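(* Let $\Omega=\{x\in\mathbf{Z}^d:0\le x_i\le L_i-1,\ 1\le i\le d\}$ be the integer points of a torus with periodic boundary conditions, and for $b:\Omega\to\mathbf{R}$ with $\sup_{\omega\in\Omega}|b(\omega)|<\frac1{2d}$ and $$b(x_1,x_2,\dots,x_d)=-b(L_1-1-x_1,x_2,\dots,x_d),\qquad x\in\Omega,$$ let $q(b)$ be the effective diffusion constant. Then: (a) For $d=1$ one has $q(b)\le\frac12$. (b) If $d\ge1$ and $L_1=2$, one has $q(b)\le\frac1{2d}$. (c) If $d=2$ and $L_1=4$, one has $q(b)\le\frac14$. (d) If $d\ge2$ and $L_1\ge6$ is even, then there exists such a $b$ with $q(b)>\frac1{2d}$.
   Context: $L_1,\dots,L_d$ are positive integers, $\mathbf{e}_1,\dots,\mathbf{e}_d$ is the standard basis of $\mathbf{Z}^d$, $\Omega$ carries the uniform probability measure, and $\tau_x:\Omega\to\Omega$, $x\in\mathbf{Z}^d$, is translation by $x$ with periodic boundary conditions. Effective diffusion constant: $q(b)\in(0,\infty)$ is the number (it exists) such that for every smooth compactly supported $f:\mathbf{R}^d\to\mathbf{R}$ the following holds. If for $\varepsilon>0$, $u_\varepsilon(x,\omega)$ ($x\in\varepsilon\mathbf{Z}^d$, $\omega\in\Omega$) is the unique bounded solution of $$u_\varepsilon(x,\omega)-\sum_{i=1}^d\frac{1}{2d}[u_\varepsilon(x+\varepsilon\mathbf{e}_i,\omega)+u_\varepsilon(x-\varepsilon\mathbf{e}_i,\omega)]-b(\tau_{x/\varepsilon}\omega)[u_\varepsilon(x+\varepsilon\mathbf{e}_1,\omega)-u_\varepsilon(x-\varepsilon\mathbf{e}_1,\omega)]+\varepsilon^2u_\varepsilon(x,\omega)=\varepsilon^2f(x),$$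 and $u$ is the bounded solution of $-q(b)\,\partial^2u/\partial x_1^2-\sum_{j=2}^d\frac1{2d}\,\partial^2u/\partial x_j^2+u=f$ on $\mathbf{R}^d$, then $\lim_{\varepsilon\to0}\sup_{x\in\mathbf{R}^d,\omega\in\Omega}|u_\varepsilon(\varepsilon\lfloor x/\varepsilon\rfloor,\omega)-u(x)|=0$.
   Formalization: In (d) it is additionally assumed that some L_j with j ≠ 1 is at least 2; if L_2 = ... = L_d = 1, then b depends only on x_1 and, by rescaling (a), q(b) ≤ 1/(2d) for every such b, so (d) fails there. *)

theory Defs
  imports "HOL-Analysis.Analysis"
begin

text \<open>
  The dimension is \<open>d = CARD('n)\<close>.  Coordinates are indexed by \<open>'n\<close>, and the parameter \<open>k\<close>
  below is the label of the distinguished (first) coordinate; the labelling of the others is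
  irrelevant.  The side lengths are \<open>L i\<close>.  A function \<open>b\<close> on \<open>torus L\<close> is represented by a
  function on all of \<open>int ^ 'n\<close>, of which only the values on \<open>torus L\<close> are ever used.
\<close>

definition torus :: "('n::finite \<Rightarrow> nat) \<Rightarrow> (int ^ 'n) set" where
  "torus L = {x. \<forall>i. 0 \<le> x $ i \<and> x $ i \<le> int (L i) - 1}"

definition translate :: "('n::finite \<Rightarrow> nat) \<Rightarrow> int ^ 'n \<Rightarrow> int ^ 'n \<Rightarrow> int ^ 'n" where
  "translate L x \<omega> = (\<chi> i. (\<omega> $ i + x $ i) mod int (L i))"

definition reflect :: "'n::finite \<Rightarrow> ('n \<Rightarrow> nat) \<Rightarrow> int ^ 'n \<Rightarrow> int ^ 'n" where
  "reflect k L x = (\<chi> i. if i = k then int (L k) - 1 - x $ k else x $ i)"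

definition admissible :: "'n::finite \<Rightarrow> ('n \<Rightarrow> nat) \<Rightarrow> (int ^ 'n \<Rightarrow> real) \<Rightarrow> bool" where
  "admissible k L b \<longleftrightarrow>
     (SUP \<omega>\<in>torus L. \<bar>b \<omega>\<bar>) < 1 / (2 * real CARD('n)) \<and>
     (\<forall>x\<in>torus L. b x = - b (reflect k L x))"

definition partial_deriv :: "'n::finite \<Rightarrow> (real ^ 'n \<Rightarrow> real) \<Rightarrow> real ^ 'n \<Rightarrow> real" where
  "partial_deriv i f x = frechet_derivative f (at x) (axis i 1)"

primrec C_class :: "nat \<Rightarrow> (real ^ 'n::finite \<Rightarrow> real) \<Rightarrow> bool" where
  "C_class 0 f \<longleftrightarrow> continuous_on UNIV f"
| "C_class (Suc m) f \<longleftrightarrow>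
     (\<forall>x. f differentiable (at x)) \<and> (\<forall>i. C_class m (partial_deriv i f))"

definition smooth :: "(real ^ 'n::finite \<Rightarrow> real) \<Rightarrow> bool" where
  "smooth f \<longleftrightarrow> (\<forall>m. C_class m f)"

definition compactly_supported :: "(real ^ 'n::finite \<Rightarrow> real) \<Rightarrow> bool" where
  "compactly_supported f \<longleftrightarrow> compact (closure {x. f x \<noteq> 0})"

definition lattice_point :: "real \<Rightarrow> int ^ 'n::finite \<Rightarrow> real ^ 'n" where
  "lattice_point \<epsilon> z = (\<chi> i. \<epsilon> * real_of_int (z $ i))"

definition lattice_floor :: "real \<Rightarrow> real ^ 'n::finite \<Rightarrow> real ^ 'n" where
  "lattice_floor \<epsilon> x = lattice_point \<epsilon> (\<chi> i. \<lfloor>x $ i / \<epsilon>\<rfloor>)"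

text \<open>
  The function \<open>v x \<omega>\<close> matters only for \<open>x\<close> in the lattice with mesh \<open>\<epsilon>\<close>, written
  \<open>x = lattice_point \<epsilon> z\<close> (so that \<open>z = x / \<epsilon>\<close>), and for \<open>\<omega>\<close> in the torus.  On this set the
  bounded solution is unique.
\<close>

definition discrete_solution ::
  "'n::finite \<Rightarrow> ('n \<Rightarrow> nat) \<Rightarrow> (int ^ 'n \<Rightarrow> real) \<Rightarrow> (real ^ 'n \<Rightarrow> real) \<Rightarrow> real \<Rightarrow>
   (real ^ 'n \<Rightarrow> int ^ 'n \<Rightarrow> real) \<Rightarrow> bool" where
  "discrete_solution k L b f \<epsilon> v \<longleftrightarrow>
     bounded {v (lattice_point \<epsilon> z) \<omega> | z \<omega>. \<omega> \<in> torus L} \<and>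
     (\<forall>z. \<forall>\<omega>\<in>torus L. let x = lattice_point \<epsilon> z; e = (\<lambda>i. axis i 1) in
        v x \<omega>
        - (\<Sum>i\<in>UNIV. 1 / (2 * real CARD('n)) * (v (x + \<epsilon> *\<^sub>R e i) \<omega> + v (x - \<epsilon> *\<^sub>R e i) \<omega>))
        - b (translate L z \<omega>) * (v (x + \<epsilon> *\<^sub>R e k) \<omega> - v (x - \<epsilon> *\<^sub>R e k) \<omega>)
        + \<epsilon>\<^sup>2 * v x \<omega>
        = \<epsilon>\<^sup>2 * f x)"

definition homogenized_solution ::
  "'n::finite \<Rightarrow> real \<Rightarrow> (real ^ 'n \<Rightarrow> real) \<Rightarrow> (real ^ 'n \<Rightarrow> real) \<Rightarrow> bool" where
  "homogenized_solution k q f u \<longleftrightarrow>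
     C_class 2 u \<and> bounded (range u) \<and>
     (\<forall>x. - q * partial_deriv k (partial_deriv k u) x
          - (\<Sum>j\<in>UNIV - {k}. 1 / (2 * real CARD('n)) * partial_deriv j (partial_deriv j u) x)
          + u x = f x)"

definition is_effective_diffusion ::
  "'n::finite \<Rightarrow> ('n \<Rightarrow> nat) \<Rightarrow> (int ^ 'n \<Rightarrow> real) \<Rightarrow> real \<Rightarrow> bool" where
  "is_effective_diffusion k L b q \<longleftrightarrow> 0 < q \<and>
     (\<forall>f v u. smooth f \<longrightarrow> compactly_supported f \<longrightarrow>
        (\<forall>\<epsilon>>0. discrete_solution k L b f \<epsilon> (v \<epsilon>)) \<longrightarrow>
        homogenized_solution k q f u \<longrightarrow>
        ((\<lambda>\<epsilon>. SUP (x, \<omega>)\<in>UNIV \<times> torus L. \<bar>v \<epsilon> (lattice_floor \<epsilon> x) \<omega> - u x\<bar>) \<longlongrightarrow> 0)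
          (at_right 0))"

definition effective_diffusion ::
  "'n::finite \<Rightarrow> ('n \<Rightarrow> nat) \<Rightarrow> (int ^ 'n \<Rightarrow> real) \<Rightarrow> real" where
  "effective_diffusion k L b = (THE q. is_effective_diffusion k L b q)"

end

theory Submission
  imports Defs
begin

text \<open>
  Extend \<open>b\<close> periodically to \<open>\<beta>\<close> on the lattice. The walk with jump probabilities
  \<open>1/(2d) \<plusminus> \<beta>\<close> along \<open>k\<close> and \<open>1/(2d)\<close> otherwise has an odd corrector \<open>\<phi>\<close>, because \<open>\<beta>\<close> is odd
  under the reflection, and the effective constant \<open>q\<close> is the solvability constant of the
  second-order cell problem. Homogenization follows by inserting
  \<open>u + \<epsilon> \<phi> \<partial>\<^sub>k u + \<epsilon>\<^sup>2 \<Sum>\<^sub>i \<psi>\<^sub>i \<partial>\<^sub>i \<partial>\<^sub>k u\<close> into the discrete equation and comparing on large balls with a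
  corrected quadratic barrier; no regularity of \<open>u\<close> beyond \<open>C\<^sup>2\<close> is needed, and far away both solutions
  are small because \<open>f\<close> has compact support.

  The upper bounds pair the second cell problem with the invariant measure of the walk. In dimension
  one it is explicit and reversible, and the bound is the arithmetic-harmonic mean inequality. For
  period two the walk on the torus is symmetric. For period four in dimension two the invariant
  density is \<open>1 \<plusminus> h\<close>, and \<open>1/4 - q\<close> becomes a sum of squares. For period at least six, second-order
  perturbation in the drift \<open>t sin(\<theta>(x\<^sub>k + 1/2)) cos(\<eta> x\<^sub>j)\<close> gives \<open>q - 1/(2d) = K t\<^sup>2 + O(t\<^sup>3)\<close> where
  \<open>K\<close> is a positive multiple of \<open>2 cos \<theta> - 1 - cos \<theta> cos \<eta> > 0\<close>.
\<close>

subsection \<open>Random walks with periodic coefficients\<close>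

text \<open>\<open>effective_diffusion\<close> is a definite description over a condition that
  quantifies over solutions of two equations. A cell constant must therefore be shown to satisfy
  that condition and to be the only number that does. The second half needs one source term for
  which bounded homogenized solutions are at hand for two different constants; (1 - A)(1 - A')w is
  such a source, where A and A' are the two constant-coefficient operators and w is a product of
  bump functions. The number six enters through \<theta> = 2 pi / L_k: from period six on, cos
  \<theta> is at least 1/2 and 2 cos \<theta> - 1 is nonnegative, while a negative cos \<eta> makes
  the remaining term strictly positive. With \<eta> = 0 the same expression is cos \<theta> - 1 < 0,
  so within this family a drift that is constant transversally lowers q to second order. This is why
  a second coordinate with period at least two is asked for.\<close>

definition wrap :: "('n::finite \<Rightarrow> nat) \<Rightarrow> int ^ 'n \<Rightarrow> int ^ 'n" where
  "wrap L y = (\<chi> i. y $ i mod int (L i))"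

definition periodic :: "('n::finite \<Rightarrow> nat) \<Rightarrow> (int ^ 'n \<Rightarrow> real) \<Rightarrow> bool" where
  "periodic L g \<longleftrightarrow> (\<forall>y. g (wrap L y) = g y)"

text \<open>The probability of a jump from \<open>y\<close> by \<open>s = 1\<close> or \<open>s = -1\<close> in direction \<open>i\<close>.\<close>

definition rate :: "'n::finite \<Rightarrow> (int ^ 'n \<Rightarrow> real) \<Rightarrow> real \<Rightarrow> 'n \<Rightarrow> int ^ 'n \<Rightarrow> real" where
  "rate k \<beta> s i y = 1 / (2 * real CARD('n)) + (if i = k then s * \<beta> y else 0)"

definition step :: "'n::finite \<Rightarrow> (int ^ 'n \<Rightarrow> real) \<Rightarrow> (int ^ 'n \<Rightarrow> real) \<Rightarrow> int ^ 'n \<Rightarrow> real" where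
  "step k \<beta> g y = (\<Sum>i\<in>UNIV. rate k \<beta> 1 i y * g (y + axis i 1) + rate k \<beta> (-1) i y * g (y - axis i 1))"

definition flux :: "'n::finite \<Rightarrow> (int ^ 'n \<Rightarrow> real) \<Rightarrow> 'n \<Rightarrow> (int ^ 'n \<Rightarrow> real) \<Rightarrow> int ^ 'n \<Rightarrow> real" where
  "flux k \<beta> i g y = rate k \<beta> 1 i y * g (y + axis i 1) - rate k \<beta> (-1) i y * g (y - axis i 1)"

section \<open>Finite linear systems\<close>

lemma homogeneous_system_nontrivial:
  fixes A :: "'a \<Rightarrow> 'b \<Rightarrow> real"
  assumes "finite S" "finite T" "card S < card T"
  shows "\<exists>x. (\<exists>t\<in>T. x t \<noteq> 0) \<and> (\<forall>s\<in>S. (\<Sum>t\<in>T. A s t * x t) = 0)"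
  using assms
proof (induction S arbitrary: A T rule: finite_induct)
  case empty
  then have "T \<noteq> {}" by auto
  then show ?case by (intro exI[of _ "\<lambda>_. 1"]) auto
next
  case (insert s S)
  show ?case
  proof (cases "\<forall>t\<in>T. A s t = 0")
    case True
    with insert obtain x where "\<exists>t\<in>T. x t \<noteq> 0" "\<forall>s\<in>S. (\<Sum>t\<in>T. A s t * x t) = 0"
      by (metis card_insert_disjoint less_SucI less_imp_Suc_add not_less_eq Suc_lessD)
    then show ?thesis using True by auto
  next
    case False
    then obtain t0 where t0: "t0 \<in> T" "A s t0 \<noteq> 0" by auto
    \<comment> \<open>One step of Gaussian elimination: equation \<open>s\<close> is solved for the
      pivot unknown \<open>t0\<close> and substituted into the others, which leaves one equation and
      one unknown fewer.\<close>
    have "card S < card (T - {t0})" using insert t0 by simp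
    then obtain x where x: "\<exists>t\<in>T - {t0}. x t \<noteq> 0"
      and eq: "\<forall>s'\<in>S. (\<Sum>t\<in>T - {t0}. (A s' t - A s' t0 * A s t / A s t0) * x t) = 0"
      using insert.IH[of "T - {t0}" "\<lambda>s' t. A s' t - A s' t0 * A s t / A s t0"] insert.prems
      by auto
    define r where "r = (\<Sum>t\<in>T - {t0}. A s t * x t)"
    define y where "y = x(t0 := - r / A s t0)"
    have split: "(\<Sum>t\<in>T. A s' t * y t) = (\<Sum>t\<in>T - {t0}. A s' t * x t) - A s' t0 * r / A s t0" for s'
    proof -
      have "(\<Sum>t\<in>T. A s' t * y t) = A s' t0 * y t0 + (\<Sum>t\<in>T - {t0}. A s' t * y t)"
        using insert.prems t0 by (simp add: sum.remove)
      also have "(\<Sum>t\<in>T - {t0}. A s' t * y t) = (\<Sum>t\<in>T - {t0}. A s' t * x t)"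
        by (rule sum.cong) (auto simp: y_def)
      finally show ?thesis by (simp add: y_def)
    qed
    have "(\<Sum>t\<in>T. A s' t * y t) = 0" if "s' \<in> insert s S" for s'
    proof (cases "s' = s")
      case True
      then show ?thesis using split[of s] t0 by (simp add: r_def)
    next
      case False
      then have "0 = (\<Sum>t\<in>T - {t0}. (A s' t - A s' t0 * A s t / A s t0) * x t)"
        using eq that by auto
      also have "\<dots> = (\<Sum>t\<in>T - {t0}. A s' t * x t) - A s' t0 / A s t0 * r"
        by (simp add: r_def sum_subtractf sum_distrib_left algebra_simps)
      finally show ?thesis using split[of s'] by simp
    qed
    moreover have "\<exists>t\<in>T. y t \<noteq> 0" using x by (auto simp: y_def)
    ultimately show ?thesis by blast
  qed
qed

text \<open>The right-hand side becomes one more unknown \<open>None\<close> with coefficient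
  \<open>- g\<close>, so there are more unknowns than equations. Injectivity prevents the
  \<open>None\<close> coordinate of a nontrivial solution from being zero, and dividing by it solves
  the system.\<close>

lemma finite_system_solvable:
  fixes A :: "'a \<Rightarrow> 'a \<Rightarrow> real"
  assumes "finite S"
    and inj: "\<And>x. (\<And>s. s \<in> S \<Longrightarrow> (\<Sum>t\<in>S. A s t * x t) = 0) \<Longrightarrow> \<forall>t\<in>S. x t = 0"
  shows "\<exists>x. \<forall>s\<in>S. (\<Sum>t\<in>S. A s t * x t) = g s"
proof -
  define T where "T = insert None (Some ` S)"
  define B where "B s t = (case t of None \<Rightarrow> - g s | Some t \<Rightarrow> A s t)" for s t
  have "finite T" "card T = Suc (card S)"
    using assms(1) by (auto simp: T_def card_insert_if card_image)
  then obtain x where x: "\<exists>t\<in>T. x t \<noteq> 0" and eq: "\<forall>s\<in>S. (\<Sum>t\<in>T. B s t * x t) = 0"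
    using homogeneous_system_nontrivial[of S T B] assms(1) by auto
  have eq': "(\<Sum>t\<in>S. A s t * x (Some t)) = g s * x None" if "s \<in> S" for s
  proof -
    have "(\<Sum>t\<in>T. B s t * x t) = - g s * x None + (\<Sum>t\<in>S. A s t * x (Some t))"
      unfolding T_def using assms(1) by (subst sum.insert) (auto simp: B_def sum.reindex)
    then show ?thesis using eq that by simp
  qed
  have "x None \<noteq> 0"
  proof
    assume "x None = 0"
    then have "\<forall>t\<in>S. x (Some t) = 0" using inj[of "\<lambda>t. x (Some t)"] eq' by simp
    then show False using x \<open>x None = 0\<close> by (auto simp: T_def)
  qed
  then show ?thesis using eq'
    by (intro exI[of _ "\<lambda>t. x (Some t) / x None"]) (simp flip: sum_divide_distrib)
qed

section \<open>The torus and periodic functions on the lattice\<close>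

lemma finite_torus: "finite (torus (L :: 'n::finite \<Rightarrow> nat))"
proof -
  have "inj (vec_nth :: int ^ 'n \<Rightarrow> _)" by (simp add: inj_def vec_nth_inject)
  moreover have "vec_nth ` torus L \<subseteq> PiE UNIV (\<lambda>i. {0..int (L i) - 1})"
    by (auto simp: torus_def)
  then have "finite (vec_nth ` torus L)"
    by (rule finite_subset) (auto intro: finite_PiE)
  ultimately show ?thesis by (metis finite_imageD inj_on_subset subset_UNIV)
qed

lemma periodic_cong:
  assumes "periodic L g" "\<And>i. y $ i mod int (L i) = z $ i mod int (L i)"
  shows "g y = g z"
proof -
  have "wrap L y = wrap L z" using assms(2) by (simp add: wrap_def vec_eq_iff)
  then show ?thesis using assms(1) unfolding periodic_def by metis
qed

lemma wrap_nth: "wrap L y $ i = y $ i mod int (L i)"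
  by (simp add: wrap_def)

lemma periodicI: "(\<And>y. g (wrap L y) = g y) \<Longrightarrow> periodic L g"
  by (simp add: periodic_def)

lemma periodic_const [simp]: "periodic L (\<lambda>_. c)"
  by (simp add: periodic_def)

lemma periodic_shift:
  assumes "periodic L g" shows "periodic L (\<lambda>y. g (y + a))"
  by (rule periodicI, rule periodic_cong[OF assms]) (simp add: wrap_nth mod_simps)

lemma periodic_shift_minus:
  assumes "periodic L g" shows "periodic L (\<lambda>y. g (y - a))"
  using periodic_shift[OF assms, of "- a"] by simp

lemma periodic_add: "periodic L f \<Longrightarrow> periodic L g \<Longrightarrow> periodic L (\<lambda>y. f y + g y)"
  by (simp add: periodic_def)

lemma periodic_diff: "periodic L f \<Longrightarrow> periodic L g \<Longrightarrow> periodic L (\<lambda>y. f y - g y)"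
  by (simp add: periodic_def)

lemma periodic_mult: "periodic L f \<Longrightarrow> periodic L g \<Longrightarrow> periodic L (\<lambda>y. f y * g y)"
  by (simp add: periodic_def)

lemma periodic_uminus: "periodic L f \<Longrightarrow> periodic L (\<lambda>y. - f y)"
  by (simp add: periodic_def)

lemma periodic_divide: "periodic L f \<Longrightarrow> periodic L (\<lambda>y. f y / c)"
  by (simp add: periodic_def)

lemma periodic_sum: "(\<And>i. i \<in> S \<Longrightarrow> periodic L (f i)) \<Longrightarrow> periodic L (\<lambda>y. \<Sum>i\<in>S. f i y)"
  by (simp add: periodic_def)

lemma periodic_rate: "periodic L \<beta> \<Longrightarrow> periodic L (rate k \<beta> s i)"
  by (simp add: periodic_def rate_def)

lemma periodic_reflect:
  assumes "periodic L g" shows "periodic L (\<lambda>y. g (reflect k L y))"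
proof (rule periodicI, rule periodic_cong[OF assms])
  fix y :: "int ^ 'a" and i
  show "reflect k L (wrap L y) $ i mod int (L i) = reflect k L y $ i mod int (L i)"
    by (simp add: reflect_def wrap_nth) (metis mod_diff_right_eq)
qed

lemmas periodic_intros = periodic_const periodic_add periodic_diff periodic_mult periodic_uminus
  periodic_divide periodic_sum periodic_shift periodic_shift_minus periodic_rate periodic_reflect

lemma periodic_step: "periodic L \<beta> \<Longrightarrow> periodic L g \<Longrightarrow> periodic L (step k \<beta> g)"
  unfolding step_def by (intro periodic_intros)

lemma periodic_flux: "periodic L \<beta> \<Longrightarrow> periodic L g \<Longrightarrow> periodic L (flux k \<beta> i g)"
  unfolding flux_def by (intro periodic_intros)

section \<open>The averaging operator of the walk\<close>

lemma sum_rates: "(\<Sum>i\<in>UNIV. rate k \<beta> 1 i y + rate k \<beta> (-1) i y) = 1"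
proof -
  have "rate k \<beta> 1 i y + rate k \<beta> (-1) i y = 1 / real CARD('a)" for i :: 'a
    by (simp add: rate_def field_simps)
  then show ?thesis by simp
qed

lemma step_add: "step k \<beta> (\<lambda>y. f y + g y) y = step k \<beta> f y + step k \<beta> g y"
  by (simp add: step_def sum.distrib[symmetric] algebra_simps)

lemma step_diff: "step k \<beta> (\<lambda>y. f y - g y) y = step k \<beta> f y - step k \<beta> g y"
  by (simp add: step_def sum_subtractf[symmetric] algebra_simps)

lemma step_cmult: "step k \<beta> (\<lambda>y. c * f y) y = c * step k \<beta> f y"
  by (simp add: step_def sum_distrib_left algebra_simps)

lemma step_uminus: "step k \<beta> (\<lambda>y. - f y) y = - step k \<beta> f y"
  using step_cmult[of k \<beta> "-1" f y] by simp

lemma step_sum: "step k \<beta> (\<lambda>y. \<Sum>i\<in>S. f i y) y = (\<Sum>i\<in>S. step k \<beta> (f i) y)"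
  by (simp add: step_def sum_distrib_left sum.swap[of _ S] sum.distrib)

lemma step_const: "step k \<beta> (\<lambda>_. c) y = c"
proof -
  have "step k \<beta> (\<lambda>_. c) y = (\<Sum>i\<in>UNIV. rate k \<beta> 1 i y + rate k \<beta> (-1) i y) * c"
    by (simp only: step_def sum_distrib_right distrib_right)
  then show ?thesis by (simp add: sum_rates)
qed

lemma rate_nonneg:
  fixes \<beta> :: "int ^ 'n::finite \<Rightarrow> real"
  assumes "\<bar>\<beta> y\<bar> \<le> 1 / (2 * real CARD('n))" "s \<in> {1, -1}"
  shows "rate k \<beta> s i y \<ge> 0"
  using assms unfolding rate_def by (cases "i = k") auto

lemma step_mono:
  fixes \<beta> :: "int ^ 'n::finite \<Rightarrow> real"
  assumes "\<bar>\<beta> y\<bar> \<le> 1 / (2 * real CARD('n))"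
    and "\<And>i. f (y + axis i 1) \<le> g (y + axis i 1)" "\<And>i. f (y - axis i 1) \<le> g (y - axis i 1)"
  shows "step k \<beta> f y \<le> step k \<beta> g y"
  unfolding step_def
  by (intro sum_mono add_mono mult_left_mono rate_nonneg assms) auto

lemma torus_wrap: "\<forall>i. L i > 0 \<Longrightarrow> wrap L y \<in> torus L"
  by (auto simp: torus_def wrap_nth)

lemma wrap_torus: "y \<in> torus L \<Longrightarrow> wrap L y = y"
  by (auto simp: torus_def wrap_def vec_eq_iff)

section \<open>Maximum principles for periodic functions\<close>

lemma periodic_attains_max:
  assumes "\<forall>i. L i > 0" "periodic L g"
  obtains y0 where "\<And>y. g y \<le> g y0"
proof -
  have ne: "torus L \<noteq> {}" using torus_wrap[OF assms(1)] by blast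
  then have "Max (g ` torus L) \<in> g ` torus L"
    by (intro Max_in) (auto simp: finite_torus)
  then obtain y0 where y0: "Max (g ` torus L) = g y0" by auto
  have "g y \<le> g y0" for y
  proof -
    have "g (wrap L y) \<le> Max (g ` torus L)"
      using torus_wrap[OF assms(1)] by (intro Max_ge) (auto simp: finite_torus)
    then show ?thesis using assms(2) y0 by (simp add: periodic_def)
  qed
  with that show ?thesis by blast
qed

lemma periodic_bounded:
  assumes "\<forall>i. L i > 0" "periodic L g"
  obtains K where "0 \<le> K" "\<And>y. \<bar>g y\<bar> \<le> K"
proof -
  have "periodic L (\<lambda>y. \<bar>g y\<bar>)" using assms(2) by (simp add: periodic_def)
  then obtain y0 where "\<And>y. \<bar>g y\<bar> \<le> \<bar>g y0\<bar>" using periodic_attains_max[OF assms(1)] by blast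
  then show ?thesis using that[of "\<bar>g y0\<bar>"] by simp
qed

text \<open>The deficit \<open>m - g\<close> is nonnegative and its average over one jump is at most
  \<open>m - g y + G\<close>. Each neighbour is hit with probability at least \<open>p\<close>, so a
  single deficit is at most \<open>1 / p\<close> times this average.\<close>

lemma neighbour_deficit:
  fixes \<beta> :: "int ^ 'n::finite \<Rightarrow> real"
  assumes p: "0 < p" "\<And>y i s. s \<in> {1, -1} \<Longrightarrow> p \<le> rate k \<beta> s i y"
    and le: "\<And>y. g y - step k \<beta> g y \<le> G" and max: "\<And>y. g y \<le> m"
  shows "p * (m - g (y + axis i 1)) \<le> m - g y + G"
proof -
  have r: "0 \<le> rate k \<beta> s i y" if "s \<in> {1, -1}" for s i using p(1) p(2)[OF that, of i y] by linarith
  have "p * (m - g (y + axis i 1)) \<le> rate k \<beta> 1 i y * (m - g (y + axis i 1))"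
    using p max by (intro mult_right_mono) auto
  also have "\<dots> \<le> rate k \<beta> 1 i y * (m - g (y + axis i 1)) + rate k \<beta> (-1) i y * (m - g (y - axis i 1))"
    using r max by simp
  also have "\<dots> \<le> step k \<beta> (\<lambda>y. m - g y) y"
    unfolding step_def
    by (rule member_le_sum[of i UNIV "\<lambda>i. rate k \<beta> 1 i y * (m - g (y + axis i 1)) + rate k \<beta> (-1) i y * (m - g (y - axis i 1))"])
       (auto intro!: add_nonneg_nonneg mult_nonneg_nonneg r simp: max)
  also have "\<dots> = m - step k \<beta> g y" by (simp add: step_diff step_const)
  finally show ?thesis using le[of y] by linarith
qed

text \<open>Starting from a maximum point, the deficit grows at most by a constant factor per lattice step.\<close>

lemma oscillation_bound:
  fixes \<beta> :: "int ^ 'n::finite \<Rightarrow> real" and L :: "'n \<Rightarrow> nat"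
  assumes L: "\<forall>i. L i > 0" and per: "periodic L g"
    and p: "0 < p" "p \<le> 1" "\<And>y i s. s \<in> {1, -1} \<Longrightarrow> p \<le> rate k \<beta> s i y"
    and le: "\<And>y. g y - step k \<beta> g y \<le> G" and "0 \<le> G"
  shows "g x - g y \<le> (2 / p) ^ (\<Sum>i\<in>UNIV. L i) * G"
proof -
  obtain y0 where y0: "\<And>y. g y \<le> g y0" using periodic_attains_max[OF L per] by blast
  have ge1: "1 \<le> (2 / p) ^ n" for n using p by (intro one_le_power) (simp add: field_simps)
  have reach: "g y0 - g (y0 + z) \<le> (2 / p) ^ n * G"
    if "\<And>i. 0 \<le> z $ i" "(\<Sum>i\<in>UNIV. nat (z $ i)) = n" for n and z :: "int ^ 'n"
    using that
  proof (induction n arbitrary: z)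
    case 0
    then have "\<forall>i. nat (z $ i) = 0" by (metis finite sum_eq_0_iff UNIV_I)
    then have "z = 0" using 0(1) by (metis antisym nat_0_iff vec_eq_iff zero_index)
    then show ?case using \<open>0 \<le> G\<close> by simp
  next
    case (Suc n)
    then obtain i where i: "0 < nat (z $ i)"
      by (metis Zero_not_Suc gr_zeroI sum.neutral)
    define z' where "z' = z - axis i 1"
    have z'i: "z' $ j = (if j = i then z $ i - 1 else z $ j)" for j
      by (simp add: z'_def axis_def)
    have "(\<Sum>j\<in>UNIV. nat (z $ j)) = nat (z $ i) + (\<Sum>j\<in>UNIV - {i}. nat (z $ j))"
      by (simp add: sum.remove)
    moreover have "(\<Sum>j\<in>UNIV. nat (z' $ j)) = nat (z' $ i) + (\<Sum>j\<in>UNIV - {i}. nat (z' $ j))"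
      by (simp add: sum.remove)
    moreover have "(\<Sum>j\<in>UNIV - {i}. nat (z' $ j)) = (\<Sum>j\<in>UNIV - {i}. nat (z $ j))"
      by (rule sum.cong) (auto simp: z'i)
    ultimately have "(\<Sum>j\<in>UNIV. nat (z' $ j)) = n" using Suc.prems(2) i by (simp add: z'i)
    moreover have "0 \<le> z' $ j" for j using Suc.prems(1)[of j] i by (auto simp: z'i)
    ultimately have IH: "g y0 - g (y0 + z') \<le> (2 / p) ^ n * G" by (rule Suc.IH[rotated])
    \<comment> \<open>The factor \<open>2 / p\<close> per lattice step: \<open>1 / p\<close> comes
      from \<open>neighbour_deficit\<close>, and 2 from bounding the source \<open>G\<close> by
      another copy of the current bound.\<close>
    have "p * (g y0 - g (y0 + z' + axis i 1)) \<le> g y0 - g (y0 + z') + G"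
      by (rule neighbour_deficit[OF p(1,3) le y0])
    also have "\<dots> \<le> (2 / p) ^ n * G + 1 * G" using IH by simp
    also have "\<dots> \<le> (2 / p) ^ n * G + (2 / p) ^ n * G"
      by (intro add_left_mono mult_right_mono ge1 \<open>0 \<le> G\<close>)
    also have "\<dots> = p * ((2 / p) ^ Suc n * G)" using p by simp
    finally have "g y0 - g (y0 + z' + axis i 1) \<le> (2 / p) ^ Suc n * G"
      using p(1) by (subst (asm) mult_le_cancel_left_pos)
    then show ?case by (simp add: z'_def)
  qed
  \<comment> \<open>By periodicity every point is reached from \<open>y0\<close> by a displacement
    with coordinates between 0 and \<open>L i\<close>, so upward moves suffice and their number is
    at most the sum of the periods.\<close>
  have "g y = g (y0 + wrap L (y - y0))"
    by (rule periodic_cong[OF per]) (simp add: wrap_nth mod_simps)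
  moreover have "(\<Sum>i\<in>UNIV. nat (wrap L (y - y0) $ i)) \<le> (\<Sum>i\<in>UNIV. L i)"
  proof (rule sum_mono)
    fix i
    have "(y $ i - y0 $ i) mod int (L i) < int (L i)" using L by simp
    then show "nat (wrap L (y - y0) $ i) \<le> L i" by (simp add: wrap_nth)
  qed
  then have "(2 / p) ^ (\<Sum>i\<in>UNIV. nat (wrap L (y - y0) $ i)) \<le> (2 / p) ^ (\<Sum>i\<in>UNIV. L i)"
    using p by (intro power_increasing) (auto simp: field_simps)
  ultimately have "g y0 - g y \<le> (2 / p) ^ (\<Sum>i\<in>UNIV. L i) * G"
    using reach[OF _ refl, of "wrap L (y - y0)"] L \<open>0 \<le> G\<close>
    by (simp add: wrap_nth) (smt (verit) mult_right_mono)
  then show ?thesis using y0[of x] by linarith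
qed

subsection \<open>Correctors\<close>

text \<open>\<open>\<phi>\<close> and \<open>\<psi> i\<close> are the coefficients of \<open>\<epsilon> \<partial>\<^sub>k u\<close> and \<open>\<epsilon>\<^sup>2 \<partial>\<^sub>i \<partial>\<^sub>k u\<close> in the two-scale expansion;
  \<open>q\<close> is the constant that makes the second equation solvable.\<close>

definition cell :: "'n::finite \<Rightarrow> (int ^ 'n \<Rightarrow> real) \<Rightarrow> (int ^ 'n \<Rightarrow> real) \<Rightarrow> ('n \<Rightarrow> int ^ 'n \<Rightarrow> real) \<Rightarrow> real \<Rightarrow> bool" where
  "cell k \<beta> \<phi> \<psi> q \<longleftrightarrow>
     (\<forall>y. \<phi> y - step k \<beta> \<phi> y = 2 * \<beta> y) \<and>
     (\<forall>i y. \<psi> i y - step k \<beta> (\<psi> i) y = flux k \<beta> i \<phi> y - (if i = k then q - 1 / (2 * real CARD('n)) else 0))"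

locale walk =
  fixes k :: "'n::finite" and L :: "'n \<Rightarrow> nat" and \<beta> :: "int ^ 'n \<Rightarrow> real"
  assumes L: "\<forall>i. L i > 0" and per: "periodic L \<beta>"
    and bound: "\<bar>\<beta> y\<bar> < 1 / (2 * real CARD('n))"
begin

text \<open>Pointwise ellipticity is uniform because the absolute value of \<open>\<beta>\<close>
  attains its maximum.\<close>

lemma rates_bounded_below:
  obtains p where "0 < p" "p \<le> 1" "\<And>y i s. s \<in> {1, -1} \<Longrightarrow> p \<le> rate k \<beta> s i y"
proof -
  have "periodic L (\<lambda>y. \<bar>\<beta> y\<bar>)" using per by (simp add: periodic_def)
  then obtain y0 where y0: "\<And>y. \<bar>\<beta> y\<bar> \<le> \<bar>\<beta> y0\<bar>" using periodic_attains_max[OF L] by blast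
  show ?thesis
  proof (rule that)
    show "0 < 1 / (2 * real CARD('n)) - \<bar>\<beta> y0\<bar>" using bound[of y0] by simp
    have "1 / (2 * real CARD('n)) \<le> 1" using zero_less_card_finite[where 'a='n] by (simp add: field_simps del: zero_less_card_finite)
    then show "1 / (2 * real CARD('n)) - \<bar>\<beta> y0\<bar> \<le> 1" by linarith
    show "1 / (2 * real CARD('n)) - \<bar>\<beta> y0\<bar> \<le> rate k \<beta> s i y" if "s \<in> {1, -1}" for y i s
      using that y0[of y] unfolding rate_def by auto
  qed
qed

text \<open>Strong maximum principle: the oscillation bound with \<open>G = 0\<close>.\<close>

lemma subharmonic_constant:
  assumes "periodic L g" "\<And>y. g y \<le> step k \<beta> g y"
  shows "g x = g y"
proof -
  obtain p where p: "0 < p" "p \<le> 1" "\<And>y i s. s \<in> {1, -1} \<Longrightarrow> p \<le> rate k \<beta> s i y"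
    using rates_bounded_below by blast
  have "g x - g y \<le> 0" for x y
    using oscillation_bound[OF L assms(1) p, of 0 x y] assms(2) by simp
  from this[of x y] this[of y x] show ?thesis by linarith
qed

lemma step_monotone: "(\<And>y. f y \<le> g y) \<Longrightarrow> step k \<beta> f y \<le> step k \<beta> g y"
  using bound[of y] by (intro step_mono) auto

text \<open>At a minimum of \<open>g\<close> the average over the neighbours is at least
  \<open>g\<close>, so the residual is nonpositive there. This one-sided test stands in for an
  invariant measure when \<open>q\<close> is bounded from below.\<close>

lemma residual_lower:
  assumes "periodic L g" "\<And>y. m \<le> g y - step k \<beta> g y"
  shows "m \<le> 0"
proof -
  obtain y0 where "\<And>y. - g y \<le> - g y0" using periodic_attains_max[OF L periodic_uminus[OF assms(1)]] by blast
  then have "step k \<beta> (\<lambda>_. g y0) y0 \<le> step k \<beta> g y0" by (intro step_monotone) simp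
  then show ?thesis using assms(2)[of y0] by (simp add: step_const)
qed

lemma residual_const:
  assumes "periodic L g" "\<And>y. g y - step k \<beta> g y = m"
  shows "m = 0"
proof (rule antisym)
  show "m \<le> 0" using assms by (intro residual_lower[of g]) auto
  have "- m \<le> - g y - step k \<beta> (\<lambda>y. - g y) y" for y
    using assms(2)[of y] unfolding step_uminus by linarith
  then have "- m \<le> 0" by (rule residual_lower[OF periodic_uminus[OF assms(1)]])
  then show "0 \<le> m" by simp
qed

text \<open>Adding the value at the origin makes the operator injective, so a finite-dimensional count gives the Fredholm alternative.\<close>

lemma poisson_solvable:
  assumes "periodic L g"
  shows "\<exists>\<phi> m. periodic L \<phi> \<and> (\<forall>y. \<phi> y - step k \<beta> \<phi> y = g y - m)"
proof -
  \<comment> \<open>\<open>A\<close> is the matrix of \<open>g - step k \<beta> g + g 0\<close> on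
    one period; jumps that leave the period are wrapped back.\<close>
  define A where "A s t = of_bool (s = t) + of_bool (0 = t)
     - (\<Sum>i\<in>UNIV. rate k \<beta> 1 i s * of_bool (wrap L (s + axis i 1) = t) + rate k \<beta> (-1) i s * of_bool (wrap L (s - axis i 1) = t))" for s t
  define ext where "ext x y = x (wrap L y)" for x :: "int ^ 'n \<Rightarrow> real" and y
  have per_ext: "periodic L (ext x)" for x
    by (rule periodicI) (simp add: ext_def wrap_def)
  have delta: "(\<Sum>t\<in>torus L. of_bool (s = t) * x t) = x s" if "s \<in> torus L" for s and x :: "int ^ 'n \<Rightarrow> real"
    using that finite_torus[of L] by (simp add: of_bool_def if_distrib[of "\<lambda>c. c * _"] cong: if_cong)
  have zero: "0 \<in> torus L" using L by (auto simp: torus_def Suc_le_eq)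
  have A: "(\<Sum>t\<in>torus L. A s t * x t) = ext x s - step k \<beta> (ext x) s + ext x 0" if s: "s \<in> torus L" for s x
  proof -
    have "(\<Sum>t\<in>torus L. A s t * x t) = (\<Sum>t\<in>torus L. of_bool (s = t) * x t) + (\<Sum>t\<in>torus L. of_bool (0 = t) * x t)
       - (\<Sum>t\<in>torus L. \<Sum>i\<in>UNIV. rate k \<beta> 1 i s * (of_bool (wrap L (s + axis i 1) = t) * x t)
            + rate k \<beta> (-1) i s * (of_bool (wrap L (s - axis i 1) = t) * x t))"
      unfolding A_def
      by (simp only: sum.distrib sum_subtractf sum_distrib_right left_diff_distrib distrib_right mult.assoc)
    also have "(\<Sum>t\<in>torus L. \<Sum>i\<in>UNIV. rate k \<beta> 1 i s * (of_bool (wrap L (s + axis i 1) = t) * x t)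
            + rate k \<beta> (-1) i s * (of_bool (wrap L (s - axis i 1) = t) * x t))
      = (\<Sum>i\<in>UNIV. rate k \<beta> 1 i s * x (wrap L (s + axis i 1)) + rate k \<beta> (-1) i s * x (wrap L (s - axis i 1)))"
      by (subst sum.swap) (simp only: sum.distrib sum_distrib_left[symmetric] delta torus_wrap[OF L])
    finally show ?thesis unfolding delta[OF s] delta[OF zero] using s zero
      by (simp add: ext_def wrap_torus step_def)
  qed
  have inj: "\<forall>t\<in>torus L. x t = 0" if ker: "\<And>s. s \<in> torus L \<Longrightarrow> (\<Sum>t\<in>torus L. A s t * x t) = 0" for x
  proof -
    have "periodic L (\<lambda>y. ext x y - step k \<beta> (ext x) y + ext x 0)"
      by (intro periodic_intros periodic_step per per_ext)
    moreover have "ext x s - step k \<beta> (ext x) s + ext x 0 = 0" if "s \<in> torus L" for s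
      using A[OF that, of x] ker[OF that] by simp
    ultimately have eq: "ext x y - step k \<beta> (ext x) y + ext x 0 = 0" for y
      using torus_wrap[OF L, of y] unfolding periodic_def by metis
    \<comment> \<open>A kernel element has the constant residual \<open>- ext x 0\<close>, which
      must vanish; it is then harmonic, hence constant, hence equal to its value 0 at the
      origin.\<close>
    have "ext x y - step k \<beta> (ext x) y = - ext x 0" for y using eq[of y] by linarith
    then have x0: "ext x 0 = 0" using residual_const[OF per_ext] by (metis neg_equal_0_iff_equal)
    then have "ext x y \<le> step k \<beta> (ext x) y" for y using eq[of y] by linarith
    then have "ext x y = ext x 0" for y by (intro subharmonic_constant per_ext)
    then show ?thesis using x0 by (metis ext_def wrap_torus)
  qed
  \<comment> \<open>The value at the origin turns into the constant to be subtracted: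
    \<open>m\<close> is \<open>ext x 0\<close>.\<close>
  obtain x where x: "\<forall>s\<in>torus L. (\<Sum>t\<in>torus L. A s t * x t) = g s"
    using finite_system_solvable[OF finite_torus[of L], of A g] inj by blast
  have "periodic L (\<lambda>y. ext x y - step k \<beta> (ext x) y - (g y - ext x 0))"
    by (intro periodic_intros periodic_step per per_ext assms)
  moreover have "ext x s - step k \<beta> (ext x) s - (g s - ext x 0) = 0" if "s \<in> torus L" for s
    using A[OF that, of x] x that by simp
  ultimately have "ext x y - step k \<beta> (ext x) y - (g y - ext x 0) = 0" for y
    using torus_wrap[OF L, of y] unfolding periodic_def by metis
  then show ?thesis using per_ext by (metis eq_iff_diff_eq_0)
qed

end

section \<open>Reflection symmetry\<close>

lemma reflect_reflect: "reflect k L (reflect k L y) = y"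
  by (simp add: reflect_def vec_eq_iff)

lemma reflect_plus_axis:
  "reflect k L (y + axis i 1) = (if i = k then reflect k L y - axis i 1 else reflect k L y + axis i 1)"
  "reflect k L (y - axis i 1) = (if i = k then reflect k L y + axis i 1 else reflect k L y - axis i 1)"
  by (auto simp: reflect_def vec_eq_iff axis_def)

locale odd_walk = walk k L \<beta>
  for k :: "'n::finite" and L :: "'n \<Rightarrow> nat" and \<beta> :: "int ^ 'n \<Rightarrow> real" +
  assumes odd: "\<beta> (reflect k L y) = - \<beta> y"
begin

text \<open>Reflection swaps the two jumps along \<open>k\<close>, and oddness of
  \<open>\<beta>\<close> swaps their rates.\<close>

lemma step_reflect: "step k \<beta> (\<lambda>y. g (reflect k L y)) y = step k \<beta> g (reflect k L y)"
  unfolding step_def by (intro sum.cong refl) (auto simp: reflect_plus_axis rate_def odd)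

text \<open>The unknown constant \<open>m\<close> is even while the data are odd, so the
  antisymmetric part of any solution solves the equation without it.\<close>

lemma odd_poisson_solvable:
  assumes "periodic L g" "\<And>y. g (reflect k L y) = - g y"
  shows "\<exists>\<phi>. periodic L \<phi> \<and> (\<forall>y. \<phi> (reflect k L y) = - \<phi> y) \<and> (\<forall>y. \<phi> y - step k \<beta> \<phi> y = g y)"
proof -
  obtain \<phi> m where \<phi>: "periodic L \<phi>" "\<And>y. \<phi> y - step k \<beta> \<phi> y = g y - m"
    using poisson_solvable[OF assms(1)] by blast
  define \<phi>' where "\<phi>' y = \<phi> y - \<phi> (reflect k L y)" for y
  have per': "periodic L \<phi>'" unfolding \<phi>'_def by (intro periodic_intros \<phi>)
  have eq: "\<phi>' y - step k \<beta> \<phi>' y = 2 * g y" for y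
    using \<phi>(2)[of y] \<phi>(2)[of "reflect k L y"] unfolding \<phi>'_def
    by (simp add: step_diff step_reflect assms(2))
  show ?thesis
  proof (intro exI[of _ "\<lambda>y. 1 / 2 * \<phi>' y"] conjI allI)
    show "periodic L (\<lambda>y. 1 / 2 * \<phi>' y)" by (intro periodic_intros per')
    show "1 / 2 * \<phi>' (reflect k L y) = - (1 / 2 * \<phi>' y)" for y
      by (simp add: \<phi>'_def reflect_reflect field_simps)
    show "1 / 2 * \<phi>' y - step k \<beta> (\<lambda>y. 1 / 2 * \<phi>' y) y = g y" for y
      unfolding step_cmult using eq[of y] by simp
  qed
qed

text \<open>The drift is odd, so the first corrector exists without an effective drift. Along
  \<open>i \<noteq> k\<close> the flux of the odd \<open>\<phi>\<close> is odd as well; along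
  \<open>k\<close> reflection exchanges neighbours together with their rates, the flux is even, and
  its solvability constant produces \<open>q\<close>.\<close>

lemma cell_exists:
  "\<exists>\<phi> \<psi> q. periodic L \<phi> \<and> (\<forall>y. \<phi> (reflect k L y) = - \<phi> y) \<and> (\<forall>i. periodic L (\<psi> i)) \<and> cell k \<beta> \<phi> \<psi> q"
proof -
  obtain \<phi> where \<phi>: "periodic L \<phi>" "\<And>y. \<phi> (reflect k L y) = - \<phi> y"
    "\<And>y. \<phi> y - step k \<beta> \<phi> y = 2 * \<beta> y"
    using odd_poisson_solvable[OF periodic_mult[OF periodic_const[of L 2] per]] odd by auto
  have fl: "periodic L (flux k \<beta> i \<phi>)" for i by (intro periodic_flux per \<phi>)
  obtain \<psi>k m where \<psi>k: "periodic L \<psi>k" "\<And>y. \<psi>k y - step k \<beta> \<psi>k y = flux k \<beta> k \<phi> y - m"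
    using poisson_solvable[OF fl[of k]] by blast
  have "\<exists>\<psi>. periodic L \<psi> \<and> (\<forall>y. \<psi> y - step k \<beta> \<psi> y = flux k \<beta> i \<phi> y)" if "i \<noteq> k" for i
  proof -
    have "flux k \<beta> i \<phi> (reflect k L y) = - flux k \<beta> i \<phi> y" for y
      using that \<phi>(2)[of "y + axis i 1"] \<phi>(2)[of "y - axis i 1"]
      by (simp add: flux_def rate_def reflect_plus_axis algebra_simps)
    then show ?thesis using odd_poisson_solvable[OF fl[of i]] by blast
  qed
  then obtain \<psi> where \<psi>: "\<And>i. i \<noteq> k \<Longrightarrow> periodic L (\<psi> i)"
    "\<And>i y. i \<noteq> k \<Longrightarrow> \<psi> i y - step k \<beta> (\<psi> i) y = flux k \<beta> i \<phi> y" by metis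
  have "cell k \<beta> \<phi> (\<psi>(k := \<psi>k)) (1 / (2 * real CARD('n)) + m)"
    unfolding cell_def using \<phi> \<psi> \<psi>k by auto
  moreover have "periodic L ((\<psi>(k := \<psi>k)) i)" for i using \<psi> \<psi>k by auto
  ultimately show ?thesis using \<phi> by blast
qed

end

section \<open>The energy identity and positivity of \<open>q\<close>\<close>

context walk
begin

text \<open>The function \<open>y $ k + \<phi> y\<close> is harmonic, and \<open>\<Gamma>\<close> is
  its mean squared increment over one jump. Subtracting half the square of \<open>\<phi>\<close>
  from the second corrector turns the flux into this nonnegative density, which exhibits
  \<open>q\<close> as half of a mean energy.\<close>

lemma cell_energy:
  assumes "cell k \<beta> \<phi> \<psi> q"
  defines "\<Gamma> \<equiv> \<lambda>y. \<Sum>i\<in>UNIV. rate k \<beta> 1 i y * (of_bool (i = k) + \<phi> (y + axis i 1) - \<phi> y)\<^sup>2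
    + rate k \<beta> (-1) i y * (- of_bool (i = k) + \<phi> (y - axis i 1) - \<phi> y)\<^sup>2"
    and "\<zeta> \<equiv> \<lambda>y. \<psi> k y - \<phi> y * \<phi> y / 2"
  shows "\<zeta> y - step k \<beta> \<zeta> y = \<Gamma> y / 2 - q"
proof -
  let ?c = "1 / (2 * real CARD('n))"
  let ?p = "\<lambda>i. rate k \<beta> 1 i y" and ?m = "\<lambda>i. rate k \<beta> (-1) i y"
  let ?u = "\<lambda>i. \<phi> (y + axis i 1)" and ?d = "\<lambda>i. \<phi> (y - axis i 1)"
  define A where "A i = ?p i * (?u i * ?u i) + ?m i * (?d i * ?d i)" for i
  define B where "B i = ?p i * ?u i + ?m i * ?d i" for i
  define C where "C i = ?p i + ?m i" for i
  \<comment> \<open>\<open>E\<close> collects the terms of the square that involve the unit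
    increment of the coordinate; they occur only for \<open>i = k\<close>.\<close>
  define E where "E i = (?p i + ?m i) + 2 * (?p i * ?u i - ?m i * ?d i) - 2 * \<phi> y * (?p i - ?m i)" for i
  have "\<Gamma> y = (\<Sum>i\<in>UNIV. A i - 2 * \<phi> y * B i + (\<phi> y)\<^sup>2 * C i + (if i = k then E i else 0))"
    unfolding \<Gamma>_def A_def B_def C_def E_def
    by (rule sum.cong) (auto simp: power2_eq_square algebra_simps)
  also have "\<dots> = sum A UNIV - 2 * \<phi> y * sum B UNIV + (\<phi> y)\<^sup>2 * sum C UNIV + E k"
    by (simp only: sum.distrib sum_subtractf sum_distrib_left[symmetric]) simp
  also have "sum A UNIV = step k \<beta> (\<lambda>y. \<phi> y * \<phi> y) y" by (simp add: step_def A_def)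
  also have "sum B UNIV = step k \<beta> \<phi> y" by (simp add: step_def B_def)
  also have "sum C UNIV = 1" by (simp add: C_def sum_rates)
  also have "E k = (?p k + ?m k) + 2 * flux k \<beta> k \<phi> y - 2 * \<phi> y * (?p k - ?m k)"
    by (simp add: E_def flux_def)
  also have "?p k + ?m k = 2 * ?c" by (simp add: rate_def)
  also have "?p k - ?m k = 2 * \<beta> y" by (simp add: rate_def)
  finally have \<Gamma>: "\<Gamma> y = step k \<beta> (\<lambda>y. \<phi> y * \<phi> y) y - 2 * \<phi> y * step k \<beta> \<phi> y + (\<phi> y)\<^sup>2 * 1
      + (2 * ?c + 2 * flux k \<beta> k \<phi> y - 2 * \<phi> y * (2 * \<beta> y))" .
  have "2 * \<beta> y = \<phi> y - step k \<beta> \<phi> y" and \<psi>: "\<psi> k y - step k \<beta> (\<psi> k) y = flux k \<beta> k \<phi> y - (q - ?c)"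
    using assms(1) by (auto simp: cell_def)
  then have "\<Gamma> y / 2 = step k \<beta> (\<lambda>y. \<phi> y * \<phi> y) y / 2 - (\<phi> y)\<^sup>2 / 2 + ?c + flux k \<beta> k \<phi> y"
    unfolding \<Gamma> \<open>2 * \<beta> y = _\<close>
    by (simp add: power2_eq_square algebra_simps add_divide_distrib diff_divide_distrib)
  moreover have "step k \<beta> \<zeta> y = step k \<beta> (\<psi> k) y - step k \<beta> (\<lambda>y. \<phi> y * \<phi> y) y / 2"
    unfolding \<zeta>_def step_diff using step_cmult[of k \<beta> "1/2" "\<lambda>y. \<phi> y * \<phi> y" y] by simp
  ultimately show ?thesis using \<psi> unfolding \<zeta>_def power2_eq_square by argo
qed

text \<open>If \<open>q \<le> 0\<close>, then \<open>\<zeta>\<close> is superharmonic, hence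
  constant, and the energy density vanishes. Then \<open>y $ k + \<phi> y\<close> would be constant
  along \<open>k\<close>, which a periodic \<open>\<phi>\<close> does not allow.\<close>

lemma cell_positive:
  assumes "cell k \<beta> \<phi> \<psi> q" and \<phi>: "periodic L \<phi>" and \<psi>: "periodic L (\<psi> k)"
  shows "0 < q"
proof (rule ccontr)
  assume "\<not> 0 < q"
  define a where "a i y = rate k \<beta> 1 i y * (of_bool (i = k) + \<phi> (y + axis i 1) - \<phi> y)\<^sup>2" for i y
  define b where "b i y = rate k \<beta> (-1) i y * (- of_bool (i = k) + \<phi> (y - axis i 1) - \<phi> y)\<^sup>2" for i y
  define \<zeta> where "\<zeta> y = \<psi> k y - \<phi> y * \<phi> y / 2" for y
  have en: "\<zeta> y - step k \<beta> \<zeta> y = (\<Sum>i\<in>UNIV. a i y + b i y) / 2 - q" for y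
    using cell_energy[OF assms(1), of y] unfolding a_def b_def \<zeta>_def .
  have nn: "0 \<le> a i y" "0 \<le> b i y" for i y
    using bound[of y] unfolding a_def b_def by (auto intro!: mult_nonneg_nonneg rate_nonneg)
  have \<Gamma>nn: "0 \<le> (\<Sum>i\<in>UNIV. a i y + b i y)" for y by (intro sum_nonneg add_nonneg_nonneg nn)
  have per\<zeta>: "periodic L (\<lambda>y. - \<zeta> y)" unfolding \<zeta>_def by (intro periodic_intros \<phi> \<psi>)
  have "- \<zeta> y \<le> step k \<beta> (\<lambda>y. - \<zeta> y) y" for y
    unfolding step_uminus using en[of y] \<Gamma>nn[of y] \<open>\<not> 0 < q\<close> by linarith
  from subharmonic_constant[OF per\<zeta> this] have "\<zeta> x = \<zeta> y" for x y by simp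
  then have "\<zeta> = (\<lambda>_. \<zeta> 0)" by blast
  then have "step k \<beta> \<zeta> y = \<zeta> y" for y by (metis step_const)
  then have \<Gamma>0: "(\<Sum>i\<in>UNIV. a i y + b i y) = 0" for y
    using en[of y] \<Gamma>nn[of y] \<open>\<not> 0 < q\<close> by simp
  have ak: "a k y = 0" for y
  proof -
    have "\<forall>i\<in>UNIV. a i y + b i y = 0" using \<Gamma>0[of y] nn by (subst (asm) sum_nonneg_eq_0_iff) auto
    then show ?thesis using nn by (metis UNIV_I add_nonneg_eq_0_iff)
  qed
  have "rate k \<beta> 1 k y \<noteq> 0" for y using bound[of y] by (auto simp: rate_def)
  then have down: "\<phi> (y + axis k 1) = \<phi> y - 1" for y using ak[of y] by (auto simp: a_def)
  have "\<phi> (axis k (int n)) = \<phi> 0 - real n" for n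
  proof (induction n)
    case 0 show ?case by (simp add: axis_def zero_vec_def)
  next
    case (Suc n)
    have "axis k (int (Suc n)) = axis k (int n) + axis k 1" by (simp add: axis_def vec_eq_iff)
    then show ?case using down[of "axis k (int n)"] Suc by simp
  qed
  from this[of "L k"] have "\<phi> (axis k (int (L k))) \<noteq> \<phi> 0" using L by simp
  moreover have "\<phi> (axis k (int (L k))) = \<phi> 0" by (rule periodic_cong[OF \<phi>]) (simp add: axis_def)
  ultimately show False by simp
qed

end

subsection \<open>Comparison with corrected functions\<close>

lemma step_le_of_bounded:
  fixes \<beta> :: "int ^ 'n::finite \<Rightarrow> real"
  assumes "\<bar>\<beta> z\<bar> \<le> 1 / (2 * real CARD('n))" "\<And>y. W y \<le> m"
  shows "step k \<beta> W z \<le> m"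
  using step_mono[of \<beta> z W "\<lambda>_. m" k] assms by (simp add: step_const)

text \<open>On the infinite lattice the supremum need not be attained, so the supremum
  \<open>m\<close> itself is compared with \<open>m / (1 + \<epsilon>\<^sup>2)\<close>. The
  disjunction asks for the inequality only where \<open>W\<close> is positive; a barrier makes
  \<open>W\<close> nonpositive outside a ball.\<close>

lemma discrete_max_principle:
  fixes \<beta> :: "int ^ 'n::finite \<Rightarrow> real"
  assumes \<beta>: "\<And>y. \<bar>\<beta> y\<bar> \<le> 1 / (2 * real CARD('n))" and "\<epsilon> \<noteq> 0"
    and M: "\<And>z. W z \<le> M" and sub: "\<And>z. W z \<le> 0 \<or> (1 + \<epsilon>\<^sup>2) * W z \<le> step k \<beta> W z"
  shows "W z \<le> 0"
proof (rule ccontr)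
  assume "\<not> W z \<le> 0"
  define m where "m = Sup (range W)"
  have bdd: "bdd_above (range W)" by (rule bdd_aboveI2[of _ W M]) (rule M)
  have le: "W y \<le> m" for y unfolding m_def by (rule cSup_upper[OF _ bdd]) simp
  have m: "0 < m" using le[of z] \<open>\<not> W z \<le> 0\<close> by linarith
  have e: "0 < 1 + \<epsilon>\<^sup>2" by (simp add: add_pos_nonneg)
  have "W y \<le> m / (1 + \<epsilon>\<^sup>2)" for y
  proof (cases "W y \<le> 0")
    case True
    then show ?thesis using m e by (simp add: order.trans[of _ 0])
  next
    case False
    then have "(1 + \<epsilon>\<^sup>2) * W y \<le> m" using sub[of y] step_le_of_bounded[of \<beta> y W m k] \<beta> le by force
    then show ?thesis using e by (simp add: field_simps)
  qed
  then have "m \<le> m / (1 + \<epsilon>\<^sup>2)" unfolding m_def by (intro cSup_least) auto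
  then have "m * \<epsilon>\<^sup>2 \<le> 0" using e by (simp add: field_simps)
  then show False using m \<open>\<epsilon> \<noteq> 0\<close> by (simp add: mult_le_0_iff)
qed

text \<open>The jump probabilities sum to 1, so errors at the neighbours are averaged and not added
  up.\<close>

lemma step_perturb:
  fixes \<beta> :: "int ^ 'n::finite \<Rightarrow> real"
  assumes \<beta>: "\<bar>\<beta> z\<bar> \<le> 1 / (2 * real CARD('n))"
    and "\<And>i. \<bar>g (z + axis i 1) - a i\<bar> \<le> \<tau>" "\<And>i. \<bar>g (z - axis i 1) - b i\<bar> \<le> \<tau>"
  shows "\<bar>step k \<beta> g z - (\<Sum>i\<in>UNIV. rate k \<beta> 1 i z * a i + rate k \<beta> (-1) i z * b i)\<bar> \<le> \<tau>"
proof -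
  have r: "0 \<le> rate k \<beta> 1 i z" "0 \<le> rate k \<beta> (-1) i z" for i
    using \<beta> by (auto intro: rate_nonneg)
  have eq: "step k \<beta> g z - (\<Sum>i\<in>UNIV. rate k \<beta> 1 i z * a i + rate k \<beta> (-1) i z * b i)
     = (\<Sum>i\<in>UNIV. rate k \<beta> 1 i z * (g (z + axis i 1) - a i) + rate k \<beta> (-1) i z * (g (z - axis i 1) - b i))"
    by (simp add: step_def sum_subtractf[symmetric] algebra_simps)
  have "\<bar>step k \<beta> g z - (\<Sum>i\<in>UNIV. rate k \<beta> 1 i z * a i + rate k \<beta> (-1) i z * b i)\<bar>
    \<le> (\<Sum>i\<in>UNIV. \<bar>rate k \<beta> 1 i z * (g (z + axis i 1) - a i) + rate k \<beta> (-1) i z * (g (z - axis i 1) - b i)\<bar>)"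
    unfolding eq by (rule sum_abs)
  also have "\<dots> \<le> (\<Sum>i\<in>UNIV. rate k \<beta> 1 i z * \<tau> + rate k \<beta> (-1) i z * \<tau>)"
  proof (rule sum_mono)
    fix i
    have "\<bar>rate k \<beta> 1 i z * (g (z + axis i 1) - a i)\<bar> \<le> rate k \<beta> 1 i z * \<tau>"
      "\<bar>rate k \<beta> (-1) i z * (g (z - axis i 1) - b i)\<bar> \<le> rate k \<beta> (-1) i z * \<tau>"
      using r[of i] assms(2,3) by (auto simp: abs_mult intro: mult_left_mono)
    then show "\<bar>rate k \<beta> 1 i z * (g (z + axis i 1) - a i) + rate k \<beta> (-1) i z * (g (z - axis i 1) - b i)\<bar>
      \<le> rate k \<beta> 1 i z * \<tau> + rate k \<beta> (-1) i z * \<tau>" by linarith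
  qed
  also have "\<dots> = (\<Sum>i\<in>UNIV. rate k \<beta> 1 i z + rate k \<beta> (-1) i z) * \<tau>"
    by (simp only: sum_distrib_right distrib_right)
  finally show ?thesis by (simp add: sum_rates)
qed

text \<open>Discrete Leibniz rule for an oscillating factor \<open>a\<close> and a slow factor
  \<open>u\<close>: the average acts on \<open>a\<close>, and the gradient of \<open>u\<close> is
  paired with the flux of \<open>a\<close>.\<close>

lemma step_product:
  fixes \<beta> :: "int ^ 'n::finite \<Rightarrow> real"
  assumes \<beta>: "\<bar>\<beta> z\<bar> \<le> 1 / (2 * real CARD('n))" and K: "\<And>y. \<bar>a y\<bar> \<le> K" and "0 \<le> \<tau>"
    and u: "\<And>i. \<bar>u (z + axis i 1) - (u z + \<epsilon> * D i)\<bar> \<le> \<tau>" "\<And>i. \<bar>u (z - axis i 1) - (u z - \<epsilon> * D i)\<bar> \<le> \<tau>"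
  shows "\<bar>step k \<beta> (\<lambda>z. a z * u z) z - (u z * step k \<beta> a z + \<epsilon> * (\<Sum>i\<in>UNIV. D i * flux k \<beta> i a z))\<bar> \<le> K * \<tau>"
proof -
  have "\<bar>step k \<beta> (\<lambda>z. a z * u z) z - (\<Sum>i\<in>UNIV. rate k \<beta> 1 i z * (a (z + axis i 1) * (u z + \<epsilon> * D i))
      + rate k \<beta> (-1) i z * (a (z - axis i 1) * (u z - \<epsilon> * D i)))\<bar> \<le> K * \<tau>"
    using K u by (intro step_perturb \<beta>) (auto simp: right_diff_distrib[symmetric] abs_mult intro!: mult_mono order.trans[OF abs_ge_zero K])
  moreover have "(\<Sum>i\<in>UNIV. rate k \<beta> 1 i z * (a (z + axis i 1) * (u z + \<epsilon> * D i))
      + rate k \<beta> (-1) i z * (a (z - axis i 1) * (u z - \<epsilon> * D i)))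
    = u z * step k \<beta> a z + \<epsilon> * (\<Sum>i\<in>UNIV. D i * flux k \<beta> i a z)"
    unfolding step_def flux_def sum_distrib_left sum.distrib[symmetric]
    by (rule sum.cong) (auto simp: algebra_simps)
  ultimately show ?thesis by simp
qed

text \<open>The first-order terms cancel in pairs except along \<open>k\<close>, where the two rates
  differ by \<open>2 * \<beta> z\<close>.\<close>

lemma step_taylor:
  fixes \<beta> :: "int ^ 'n::finite \<Rightarrow> real"
  assumes \<beta>: "\<bar>\<beta> z\<bar> \<le> 1 / (2 * real CARD('n))"
    and u: "\<And>i. \<bar>u (z + axis i 1) - (u z + \<epsilon> * D i + \<epsilon>\<^sup>2 / 2 * h i)\<bar> \<le> \<tau>"
      "\<And>i. \<bar>u (z - axis i 1) - (u z - \<epsilon> * D i + \<epsilon>\<^sup>2 / 2 * h i)\<bar> \<le> \<tau>"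
  shows "\<bar>step k \<beta> u z - (u z + \<epsilon> * (2 * \<beta> z * D k) + \<epsilon>\<^sup>2 * (1 / (2 * real CARD('n)) * (\<Sum>i\<in>UNIV. h i)))\<bar> \<le> \<tau>"
proof -
  let ?c = "1 / (2 * real CARD('n))"
  have "(\<Sum>i\<in>UNIV. rate k \<beta> 1 i z * (u z + \<epsilon> * D i + \<epsilon>\<^sup>2 / 2 * h i) + rate k \<beta> (-1) i z * (u z - \<epsilon> * D i + \<epsilon>\<^sup>2 / 2 * h i))
     = (\<Sum>i\<in>UNIV. u z * (rate k \<beta> 1 i z + rate k \<beta> (-1) i z) + (if i = k then \<epsilon> * (2 * \<beta> z * D k) else 0) + \<epsilon>\<^sup>2 * (?c * h i))"
    by (rule sum.cong) (auto simp: rate_def algebra_simps add_divide_distrib)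
  also have "\<dots> = u z + \<epsilon> * (2 * \<beta> z * D k) + \<epsilon>\<^sup>2 * (?c * (\<Sum>i\<in>UNIV. h i))"
  proof -
    define C where "C i = rate k \<beta> 1 i z + rate k \<beta> (-1) i z" for i
    have "sum C UNIV = 1" unfolding C_def by (rule sum_rates)
    then show ?thesis unfolding C_def[symmetric]
      by (simp only: sum.distrib sum_distrib_left[symmetric]) simp
  qed
  finally show ?thesis
    using step_perturb[of \<beta> z u "\<lambda>i. u z + \<epsilon> * D i + \<epsilon>\<^sup>2 / 2 * h i" \<tau> "\<lambda>i. u z - \<epsilon> * D i + \<epsilon>\<^sup>2 / 2 * h i" k] \<beta> u
    by simp
qed

text \<open>Order \<open>\<epsilon>\<close> cancels by the equation for \<open>\<phi>\<close>; at
  order \<open>\<epsilon>\<^sup>2\<close> the equation for \<open>\<psi>\<close> replaces the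
  oscillating flux by a constant along \<open>k\<close> and by zero in the other directions.
  \<open>u0\<close>, \<open>u1\<close>, \<open>u2\<close> are lattice functions tied only by
  approximate difference relations, so that the statement covers a C2 function with small
  \<open>\<tau>\<close> as well as a quadratic polynomial with \<open>\<tau> = 0\<close>.\<close>

lemma corrector_expansion:
  fixes \<beta> :: "int ^ 'n::finite \<Rightarrow> real"
  assumes cell: "cell k \<beta> \<phi> \<psi> q"
    and \<beta>: "\<bar>\<beta> z\<bar> \<le> 1 / (2 * real CARD('n))"
    and K: "\<And>y. \<bar>\<phi> y\<bar> \<le> K" "\<And>i y. \<bar>\<psi> i y\<bar> \<le> K" and "0 < \<epsilon>" "0 \<le> \<tau>"
    and u0: "\<And>i. \<bar>u0 (z + axis i 1) - (u0 z + \<epsilon> * D i + \<epsilon>\<^sup>2 / 2 * h i)\<bar> \<le> \<epsilon>\<^sup>2 * \<tau>"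
      "\<And>i. \<bar>u0 (z - axis i 1) - (u0 z - \<epsilon> * D i + \<epsilon>\<^sup>2 / 2 * h i)\<bar> \<le> \<epsilon>\<^sup>2 * \<tau>"
    and u1: "\<And>i. \<bar>u1 (z + axis i 1) - (u1 z + \<epsilon> * u2 i z)\<bar> \<le> \<epsilon> * \<tau>"
      "\<And>i. \<bar>u1 (z - axis i 1) - (u1 z - \<epsilon> * u2 i z)\<bar> \<le> \<epsilon> * \<tau>"
    and u2: "\<And>i j. \<bar>u2 j (z + axis i 1) - u2 j z\<bar> \<le> \<tau>" "\<And>i j. \<bar>u2 j (z - axis i 1) - u2 j z\<bar> \<le> \<tau>"
    and D: "D k = u1 z" and h: "h k = u2 k z"
  defines "U \<equiv> \<lambda>z. u0 z + \<epsilon> * (\<phi> z * u1 z) + \<epsilon>\<^sup>2 * (\<Sum>i\<in>UNIV. \<psi> i z * u2 i z)"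
  shows "\<bar>step k \<beta> U z - U z - \<epsilon>\<^sup>2 * (q * h k + 1 / (2 * real CARD('n)) * (\<Sum>i\<in>UNIV - {k}. h i))\<bar>
    \<le> \<epsilon>\<^sup>2 * (\<tau> * (1 + K + real CARD('n) * K))"
proof -
  let ?c = "1 / (2 * real CARD('n))"
  have S: "step k \<beta> U z = step k \<beta> u0 z + \<epsilon> * step k \<beta> (\<lambda>z. \<phi> z * u1 z) z
    + \<epsilon>\<^sup>2 * (\<Sum>i\<in>UNIV. step k \<beta> (\<lambda>z. \<psi> i z * u2 i z) z)"
    unfolding U_def step_add step_cmult step_sum ..
  define e0 where "e0 = step k \<beta> u0 z - (u0 z + \<epsilon> * (2 * \<beta> z * u1 z) + \<epsilon>\<^sup>2 * (?c * (\<Sum>i\<in>UNIV. h i)))"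
  have e0: "\<bar>e0\<bar> \<le> \<epsilon>\<^sup>2 * \<tau>" unfolding e0_def D[symmetric] by (intro step_taylor \<beta> u0)
  define e1 where "e1 = step k \<beta> (\<lambda>z. \<phi> z * u1 z) z - (u1 z * step k \<beta> \<phi> z + \<epsilon> * (\<Sum>i\<in>UNIV. u2 i z * flux k \<beta> i \<phi> z))"
  have e1: "\<bar>e1\<bar> \<le> K * (\<epsilon> * \<tau>)" unfolding e1_def
    using \<open>0 < \<epsilon>\<close> \<open>0 \<le> \<tau>\<close> by (intro step_product \<beta> K(1) u1) auto
  define e2 where "e2 i = step k \<beta> (\<lambda>z. \<psi> i z * u2 i z) z - u2 i z * step k \<beta> (\<psi> i) z" for i
  \<comment> \<open>\<open>\<psi>\<close> already carries the factor
    \<open>\<epsilon>\<^sup>2\<close>, so \<open>u2\<close> is frozen: the product rule is used with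
    zero gradient.\<close>
  have e2: "\<bar>e2 i\<bar> \<le> K * \<tau>" for i
    using step_product[of \<beta> z "\<psi> i" K \<tau> "u2 i" 0 "\<lambda>_. 0" k] \<beta> K(2) \<open>0 \<le> \<tau>\<close> u2 unfolding e2_def by simp
  have "\<phi> z - step k \<beta> \<phi> z = 2 * \<beta> z" using cell by (simp add: cell_def)
  then have c1: "step k \<beta> \<phi> z = \<phi> z - 2 * \<beta> z" by simp
  have c2: "step k \<beta> (\<psi> i) z = \<psi> i z - flux k \<beta> i \<phi> z + (if i = k then q - ?c else 0)" for i
    using cell unfolding cell_def by (metis (no_types) add_diff_cancel_left' diff_add_cancel diff_diff_eq2 add.commute)
  have "(\<Sum>i\<in>UNIV. u2 i z * step k \<beta> (\<psi> i) z)
    = (\<Sum>i\<in>UNIV. \<psi> i z * u2 i z - u2 i z * flux k \<beta> i \<phi> z + (if i = k then (q - ?c) * h k else 0))"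
    unfolding c2 by (rule sum.cong) (auto simp: algebra_simps h)
  also have "\<dots> = (\<Sum>i\<in>UNIV. \<psi> i z * u2 i z) - (\<Sum>i\<in>UNIV. u2 i z * flux k \<beta> i \<phi> z) + (q - ?c) * h k"
    by (simp add: sum.distrib sum_subtractf)
  finally have c3: "(\<Sum>i\<in>UNIV. step k \<beta> (\<lambda>z. \<psi> i z * u2 i z) z)
    = (\<Sum>i\<in>UNIV. \<psi> i z * u2 i z) - (\<Sum>i\<in>UNIV. u2 i z * flux k \<beta> i \<phi> z) + (q - ?c) * h k + (\<Sum>i\<in>UNIV. e2 i)"
    by (simp add: e2_def sum_subtractf)
  have hs: "(\<Sum>i\<in>UNIV. h i) = h k + (\<Sum>i\<in>UNIV - {k}. h i)" by (simp add: sum.remove)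
  have E0: "step k \<beta> u0 z = u0 z + \<epsilon> * (2 * \<beta> z * u1 z) + \<epsilon>\<^sup>2 * (?c * (h k + (\<Sum>i\<in>UNIV - {k}. h i))) + e0"
    by (simp add: e0_def hs)
  have E1: "step k \<beta> (\<lambda>z. \<phi> z * u1 z) z = u1 z * (\<phi> z - 2 * \<beta> z) + \<epsilon> * (\<Sum>i\<in>UNIV. u2 i z * flux k \<beta> i \<phi> z) + e1"
    by (simp add: e1_def c1)
  have "step k \<beta> U z - U z - \<epsilon>\<^sup>2 * (q * h k + ?c * (\<Sum>i\<in>UNIV - {k}. h i)) = e0 + \<epsilon> * e1 + \<epsilon>\<^sup>2 * (\<Sum>i\<in>UNIV. e2 i)"
    unfolding S c3 E0 E1 unfolding U_def by (simp add: algebra_simps power2_eq_square)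
  also have "\<bar>\<dots>\<bar> \<le> \<epsilon>\<^sup>2 * \<tau> + \<epsilon> * (K * (\<epsilon> * \<tau>)) + \<epsilon>\<^sup>2 * (real CARD('n) * (K * \<tau>))"
  proof -
    have "\<bar>\<Sum>i\<in>UNIV. e2 i\<bar> \<le> (\<Sum>i\<in>UNIV. \<bar>e2 i\<bar>)" by (rule sum_abs)
    also have "\<dots> \<le> (\<Sum>i\<in>(UNIV::'n set). K * \<tau>)" by (intro sum_mono e2)
    finally have "\<epsilon>\<^sup>2 * \<bar>\<Sum>i\<in>UNIV. e2 i\<bar> \<le> \<epsilon>\<^sup>2 * (real CARD('n) * (K * \<tau>))" by (intro mult_left_mono) auto
    moreover have "\<epsilon> * \<bar>e1\<bar> \<le> \<epsilon> * (K * (\<epsilon> * \<tau>))" using e1 \<open>0 < \<epsilon>\<close> by simp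
    moreover have "\<bar>e0 + \<epsilon> * e1 + \<epsilon>\<^sup>2 * (\<Sum>i\<in>UNIV. e2 i)\<bar> \<le> \<bar>e0\<bar> + \<epsilon> * \<bar>e1\<bar> + \<epsilon>\<^sup>2 * \<bar>\<Sum>i\<in>UNIV. e2 i\<bar>"
      using \<open>0 < \<epsilon>\<close> abs_triangle_ineq[of "e0 + \<epsilon> * e1" "\<epsilon>\<^sup>2 * (\<Sum>i\<in>UNIV. e2 i)"] abs_triangle_ineq[of e0 "\<epsilon> * e1"]
      by (simp add: abs_mult)
    ultimately show ?thesis using e0 by linarith
  qed
  also have "\<dots> = \<epsilon>\<^sup>2 * (\<tau> * (1 + K + real CARD('n) * K))" by (simp add: algebra_simps power2_eq_square)
  finally show ?thesis .
qed

text \<open>The corrected quadratic polynomial is an exact barrier, with no Taylor remainder.\<close>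

lemma local_comparison:
  fixes \<beta> :: "int ^ 'n::finite \<Rightarrow> real"
  assumes cell: "cell k \<beta> \<phi> \<psi> q" and "0 < q"
    and \<beta>: "\<And>y. \<bar>\<beta> y\<bar> \<le> 1 / (2 * real CARD('n))"
    and K: "\<And>y. \<bar>\<phi> y\<bar> \<le> K" "\<And>i y. \<bar>\<psi> i y\<bar> \<le> K" and \<epsilon>: "0 < \<epsilon>" "\<epsilon> \<le> 1"
    and "0 < R" "0 \<le> \<eta>" "0 \<le> M"
    and M: "\<And>z. W z \<le> M"
    and W: "\<And>z. norm (lattice_point \<epsilon> z - lattice_point \<epsilon> z0) < R \<Longrightarrow> (1 + \<epsilon>\<^sup>2) * W z - step k \<beta> W z \<le> \<epsilon>\<^sup>2 * \<eta>"
  shows "W z0 \<le> \<eta> + M * (2 * (2 * K\<^sup>2 + 4 * K + 2 * q + 1)) / R\<^sup>2"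
proof -
  define x where "x i z = \<epsilon> * (real_of_int (z $ i) - real_of_int (z0 $ i))" for i and z :: "int ^ 'n"
  \<comment> \<open>\<open>T\<close> is the homogenized operator applied to the squared distance
    from the centre, and \<open>B\<close> is that squared distance with its correctors. The mixed
    derivatives are zero, so only \<open>\<psi> k\<close> enters, with the value 2.\<close>
  define T where "T = q * 2 + 1 / (2 * real CARD('n)) * (\<Sum>i\<in>UNIV - {k}. (2::real))"
  define B where "B z = (\<Sum>i\<in>UNIV. (x i z)\<^sup>2) + \<epsilon> * (\<phi> z * (2 * x k z)) + \<epsilon>\<^sup>2 * (\<Sum>i\<in>UNIV. \<psi> i z * (if i = k then 2 else 0))" for z
  have xp: "x j (z + axis i 1) = x j z + (if j = i then \<epsilon> else 0)"
    "x j (z - axis i 1) = x j z - (if j = i then \<epsilon> else 0)" for i j z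
    by (auto simp: x_def axis_def algebra_simps)
  have sq: "(\<Sum>j\<in>UNIV. (x j (z + axis i 1))\<^sup>2) = (\<Sum>j\<in>UNIV. (x j z)\<^sup>2) + \<epsilon> * (2 * x i z) + \<epsilon>\<^sup>2 / 2 * 2"
    "(\<Sum>j\<in>UNIV. (x j (z - axis i 1))\<^sup>2) = (\<Sum>j\<in>UNIV. (x j z)\<^sup>2) - \<epsilon> * (2 * x i z) + \<epsilon>\<^sup>2 / 2 * 2" for i z
  proof -
    have "(\<Sum>j\<in>UNIV. (x j (z + axis i 1))\<^sup>2) = (\<Sum>j\<in>UNIV. (x j z)\<^sup>2 + (if j = i then \<epsilon> * (2 * x i z) + \<epsilon>\<^sup>2 else 0))"
      by (rule sum.cong) (auto simp: xp power2_sum power2_eq_square algebra_simps)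
    then show "(\<Sum>j\<in>UNIV. (x j (z + axis i 1))\<^sup>2) = (\<Sum>j\<in>UNIV. (x j z)\<^sup>2) + \<epsilon> * (2 * x i z) + \<epsilon>\<^sup>2 / 2 * 2"
      by (simp add: sum.distrib)
    have "(\<Sum>j\<in>UNIV. (x j (z - axis i 1))\<^sup>2) = (\<Sum>j\<in>UNIV. (x j z)\<^sup>2 + (if j = i then - \<epsilon> * (2 * x i z) + \<epsilon>\<^sup>2 else 0))"
      by (rule sum.cong) (auto simp: xp power2_diff power2_eq_square algebra_simps)
    then show "(\<Sum>j\<in>UNIV. (x j (z - axis i 1))\<^sup>2) = (\<Sum>j\<in>UNIV. (x j z)\<^sup>2) - \<epsilon> * (2 * x i z) + \<epsilon>\<^sup>2 / 2 * 2"
      by (simp add: sum.distrib)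
  qed
  have stepB: "step k \<beta> B z - B z = \<epsilon>\<^sup>2 * T" for z
  proof -
    have "\<bar>step k \<beta> B z - B z - \<epsilon>\<^sup>2 * T\<bar> \<le> \<epsilon>\<^sup>2 * (0 * (1 + K + real CARD('n) * K))"
      unfolding B_def T_def
      by (rule corrector_expansion[OF cell \<beta> K \<epsilon>(1), where D="\<lambda>i. 2 * x i z" and h="\<lambda>_. 2"])
         (simp_all add: sq, auto simp: xp)
    then show ?thesis by simp
  qed
  have K0: "0 \<le> K" using K(1)[of 0] by linarith
  have e2: "\<epsilon>\<^sup>2 \<le> 1" using \<epsilon> by (simp add: power_le_one)
  have "T = 2 * q + (real CARD('n) - 1) / real CARD('n)"
    by (simp add: T_def of_nat_diff Suc_le_eq field_simps)
  moreover have "0 \<le> (real CARD('n) - 1) / real CARD('n)" "(real CARD('n) - 1) / real CARD('n) \<le> 1"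
    by (auto simp: Suc_le_eq)
  ultimately have T: "T \<le> 2 * q + 1" "0 \<le> T" using \<open>0 < q\<close> by linarith+
  have psi: "\<bar>\<epsilon>\<^sup>2 * (\<Sum>i\<in>UNIV. \<psi> i z * (if i = k then 2 else 0))\<bar> \<le> 2 * K" for z
  proof -
    have "(\<Sum>i\<in>UNIV. \<psi> i z * (if i = k then 2 else 0)) = 2 * \<psi> k z" by (simp add: if_distrib cong: if_cong)
    moreover have "\<epsilon>\<^sup>2 * \<bar>\<psi> k z\<bar> \<le> 1 * K" using e2 K(2) K0 by (intro mult_mono) auto
    ultimately show ?thesis by (simp add: abs_mult)
  qed
  define r where "r z = (\<Sum>i\<in>UNIV. (x i z)\<^sup>2)" for z
  have normr: "(norm (lattice_point \<epsilon> z - lattice_point \<epsilon> z0))\<^sup>2 = r z" for z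
    unfolding power2_norm_eq_inner inner_vec_def r_def x_def
    by (simp add: lattice_point_def power2_eq_square algebra_simps)
  \<comment> \<open>The cross term of the first corrector is absorbed by half of the squared
    distance at the price \<open>2 * K\<^sup>2\<close>; the second corrector costs
    \<open>2 * K\<close>.\<close>
  have Bge: "r z / 2 - 2 * K\<^sup>2 - 2 * K \<le> B z" for z
  proof -
    have "(x k z)\<^sup>2 \<le> r z" unfolding r_def by (rule member_le_sum) auto
    moreover have "2 * \<bar>\<epsilon> * (\<phi> z * x k z)\<bar> \<le> (x k z)\<^sup>2 / 2 + 2 * K\<^sup>2"
    proof -
      have "\<bar>\<epsilon> * \<phi> z\<bar> \<le> 1 * K" unfolding abs_mult using \<epsilon> K(1) K0 by (intro mult_mono) auto
      then have "(\<epsilon> * \<phi> z)\<^sup>2 \<le> K\<^sup>2" by (metis abs_le_square_iff abs_of_nonneg K0 mult_1)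
      moreover have "0 \<le> (\<bar>x k z\<bar> / 2 - \<bar>\<epsilon> * \<phi> z\<bar>)\<^sup>2" by simp
      ultimately show ?thesis by (simp add: power2_diff abs_mult power_mult_distrib power_divide algebra_simps)
    qed
    moreover have "\<epsilon> * (\<phi> z * (2 * x k z)) = 2 * (\<epsilon> * (\<phi> z * x k z))" by simp
    ultimately show ?thesis using psi[of z] unfolding B_def r_def[symmetric] by linarith
  qed
  \<comment> \<open>The shift makes \<open>H - T\<close> nonnegative, so that \<open>(1 +
    \<epsilon>\<^sup>2) * H z - step k \<beta> H z = \<epsilon>\<^sup>2 * (H z - T)\<close> has the
    right sign.\<close>
  define H where "H z = B z + (2 * K\<^sup>2 + 2 * K + T)" for z
  have H: "r z / 2 + T \<le> H z" for z using Bge[of z] by (simp add: H_def)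
  have r0: "0 \<le> r z" for z unfolding r_def by (simp add: sum_nonneg)
  have stepH: "step k \<beta> H z = H z + \<epsilon>\<^sup>2 * T" for z
    using stepB[of z] unfolding H_def step_add step_const by simp
  \<comment> \<open>The slope is chosen so that the barrier reaches \<open>M\<close> at distance
    \<open>R\<close> from the centre and beyond, because there \<open>H\<close> is at least
    \<open>R\<^sup>2 / 2\<close>.\<close>
  define W' where "W' z = W z - \<eta> - 2 * M / R\<^sup>2 * H z" for z
  have "W' z0 \<le> 0"
  proof (rule discrete_max_principle[where \<beta>=\<beta> and \<epsilon>=\<epsilon> and M=M and k=k])
    show "\<epsilon> \<noteq> 0" using \<epsilon> by simp
    show "\<bar>\<beta> y\<bar> \<le> 1 / (2 * real CARD('n))" for y by (rule \<beta>)
    fix z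
    have c: "0 \<le> 2 * M / R\<^sup>2" using \<open>0 \<le> M\<close> by simp
    have "0 \<le> H z" using H[of z] r0[of z] T by linarith
    then have "0 \<le> 2 * M / R\<^sup>2 * H z" using c by (rule mult_nonneg_nonneg[rotated])
    then show "W' z \<le> M" using M[of z] \<open>0 \<le> \<eta>\<close> by (simp add: W'_def)
    show "W' z \<le> 0 \<or> (1 + \<epsilon>\<^sup>2) * W' z \<le> step k \<beta> W' z"
    proof (cases "norm (lattice_point \<epsilon> z - lattice_point \<epsilon> z0) < R")
      case True
      have "0 \<le> 2 * M / R\<^sup>2 * (\<epsilon>\<^sup>2 * (H z - T))"
        using H[of z] r0[of z] by (intro mult_nonneg_nonneg[OF c]) auto
      moreover have sW: "step k \<beta> W' z = step k \<beta> W z - \<eta> - 2 * M / R\<^sup>2 * (H z + \<epsilon>\<^sup>2 * T)"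
        unfolding W'_def step_diff step_cmult step_const stepH ..
      have "(1 + \<epsilon>\<^sup>2) * W' z - step k \<beta> W' z
        = ((1 + \<epsilon>\<^sup>2) * W z - step k \<beta> W z - \<epsilon>\<^sup>2 * \<eta>) - 2 * M / R\<^sup>2 * (\<epsilon>\<^sup>2 * (H z - T))"
        unfolding sW unfolding W'_def by (simp add: algebra_simps add_divide_distrib diff_divide_distrib)
      ultimately show ?thesis using W[OF True] by linarith
    next
      case False
      then have "R\<^sup>2 \<le> r z" unfolding normr[symmetric] using \<open>0 < R\<close> by (intro power_mono) auto
      then have "R\<^sup>2 / 2 \<le> H z" using H[of z] T by linarith
      then have "2 * M / R\<^sup>2 * (R\<^sup>2 / 2) \<le> 2 * M / R\<^sup>2 * H z" by (intro mult_left_mono c)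
      then have "M \<le> 2 * M / R\<^sup>2 * H z" using \<open>0 < R\<close> by simp
      then show ?thesis using M[of z] \<open>0 \<le> \<eta>\<close> by (simp add: W'_def)
    qed
  qed
  then have "W z0 \<le> \<eta> + 2 * M / R\<^sup>2 * H z0" by (simp add: W'_def)
  also have "H z0 \<le> 2 * K\<^sup>2 + 4 * K + 2 * q + 1"
    using psi[of z0] T by (simp add: H_def B_def x_def abs_le_iff)
  then have "2 * M / R\<^sup>2 * H z0 \<le> 2 * M / R\<^sup>2 * (2 * K\<^sup>2 + 4 * K + 2 * q + 1)"
    using \<open>0 \<le> M\<close> by (intro mult_left_mono) auto
  also have "2 * M / R\<^sup>2 * X = M * (2 * X) / R\<^sup>2" for X by simp
  finally show ?thesis by simp
qed

section \<open>Taylor expansion of C2 functions, uniform on balls\<close>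

lemma has_real_derivative_line:
  fixes f :: "real ^ 'n::finite \<Rightarrow> real"
  assumes "\<And>x. f differentiable (at x)"
  shows "((\<lambda>t. f (x + t *\<^sub>R axis i 1)) has_real_derivative partial_deriv i f (x + t *\<^sub>R axis i 1)) (at t)"
proof -
  let ?g = "\<lambda>t. x + t *\<^sub>R axis i (1::real)"
  have "(?g has_derivative (\<lambda>s. s *\<^sub>R axis i 1)) (at t)"
    by (auto intro!: derivative_eq_intros)
  moreover have fd: "(f has_derivative frechet_derivative f (at (?g t))) (at (?g t))"
    using assms frechet_derivative_works by blast
  ultimately have "((\<lambda>t. f (?g t)) has_derivative (\<lambda>s. frechet_derivative f (at (?g t)) (s *\<^sub>R axis i 1))) (at t)"
    by (rule has_derivative_compose)
  moreover have "frechet_derivative f (at (?g t)) (s *\<^sub>R axis i 1) = partial_deriv i f (?g t) * s" for s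
    using linear_scale[OF has_derivative_linear[OF fd], of s "axis i 1"] by (simp add: partial_deriv_def)
  ultimately show ?thesis by (simp add: has_field_derivative_def)
qed

lemma increment_bound:
  fixes g :: "real \<Rightarrow> real"
  assumes "\<And>s. (g has_real_derivative g' s) (at s)" "\<And>s. \<bar>s\<bar> \<le> \<bar>t\<bar> \<Longrightarrow> \<bar>g' s\<bar> \<le> B"
  shows "\<bar>g t - g 0\<bar> \<le> B * \<bar>t\<bar>"
proof -
  have "norm (g t - g 0) \<le> B * norm (t - 0)"
    using assms
    by (intro field_differentiable_bound[where S="{- \<bar>t\<bar>..\<bar>t\<bar>}" and f=g and f'=g'])
       (auto intro: has_field_derivative_at_within)
  then show ?thesis by simp
qed

text \<open>The second derivatives are merely continuous, so the error is a modulus of continuity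
  and not a cubic remainder. Uniform continuity on the ball of radius \<open>R + 1\<close>, with one
  \<open>\<delta>\<close> for the finitely many index pairs, is integrated once and twice along
  coordinate lines.\<close>

lemma taylor_uniform:
  fixes u :: "real ^ 'n::finite \<Rightarrow> real"
  assumes "C_class 2 u" "0 < \<tau>" "0 \<le> R"
  obtains \<delta> where "0 < \<delta>" "\<And>x t i. norm x \<le> R \<Longrightarrow> \<bar>t\<bar> < \<delta> \<Longrightarrow>
      \<bar>u (x + t *\<^sub>R axis i 1) - (u x + t * partial_deriv i u x + t\<^sup>2 / 2 * partial_deriv i (partial_deriv i u) x)\<bar> \<le> t\<^sup>2 * \<tau>"
    "\<And>x t i j. norm x \<le> R \<Longrightarrow> \<bar>t\<bar> < \<delta> \<Longrightarrow>
      \<bar>partial_deriv j u (x + t *\<^sub>R axis i 1) - (partial_deriv j u x + t * partial_deriv i (partial_deriv j u) x)\<bar> \<le> \<bar>t\<bar> * \<tau>"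
    "\<And>x t i j l. norm x \<le> R \<Longrightarrow> \<bar>t\<bar> < \<delta> \<Longrightarrow>
      \<bar>partial_deriv l (partial_deriv j u) (x + t *\<^sub>R axis i 1) - partial_deriv l (partial_deriv j u) x\<bar> \<le> \<tau>"
proof -
  have d0: "\<And>x. u differentiable (at x)" and d1: "\<And>j x. partial_deriv j u differentiable (at x)"
    and c2: "\<And>l j. continuous_on UNIV (partial_deriv l (partial_deriv j u))"
    using assms(1) by (auto simp: numeral_2_eq_2)
  let ?w = "\<lambda>p. partial_deriv (fst p) (partial_deriv (snd p) u)"
  have "\<exists>\<delta>>0. \<forall>x\<in>cball 0 (R + 1). \<forall>y\<in>cball 0 (R + 1). dist y x < \<delta> \<longrightarrow> \<bar>?w p y - ?w p x\<bar> < \<tau>" for p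
  proof -
    have "uniformly_continuous_on (cball 0 (R + 1)) (?w p)"
      using c2 by (intro compact_uniformly_continuous continuous_on_subset[OF c2]) auto
    then show ?thesis using \<open>0 < \<tau>\<close> unfolding uniformly_continuous_on_def dist_real_def by metis
  qed
  then obtain d where d: "\<And>p. 0 < d p"
    "\<And>p x y. x \<in> cball 0 (R + 1) \<Longrightarrow> y \<in> cball 0 (R + 1) \<Longrightarrow> dist y x < d p \<Longrightarrow> \<bar>?w p y - ?w p x\<bar> < \<tau>"
    by metis
  define \<delta> where "\<delta> = min 1 (Min (range d))"
  have \<delta>: "0 < \<delta>" "\<delta> \<le> 1" "\<And>p. \<delta> \<le> d p"
    unfolding \<delta>_def using d(1) by (auto simp: min.coboundedI2)
  have osc: "\<bar>partial_deriv l (partial_deriv j u) (x + t *\<^sub>R axis i 1) - partial_deriv l (partial_deriv j u) x\<bar> \<le> \<tau>"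
    if "norm x \<le> R" "\<bar>t\<bar> < \<delta>" for x t i j l
  proof -
    have "norm (x + t *\<^sub>R axis i 1) \<le> R + 1"
      using norm_triangle_ineq[of x "t *\<^sub>R axis i 1"] that \<delta> by simp
    moreover have "dist (x + t *\<^sub>R axis i 1) x < d (l, j)"
      using that \<delta>(3)[of "(l, j)"] by (simp add: dist_norm)
    ultimately show ?thesis using d(2)[of x "x + t *\<^sub>R axis i 1" "(l, j)"] that by simp
  qed
  have first: "\<bar>partial_deriv j u (x + t *\<^sub>R axis i 1) - (partial_deriv j u x + t * partial_deriv i (partial_deriv j u) x)\<bar> \<le> \<bar>t\<bar> * \<tau>"
    if "norm x \<le> R" "\<bar>t\<bar> < \<delta>" for x t i j
  proof -
    let ?a = "partial_deriv i (partial_deriv j u) x"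
    have "\<bar>(partial_deriv j u (x + t *\<^sub>R axis i 1) - t * ?a) - (partial_deriv j u (x + 0 *\<^sub>R axis i 1) - 0 * ?a)\<bar> \<le> \<tau> * \<bar>t\<bar>"
      using that osc[OF that(1), where i=i and j=j and l=i]
      by (intro increment_bound[where g'="\<lambda>s. partial_deriv i (partial_deriv j u) (x + s *\<^sub>R axis i 1) - ?a"])
         (auto intro!: derivative_eq_intros has_real_derivative_line d1)
    then show ?thesis by (simp add: algebra_simps)
  qed
  have second: "\<bar>u (x + t *\<^sub>R axis i 1) - (u x + t * partial_deriv i u x + t\<^sup>2 / 2 * partial_deriv i (partial_deriv i u) x)\<bar> \<le> t\<^sup>2 * \<tau>"
    if "norm x \<le> R" "\<bar>t\<bar> < \<delta>" for x t i
  proof -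
    let ?a = "partial_deriv i u x" and ?b = "partial_deriv i (partial_deriv i u) x"
    have "\<bar>(u (x + t *\<^sub>R axis i 1) - t * ?a - t\<^sup>2 / 2 * ?b) - (u (x + 0 *\<^sub>R axis i 1) - 0 * ?a - 0\<^sup>2 / 2 * ?b)\<bar> \<le> (\<bar>t\<bar> * \<tau>) * \<bar>t\<bar>"
    proof (rule increment_bound[where g'="\<lambda>s. partial_deriv i u (x + s *\<^sub>R axis i 1) - ?a - s * ?b"])
      show "((\<lambda>t. u (x + t *\<^sub>R axis i 1) - t * ?a - t\<^sup>2 / 2 * ?b) has_real_derivative partial_deriv i u (x + s *\<^sub>R axis i 1) - ?a - s * ?b) (at s)" for s
        by (auto intro!: derivative_eq_intros has_real_derivative_line d0)
      fix s assume s: "\<bar>s\<bar> \<le> \<bar>t\<bar>"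
      have "\<bar>partial_deriv i u (x + s *\<^sub>R axis i 1) - (?a + s * ?b)\<bar> \<le> \<bar>s\<bar> * \<tau>"
        using first[OF that(1), of s i i] s that by simp
      also have "\<dots> \<le> \<bar>t\<bar> * \<tau>" using s \<open>0 < \<tau>\<close> by simp
      finally show "\<bar>partial_deriv i u (x + s *\<^sub>R axis i 1) - ?a - s * ?b\<bar> \<le> \<bar>t\<bar> * \<tau>" by (simp add: algebra_simps)
    qed
    moreover have "(\<bar>t\<bar> * \<tau>) * \<bar>t\<bar> = t\<^sup>2 * \<tau>" by (simp add: power2_eq_square mult.assoc mult.left_commute flip: abs_mult)
    ultimately show ?thesis unfolding diff_diff_eq by simp
  qed
  show ?thesis using that[OF \<delta>(1) second first osc] by blast
qed

subsection \<open>Homogenization\<close>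

lemma rate_shift: "rate k (\<lambda>z. \<beta> (z + a)) s i z = rate k \<beta> s i (z + a)"
  by (simp add: rate_def)

lemma step_shift:
  "step k (\<lambda>z. \<beta> (z + a)) (\<lambda>z. g (z + a)) z = step k \<beta> g (z + a)"
  by (simp add: step_def rate_shift algebra_simps)

lemma flux_shift:
  "flux k (\<lambda>z. \<beta> (z + a)) i (\<lambda>z. g (z + a)) z = flux k \<beta> i g (z + a)"
  by (simp add: flux_def rate_shift algebra_simps)

text \<open>A starting environment \<open>\<omega>\<close> translates \<open>\<beta>\<close>. The
  correctors move along with the same \<open>q\<close> and the same bounds, so the estimates below
  are uniform in \<open>\<omega>\<close>.\<close>

lemma cell_shift:
  "cell k \<beta> \<phi> \<psi> q \<Longrightarrow> cell k (\<lambda>z. \<beta> (z + a)) (\<lambda>z. \<phi> (z + a)) (\<lambda>i z. \<psi> i (z + a)) q"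
  unfolding cell_def by (simp add: step_shift flux_shift)

lemma step_local:
  assumes "\<And>i. f (z + axis i 1) = g (z + axis i 1)" "\<And>i. f (z - axis i 1) = g (z - axis i 1)"
  shows "step k \<beta> f z = step k \<beta> g z"
  by (simp add: step_def assms)

lemma lattice_point_plus_axis:
  "lattice_point \<epsilon> (z + axis i 1) = lattice_point \<epsilon> z + \<epsilon> *\<^sub>R axis i 1"
  "lattice_point \<epsilon> (z - axis i 1) = lattice_point \<epsilon> z - \<epsilon> *\<^sub>R axis i 1"
  by (auto simp: lattice_point_def vec_eq_iff axis_def algebra_simps)

lemma lattice_floor_close:
  fixes x :: "real ^ 'n::finite"
  assumes "0 < \<epsilon>"
  shows "norm (lattice_floor \<epsilon> x - x) \<le> real CARD('n) * \<epsilon>"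
proof -
  have "\<bar>(lattice_floor \<epsilon> x - x) $ i\<bar> \<le> \<epsilon>" for i
  proof -
    have "\<bar>real_of_int \<lfloor>x $ i / \<epsilon>\<rfloor> - x $ i / \<epsilon>\<bar> \<le> 1" by linarith
    then have "\<epsilon> * \<bar>real_of_int \<lfloor>x $ i / \<epsilon>\<rfloor> - x $ i / \<epsilon>\<bar> \<le> \<epsilon> * 1" using assms by (intro mult_left_mono) auto
    also have "\<epsilon> * \<bar>real_of_int \<lfloor>x $ i / \<epsilon>\<rfloor> - x $ i / \<epsilon>\<bar> = \<bar>\<epsilon> * (real_of_int \<lfloor>x $ i / \<epsilon>\<rfloor> - x $ i / \<epsilon>)\<bar>"
      using assms by (simp add: abs_mult)
    finally show ?thesis using assms by (simp add: lattice_floor_def lattice_point_def right_diff_distrib)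
  qed
  then have "(\<Sum>i\<in>UNIV. \<bar>(lattice_floor \<epsilon> x - x) $ i\<bar>) \<le> (\<Sum>i\<in>(UNIV::'n set). \<epsilon>)" by (intro sum_mono)
  then show ?thesis using norm_le_l1_cart[of "lattice_floor \<epsilon> x - x"] by simp
qed

text \<open>\<open>V \<epsilon> \<omega>\<close> is the discrete solution in the environment
  \<open>\<omega>\<close>, read on integer points. The bounds \<open>K\<close>, \<open>F\<close> and
  \<open>Bu\<close> depend on neither \<open>\<epsilon>\<close> nor \<open>\<omega>\<close>, whereas
  \<open>V\<close> is only assumed bounded for each pair separately.\<close>

locale homogenization = walk k L \<beta>
  for k :: "'n::finite" and L :: "'n \<Rightarrow> nat" and \<beta> :: "int ^ 'n \<Rightarrow> real" +
  fixes \<phi> :: "int ^ 'n \<Rightarrow> real" and \<psi> :: "'n \<Rightarrow> int ^ 'n \<Rightarrow> real" and q K F \<rho> Bu :: real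
    and f u :: "real ^ 'n \<Rightarrow> real" and V :: "real \<Rightarrow> int ^ 'n \<Rightarrow> int ^ 'n \<Rightarrow> real" and \<Omega> :: "(int ^ 'n) set"
  assumes cell: "cell k \<beta> \<phi> \<psi> q" and q: "0 < q"
    and K: "\<And>y. \<bar>\<phi> y\<bar> \<le> K" "\<And>i y. \<bar>\<psi> i y\<bar> \<le> K"
    and F: "\<And>x. \<bar>f x\<bar> \<le> F" and support: "\<And>x. \<rho> < norm x \<Longrightarrow> f x = 0" and \<rho>: "0 \<le> \<rho>"
    and u: "C_class 2 u" "\<And>x. \<bar>u x\<bar> \<le> Bu"
    and pde: "\<And>x. q * partial_deriv k (partial_deriv k u) x
          + 1 / (2 * real CARD('n)) * (\<Sum>j\<in>UNIV - {k}. partial_deriv j (partial_deriv j u) x) = u x - f x"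
    and V_bounded: "\<And>\<epsilon> \<omega>. 0 < \<epsilon> \<Longrightarrow> \<omega> \<in> \<Omega> \<Longrightarrow> \<exists>M. \<forall>z. \<bar>V \<epsilon> \<omega> z\<bar> \<le> M"
    and V_eq: "\<And>\<epsilon> \<omega> z. 0 < \<epsilon> \<Longrightarrow> \<omega> \<in> \<Omega> \<Longrightarrow>
      (1 + \<epsilon>\<^sup>2) * V \<epsilon> \<omega> z - step k (\<lambda>z. \<beta> (z + \<omega>)) (V \<epsilon> \<omega>) z = \<epsilon>\<^sup>2 * f (lattice_point \<epsilon> z)"
begin

abbreviation "walk_at \<omega> \<equiv> step k (\<lambda>z. \<beta> (z + \<omega>))"

lemma bound': "\<bar>\<beta> y\<bar> \<le> 1 / (2 * real CARD('n))"
  using bound[of y] by simp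

definition C where "C = 2 * (2 * K\<^sup>2 + 4 * K + 2 * q + 1)"

lemma nonneg: "0 \<le> K" "0 \<le> F" "0 \<le> Bu" "0 \<le> C"
  using K(1)[of 0] F[of 0] u(2)[of 0] q by (auto simp: C_def intro!: add_nonneg_nonneg)

text \<open>Comparison with the constant \<open>F\<close> turns the qualitative bound on
  \<open>V\<close> into one that is the same for all \<open>\<epsilon>\<close> and
  \<open>\<omega>\<close>.\<close>

lemma V_le_F:
  assumes "0 < \<epsilon>" "\<omega> \<in> \<Omega>"
  shows "\<bar>V \<epsilon> \<omega> z\<bar> \<le> F"
proof -
  obtain M where M: "\<And>z. \<bar>V \<epsilon> \<omega> z\<bar> \<le> M" using V_bounded assms by blast
  have *: "s * V \<epsilon> \<omega> z - F \<le> 0" if s: "s = 1 \<or> s = -1" for s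
  proof (rule discrete_max_principle[where \<beta>="\<lambda>z. \<beta> (z + \<omega>)" and \<epsilon>=\<epsilon> and M=M and k=k])
    show "\<bar>\<beta> (y + \<omega>)\<bar> \<le> 1 / (2 * real CARD('n))" for y by (rule bound')
    show "\<epsilon> \<noteq> 0" using assms by simp
    show "s * V \<epsilon> \<omega> z - F \<le> M" for z using s M[of z] nonneg by auto
    fix z
    have "\<epsilon>\<^sup>2 * (s * f (lattice_point \<epsilon> z)) \<le> \<epsilon>\<^sup>2 * F" using s F[of "lattice_point \<epsilon> z"] by (intro mult_left_mono) auto
    moreover have "(1 + \<epsilon>\<^sup>2) * (s * V \<epsilon> \<omega> z - F) - (s * walk_at \<omega> (V \<epsilon> \<omega>) z - F)
      = s * ((1 + \<epsilon>\<^sup>2) * V \<epsilon> \<omega> z - walk_at \<omega> (V \<epsilon> \<omega>) z) - \<epsilon>\<^sup>2 * F"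
      by (simp add: algebra_simps)
    ultimately have "(1 + \<epsilon>\<^sup>2) * (s * V \<epsilon> \<omega> z - F) \<le> s * walk_at \<omega> (V \<epsilon> \<omega>) z - F"
      unfolding V_eq[OF assms] by (simp add: algebra_simps)
    then show "s * V \<epsilon> \<omega> z - F \<le> 0 \<or> (1 + \<epsilon>\<^sup>2) * (s * V \<epsilon> \<omega> z - F) \<le> walk_at \<omega> (\<lambda>z. s * V \<epsilon> \<omega> z - F) z"
      unfolding step_diff step_cmult step_const by simp
  qed
  show ?thesis using *[of 1] *[of "-1"] by auto
qed

lemma local_estimate:
  assumes \<epsilon>: "0 < \<epsilon>" "\<epsilon> \<le> 1" and "0 < R" "0 \<le> \<eta>"
    and M: "\<And>z. \<bar>W z\<bar> \<le> M"
    and W: "\<And>z. norm (lattice_point \<epsilon> z - lattice_point \<epsilon> z0) < R \<Longrightarrow>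
      \<bar>(1 + \<epsilon>\<^sup>2) * W z - walk_at \<omega> W z\<bar> \<le> \<epsilon>\<^sup>2 * \<eta>"
  shows "\<bar>W z0\<bar> \<le> \<eta> + M * C / R\<^sup>2"
proof -
  have M0: "0 \<le> M" using M[of 0] by linarith
  note lc = local_comparison[OF cell_shift[OF cell, of \<omega>] q bound' K \<epsilon> \<open>0 < R\<close> \<open>0 \<le> \<eta>\<close> M0, folded C_def]
  have "W z0 \<le> \<eta> + M * C / R\<^sup>2"
    using M W by (intro lc) (auto simp: abs_le_iff)
  moreover have "- W z0 \<le> \<eta> + M * C / R\<^sup>2"
  proof (rule lc)
    show "- W z \<le> M" for z using M[of z] by linarith
    show "(1 + \<epsilon>\<^sup>2) * - W z - walk_at \<omega> (\<lambda>z. - W z) z \<le> \<epsilon>\<^sup>2 * \<eta>"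
      if "norm (lattice_point \<epsilon> z - lattice_point \<epsilon> z0) < R" for z
      using W[OF that] unfolding step_uminus by (simp add: abs_le_iff)
  qed
  ultimately show ?thesis by linarith
qed

text \<open>Around such a \<open>z0\<close> the source vanishes on a ball of radius
  \<open>R\<close>, and the barrier leaves only its boundary term.\<close>

lemma V_decay:
  assumes "0 < \<epsilon>" "\<epsilon> \<le> 1" "\<omega> \<in> \<Omega>" "0 < R" "\<rho> + R \<le> norm (lattice_point \<epsilon> z0)"
  shows "\<bar>V \<epsilon> \<omega> z0\<bar> \<le> F * C / R\<^sup>2"
proof -
  have "\<bar>V \<epsilon> \<omega> z0\<bar> \<le> 0 + F * C / R\<^sup>2"
  proof (rule local_estimate)
    fix z assume "norm (lattice_point \<epsilon> z - lattice_point \<epsilon> z0) < R"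
    then have "\<rho> < norm (lattice_point \<epsilon> z)"
      using assms(5) norm_triangle_ineq2[of "lattice_point \<epsilon> z0" "lattice_point \<epsilon> z"] by (simp add: norm_minus_commute)
    then show "\<bar>(1 + \<epsilon>\<^sup>2) * V \<epsilon> \<omega> z - walk_at \<omega> (V \<epsilon> \<omega>) z\<bar> \<le> \<epsilon>\<^sup>2 * 0"
      by (simp add: V_eq assms support)
  qed (use assms V_le_F in auto)
  then show ?thesis by simp
qed

lemma ex_radius:
  assumes "0 < \<eta>" obtains R where "1 \<le> R" "M * C / R\<^sup>2 \<le> \<eta>"
proof -
  have "((\<lambda>R. M * C / R\<^sup>2) \<longlongrightarrow> 0) at_top"
    by (intro tendsto_divide_0[OF tendsto_const] filterlim_at_top_imp_at_infinity filterlim_pow_at_top filterlim_ident) auto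
  then have "\<forall>\<^sub>F R in at_top. M * C / R\<^sup>2 < \<eta>" using assms by (rule order_tendstoD)
  then have "\<forall>\<^sub>F R in at_top. M * C / R\<^sup>2 < \<eta> \<and> 1 \<le> R" using eventually_ge_at_top by (rule eventually_conj)
  then obtain R where "M * C / R\<^sup>2 < \<eta> \<and> 1 \<le> R" using eventually_happens by force
  then show ?thesis using that by force
qed

text \<open>The error splits into a boundary term \<open>M * C / R\<^sup>2\<close>, a consistency
  error \<open>\<tau> * C3\<close> and the corrector size \<open>\<epsilon> * C2\<close>.
  \<open>R\<close> is fixed before \<open>\<epsilon>\<close>, since the derivative bounds and
  \<open>\<delta>\<close> belong to a ball that depends on \<open>R\<close>.\<close>

lemma local_convergence:
  assumes "0 < \<eta>" "0 \<le> r"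
  obtains \<epsilon>0 where "0 < \<epsilon>0" "\<epsilon>0 \<le> 1"
    "\<And>\<epsilon> \<omega> z. 0 < \<epsilon> \<Longrightarrow> \<epsilon> < \<epsilon>0 \<Longrightarrow> \<omega> \<in> \<Omega> \<Longrightarrow> norm (lattice_point \<epsilon> z) \<le> r \<Longrightarrow>
      \<bar>V \<epsilon> \<omega> z - u (lattice_point \<epsilon> z)\<bar> \<le> \<eta>"
proof -
  let ?n = "real CARD('n)"
  let ?u1 = "partial_deriv k u" and ?u2 = "\<lambda>i. partial_deriv i (partial_deriv k u)"
  define M where "M = F + Bu + 1"
  obtain R where R: "1 \<le> R" "M * C / R\<^sup>2 \<le> \<eta> / 3" using ex_radius[of "\<eta> / 3" M] assms by auto
  define r1 where "r1 = r + R"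
  have cont: "continuous_on UNIV ?u1" "continuous_on UNIV (?u2 i)" for i
    using u(1) by (auto simp: numeral_2_eq_2 intro!: continuous_at_imp_continuous_on differentiable_imp_continuous_within)
  have ex: "\<exists>B. \<forall>x\<in>cball 0 (r1 + 1). \<bar>g x\<bar> \<le> B" if "continuous_on UNIV g" for g :: "real ^ 'n \<Rightarrow> real"
  proof -
    have "bounded (g ` cball 0 (r1 + 1))"
      by (intro compact_imp_bounded compact_continuous_image continuous_on_subset[OF that]) auto
    then show ?thesis by (auto simp: bounded_iff)
  qed
  from ex[OF cont(1)] obtain B1 where B1: "\<forall>x\<in>cball 0 (r1 + 1). \<bar>?u1 x\<bar> \<le> B1" by blast
  have "\<forall>i. \<exists>B. \<forall>x\<in>cball 0 (r1 + 1). \<bar>?u2 i x\<bar> \<le> B" by (intro allI ex cont(2))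
  then have "\<exists>B2. \<forall>i. \<forall>x\<in>cball 0 (r1 + 1). \<bar>?u2 i x\<bar> \<le> B2 i" by (rule choice)
  then obtain B2 where B2: "\<And>i. \<forall>x\<in>cball 0 (r1 + 1). \<bar>?u2 i x\<bar> \<le> B2 i" by blast
  define B where "B = max (max 0 B1) (Max (range B2))"
  have B0: "0 \<le> B" by (simp add: B_def)
  have B: "\<bar>?u1 x\<bar> \<le> B" "\<bar>?u2 i x\<bar> \<le> B" if "norm x \<le> r1 + 1" for x i
  proof -
    show "\<bar>?u1 x\<bar> \<le> B" using B1 that by (force simp: B_def)
    have "\<bar>?u2 i x\<bar> \<le> B2 i" using B2 that by simp
    also have "B2 i \<le> Max (range B2)" by simp
    finally show "\<bar>?u2 i x\<bar> \<le> B" by (simp add: B_def)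
  qed
  define C2 where "C2 = K * B + ?n * (K * B)"
  have C2: "0 \<le> C2" using B0 nonneg by (simp add: C2_def)
  define C3 where "C3 = 1 + K + ?n * K"
  have C3: "0 < C3" using nonneg by (simp add: C3_def add_pos_nonneg)
  define \<tau> where "\<tau> = \<eta> / (6 * C3)"
  have \<tau>: "0 < \<tau>" "\<tau> * C3 \<le> \<eta> / 6" using C3 assms by (auto simp: \<tau>_def)
  have "0 \<le> r1" using assms R by (simp add: r1_def)
  obtain \<delta> where \<delta>: "0 < \<delta>" and t2: "\<And>x t i. norm x \<le> r1 \<Longrightarrow> \<bar>t\<bar> < \<delta> \<Longrightarrow>
      \<bar>u (x + t *\<^sub>R axis i 1) - (u x + t * partial_deriv i u x + t\<^sup>2 / 2 * partial_deriv i (partial_deriv i u) x)\<bar> \<le> t\<^sup>2 * \<tau>"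
    and t1: "\<And>x t i j. norm x \<le> r1 \<Longrightarrow> \<bar>t\<bar> < \<delta> \<Longrightarrow>
      \<bar>partial_deriv j u (x + t *\<^sub>R axis i 1) - (partial_deriv j u x + t * partial_deriv i (partial_deriv j u) x)\<bar> \<le> \<bar>t\<bar> * \<tau>"
    and t0: "\<And>x t i j l. norm x \<le> r1 \<Longrightarrow> \<bar>t\<bar> < \<delta> \<Longrightarrow>
      \<bar>partial_deriv l (partial_deriv j u) (x + t *\<^sub>R axis i 1) - partial_deriv l (partial_deriv j u) x\<bar> \<le> \<tau>"
    by (rule taylor_uniform[OF u(1) \<tau>(1) \<open>0 \<le> r1\<close>]) (rule that)
  define \<epsilon>0 where "\<epsilon>0 = Min {1, \<delta>, min 1 (\<eta> / 6) / (C2 + 1)}"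
  have e0: "0 < \<epsilon>0" "\<epsilon>0 \<le> 1" "\<epsilon>0 \<le> \<delta>" "\<epsilon>0 \<le> min 1 (\<eta> / 6) / (C2 + 1)"
    using \<delta> C2 assms by (auto simp: \<epsilon>0_def)
  show ?thesis
  proof (rule that[OF e0(1,2)])
    fix \<epsilon> and \<omega> z0 :: "int ^ 'n" assume \<epsilon>: "0 < \<epsilon>" "\<epsilon> < \<epsilon>0" and \<omega>: "\<omega> \<in> \<Omega>" and z0: "norm (lattice_point \<epsilon> z0) \<le> r"
    have \<epsilon>1: "\<epsilon> \<le> 1" "\<epsilon> < \<delta>" using \<epsilon> e0 by auto
    have "\<epsilon> \<le> min 1 (\<eta> / 6) / (C2 + 1)" using \<epsilon> e0 by linarith
    then have "\<epsilon> * (C2 + 1) \<le> min 1 (\<eta> / 6)" using C2 by (subst (asm) pos_le_divide_eq) auto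
    moreover have "\<epsilon> * C2 \<le> \<epsilon> * (C2 + 1)" using \<epsilon> by simp
    ultimately have eC2: "\<epsilon> * C2 \<le> 1" "\<epsilon> * C2 \<le> \<eta> / 6" by auto
    let ?x = "lattice_point \<epsilon> :: int ^ 'n \<Rightarrow> _"
    define U where "U z = u (?x z) + \<epsilon> * (\<phi> (z + \<omega>) * ?u1 (?x z)) + \<epsilon>\<^sup>2 * (\<Sum>i\<in>UNIV. \<psi> i (z + \<omega>) * ?u2 i (?x z))" for z
    \<comment> \<open>The correctors involve derivatives of \<open>u\<close>, which are controlled
      only on a ball; outside it \<open>U'\<close> falls back to \<open>u\<close>, so that
      \<open>V - U'\<close> is bounded on the whole lattice. The margin 1 contains all neighbours of
      points of the smaller ball, since \<open>\<epsilon> \<le> 1\<close>.\<close>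
    define U' where "U' z = (if norm (?x z) \<le> r1 + 1 then U z else u (?x z))" for z
    have U'u: "\<bar>U' z - u (?x z)\<bar> \<le> \<epsilon> * C2" for z
    proof (cases "norm (?x z) \<le> r1 + 1")
      case True
      have a: "\<bar>\<phi> (z + \<omega>) * ?u1 (?x z)\<bar> \<le> K * B" unfolding abs_mult using B[OF True] K nonneg by (intro mult_mono) auto
      have "\<bar>\<Sum>i\<in>UNIV. \<psi> i (z + \<omega>) * ?u2 i (?x z)\<bar> \<le> (\<Sum>i\<in>UNIV. \<bar>\<psi> i (z + \<omega>) * ?u2 i (?x z)\<bar>)" by (rule sum_abs)
      also have "\<dots> \<le> (\<Sum>i\<in>(UNIV::'n set). K * B)"
        unfolding abs_mult using B[OF True] K nonneg by (intro sum_mono mult_mono) auto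
      finally have b: "\<bar>\<Sum>i\<in>UNIV. \<psi> i (z + \<omega>) * ?u2 i (?x z)\<bar> \<le> ?n * (K * B)" by simp
      have "\<epsilon>\<^sup>2 \<le> \<epsilon>" using \<epsilon> \<epsilon>1 by (simp add: power2_eq_square)
      then have "\<epsilon>\<^sup>2 * \<bar>\<Sum>i\<in>UNIV. \<psi> i (z + \<omega>) * ?u2 i (?x z)\<bar> \<le> \<epsilon> * (?n * (K * B))"
        using b \<epsilon> by (intro mult_mono) auto
      moreover have "\<epsilon> * \<bar>\<phi> (z + \<omega>) * ?u1 (?x z)\<bar> \<le> \<epsilon> * (K * B)" using a \<epsilon> by simp
      moreover have "\<bar>U' z - u (?x z)\<bar> \<le> \<epsilon> * \<bar>\<phi> (z + \<omega>) * ?u1 (?x z)\<bar> + \<epsilon>\<^sup>2 * \<bar>\<Sum>i\<in>UNIV. \<psi> i (z + \<omega>) * ?u2 i (?x z)\<bar>"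
        using True \<epsilon> abs_triangle_ineq[of "\<epsilon> * (\<phi> (z + \<omega>) * ?u1 (?x z))" "\<epsilon>\<^sup>2 * (\<Sum>i\<in>UNIV. \<psi> i (z + \<omega>) * ?u2 i (?x z))"]
        by (simp add: U'_def U_def abs_mult)
      ultimately show ?thesis by (simp add: C2_def algebra_simps)
    next
      case False
      then show ?thesis using \<epsilon> C2 by (simp add: U'_def)
    qed
    have "\<bar>V \<epsilon> \<omega> z0 - U' z0\<bar> \<le> (\<epsilon> * C2 + \<tau> * C3) + M * C / R\<^sup>2"
    proof (rule local_estimate[OF \<epsilon>(1) \<epsilon>1(1)])
      show "0 < R" using R by simp
      show "0 \<le> \<epsilon> * C2 + \<tau> * C3" using \<epsilon> C2 C3 \<tau> by simp
      show "\<bar>V \<epsilon> \<omega> z - U' z\<bar> \<le> M" for z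
        using V_le_F[OF \<epsilon>(1) \<omega>, of z] U'u[of z] eC2(1) u(2)[of "?x z"] by (simp add: M_def)
      fix z assume "norm (?x z - ?x z0) < R"
      then have xr: "norm (?x z) \<le> r1" using z0 norm_triangle_ineq2[of "?x z" "?x z0"] by (simp add: r1_def)
      have nb: "norm (?x z + \<epsilon> *\<^sub>R axis i 1) \<le> r1 + 1" "norm (?x z - \<epsilon> *\<^sub>R axis i 1) \<le> r1 + 1" for i
        using xr norm_triangle_ineq[of "?x z" "\<epsilon> *\<^sub>R axis i 1"] norm_triangle_ineq4[of "?x z" "\<epsilon> *\<^sub>R axis i 1"] \<epsilon> \<epsilon>1 by auto
      have Uz: "U' z = U z" using xr by (simp add: U'_def)
      have st: "walk_at \<omega> U' z = walk_at \<omega> U z"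
        by (rule step_local) (simp_all add: U'_def lattice_point_plus_axis nb)
      have m: "?x z - \<epsilon> *\<^sub>R axis i 1 = ?x z + (- \<epsilon>) *\<^sub>R axis i 1" for i by simp
      have "\<bar>walk_at \<omega> U z - U z - \<epsilon>\<^sup>2 * (q * ?u2 k (?x z)
          + 1 / (2 * real CARD('n)) * (\<Sum>i\<in>UNIV - {k}. partial_deriv i (partial_deriv i u) (?x z)))\<bar>
        \<le> \<epsilon>\<^sup>2 * (\<tau> * (1 + K + real CARD('n) * K))"
        unfolding U_def
      proof (rule corrector_expansion[OF cell_shift[OF cell] bound' K \<epsilon>(1),
            where D="\<lambda>i. partial_deriv i u (?x z)" and h="\<lambda>i. partial_deriv i (partial_deriv i u) (?x z)"])
        fix i j
        show "\<bar>u (?x (z + axis i 1)) - (u (?x z) + \<epsilon> * partial_deriv i u (?x z) + \<epsilon>\<^sup>2 / 2 * partial_deriv i (partial_deriv i u) (?x z))\<bar> \<le> \<epsilon>\<^sup>2 * \<tau>"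
          using t2[OF xr, of \<epsilon> i] \<epsilon> \<epsilon>1 by (simp add: lattice_point_plus_axis)
        show "\<bar>u (?x (z - axis i 1)) - (u (?x z) - \<epsilon> * partial_deriv i u (?x z) + \<epsilon>\<^sup>2 / 2 * partial_deriv i (partial_deriv i u) (?x z))\<bar> \<le> \<epsilon>\<^sup>2 * \<tau>"
          using t2[OF xr, of "-\<epsilon>" i] \<epsilon> \<epsilon>1 by (simp add: lattice_point_plus_axis)
        show "\<bar>?u1 (?x (z + axis i 1)) - (?u1 (?x z) + \<epsilon> * ?u2 i (?x z))\<bar> \<le> \<epsilon> * \<tau>"
          using t1[OF xr, of \<epsilon> k i] \<epsilon> \<epsilon>1 by (simp add: lattice_point_plus_axis)
        show "\<bar>?u1 (?x (z - axis i 1)) - (?u1 (?x z) - \<epsilon> * ?u2 i (?x z))\<bar> \<le> \<epsilon> * \<tau>"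
          using t1[OF xr, of "-\<epsilon>" k i] \<epsilon> \<epsilon>1 by (simp add: lattice_point_plus_axis)
        show "\<bar>?u2 j (?x (z + axis i 1)) - ?u2 j (?x z)\<bar> \<le> \<tau>"
          using t0[OF xr, of \<epsilon> j k i] \<epsilon> \<epsilon>1 by (simp add: lattice_point_plus_axis)
        show "\<bar>?u2 j (?x (z - axis i 1)) - ?u2 j (?x z)\<bar> \<le> \<tau>"
          using t0[OF xr, of "-\<epsilon>" j k i] \<epsilon> \<epsilon>1 by (simp add: lattice_point_plus_axis)
      qed (use \<tau> in auto)
      then have err: "\<bar>walk_at \<omega> U z - U z - \<epsilon>\<^sup>2 * (u (?x z) - f (?x z))\<bar> \<le> \<epsilon>\<^sup>2 * (\<tau> * C3)"
        unfolding pde C3_def .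
      have "(1 + \<epsilon>\<^sup>2) * (V \<epsilon> \<omega> z - U' z) - walk_at \<omega> (\<lambda>z. V \<epsilon> \<omega> z - U' z) z
        = ((1 + \<epsilon>\<^sup>2) * V \<epsilon> \<omega> z - walk_at \<omega> (V \<epsilon> \<omega>) z)
          + (walk_at \<omega> U z - U z) - \<epsilon>\<^sup>2 * U' z"
        unfolding step_diff st Uz by (simp add: algebra_simps)
      also have "\<dots> = (walk_at \<omega> U z - U z - \<epsilon>\<^sup>2 * (u (?x z) - f (?x z))) + \<epsilon>\<^sup>2 * (u (?x z) - U' z)"
        unfolding V_eq[OF \<epsilon>(1) \<omega>] by (simp add: algebra_simps)
      finally have eq: "(1 + \<epsilon>\<^sup>2) * (V \<epsilon> \<omega> z - U' z) - walk_at \<omega> (\<lambda>z. V \<epsilon> \<omega> z - U' z) z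
        = (walk_at \<omega> U z - U z - \<epsilon>\<^sup>2 * (u (?x z) - f (?x z))) + \<epsilon>\<^sup>2 * (u (?x z) - U' z)" .
      have "\<bar>\<epsilon>\<^sup>2 * (u (?x z) - U' z)\<bar> \<le> \<epsilon>\<^sup>2 * (\<epsilon> * C2)"
        using U'u[of z] by (auto simp: abs_mult abs_minus_commute intro!: mult_left_mono)
      then show "\<bar>(1 + \<epsilon>\<^sup>2) * (V \<epsilon> \<omega> z - U' z) - walk_at \<omega> (\<lambda>z. V \<epsilon> \<omega> z - U' z) z\<bar> \<le> \<epsilon>\<^sup>2 * (\<epsilon> * C2 + \<tau> * C3)"
        unfolding eq distrib_left using err by linarith
    qed
    \<comment> \<open>The budget: \<open>\<eta> / 6\<close> for the consistency error and for each
      of the two corrector terms, \<open>\<eta> / 3\<close> for the boundary term.\<close>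
    then show "\<bar>V \<epsilon> \<omega> z0 - u (?x z0)\<bar> \<le> \<eta>"
      using U'u[of z0] eC2 \<tau>(2) R(2) assms by linarith
  qed
qed

lemma continuous_u: "continuous_on UNIV u"
  using u(1) by (auto simp: numeral_2_eq_2 intro!: continuous_at_imp_continuous_on differentiable_imp_continuous_within)

text \<open>Local convergence covers bounded sets. Far away \<open>V\<close> is small by
  \<open>V_decay\<close>, and \<open>u\<close> inherits this smallness as the limit of
  \<open>V\<close>.\<close>

lemma uniform_convergence:
  assumes "0 < \<eta>"
  obtains \<epsilon>0 where "0 < \<epsilon>0"
    "\<And>\<epsilon> \<omega> x. 0 < \<epsilon> \<Longrightarrow> \<epsilon> < \<epsilon>0 \<Longrightarrow> \<omega> \<in> \<Omega> \<Longrightarrow> \<bar>V \<epsilon> \<omega> (\<chi> i. \<lfloor>x $ i / \<epsilon>\<rfloor>) - u x\<bar> \<le> \<eta>"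
proof (cases "\<Omega> = {}")
  case True
  then show ?thesis using that[of 1] by simp
next
  case False
  let ?n = "real CARD('n)"
  obtain R where R: "1 \<le> R" "F * C / R\<^sup>2 \<le> \<eta> / 4" using ex_radius[of "\<eta> / 4" F] assms by auto
  define r where "r = \<rho> + R + 1"
  have r0: "0 \<le> r" using \<rho> R by (simp add: r_def)
  have n1: "1 \<le> ?n" by (simp add: Suc_le_eq)
  have far: "\<bar>V \<epsilon> \<omega> (\<chi> i. \<lfloor>x $ i / \<epsilon>\<rfloor>)\<bar> \<le> \<eta> / 4" if "0 < \<epsilon>" "?n * \<epsilon> \<le> 1" "\<omega> \<in> \<Omega>" "r \<le> norm x" for \<epsilon> \<omega> x
  proof -
    have "norm x - norm (lattice_floor \<epsilon> x) \<le> ?n * \<epsilon>"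
      using lattice_floor_close[OF that(1), of x] norm_triangle_ineq2[of x "lattice_floor \<epsilon> x"] by (simp add: norm_minus_commute)
    then have R': "\<rho> + R \<le> norm (lattice_point \<epsilon> (\<chi> i. \<lfloor>x $ i / \<epsilon>\<rfloor>))"
      using that unfolding lattice_floor_def r_def by linarith
    have "\<epsilon> \<le> 1" using mult_right_mono[OF n1, of \<epsilon>] that(1,2) by linarith
    from V_decay[OF that(1) this that(3) _ R'] R show ?thesis by linarith
  qed
  have near: "\<exists>\<epsilon>0>0. \<forall>\<epsilon> \<omega> x. 0 < \<epsilon> \<longrightarrow> \<epsilon> < \<epsilon>0 \<longrightarrow> \<omega> \<in> \<Omega> \<longrightarrow> norm x \<le> s \<longrightarrow> \<bar>V \<epsilon> \<omega> (\<chi> i. \<lfloor>x $ i / \<epsilon>\<rfloor>) - u x\<bar> \<le> \<eta> / 2"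
    if "0 \<le> s" for s
  proof -
    obtain e where e: "0 < e" "e \<le> 1" "\<And>\<epsilon> \<omega> z. 0 < \<epsilon> \<Longrightarrow> \<epsilon> < e \<Longrightarrow> \<omega> \<in> \<Omega> \<Longrightarrow> norm (lattice_point \<epsilon> z) \<le> s + 1 \<Longrightarrow>
      \<bar>V \<epsilon> \<omega> z - u (lattice_point \<epsilon> z)\<bar> \<le> \<eta> / 4"
    proof (rule local_convergence)
      show "0 < \<eta> / 4" "0 \<le> s + 1" using assms \<open>0 \<le> s\<close> by auto
    qed (rule that)
    have "uniformly_continuous_on (cball 0 (s + 1)) u"
      by (intro compact_uniformly_continuous continuous_on_subset[OF continuous_u]) auto
    then obtain d where d: "0 < d" "\<And>x y. x \<in> cball 0 (s + 1) \<Longrightarrow> y \<in> cball 0 (s + 1) \<Longrightarrow> dist y x < d \<Longrightarrow> \<bar>u y - u x\<bar> < \<eta> / 4"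
      unfolding uniformly_continuous_on_def dist_real_def using assms by (metis zero_less_divide_iff zero_less_numeral)
    define \<epsilon>0 where "\<epsilon>0 = min e (min 1 d / (2 * ?n))"
    have pos: "0 < \<epsilon>0" using e d n1 by (simp add: \<epsilon>0_def)
    moreover have "\<bar>V \<epsilon> \<omega> (\<chi> i. \<lfloor>x $ i / \<epsilon>\<rfloor>) - u x\<bar> \<le> \<eta> / 2"
      if "0 < \<epsilon>" "\<epsilon> < \<epsilon>0" "\<omega> \<in> \<Omega>" "norm x \<le> s" for \<epsilon> \<omega> x
    proof -
      have "\<epsilon> < min 1 d / (2 * ?n)" using that by (simp add: \<epsilon>0_def)
      then have "\<epsilon> * (2 * ?n) < min 1 d" using n1 by (subst (asm) pos_less_divide_eq) auto
      moreover have "?n * \<epsilon> \<le> \<epsilon> * (2 * ?n)" using that by simp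
      ultimately have ne: "?n * \<epsilon> < min 1 d" by linarith
      have cl: "norm (lattice_floor \<epsilon> x - x) < min 1 d" using lattice_floor_close[OF that(1), of x] ne by linarith
      have "norm (lattice_floor \<epsilon> x) \<le> s + 1"
        using cl that norm_triangle_ineq2[of "lattice_floor \<epsilon> x" x] by simp
      then have "\<bar>V \<epsilon> \<omega> (\<chi> i. \<lfloor>x $ i / \<epsilon>\<rfloor>) - u (lattice_floor \<epsilon> x)\<bar> \<le> \<eta> / 4"
        "\<bar>u (lattice_floor \<epsilon> x) - u x\<bar> < \<eta> / 4"
        using e(3)[OF that(1) _ that(3), of "\<chi> i. \<lfloor>x $ i / \<epsilon>\<rfloor>"] d(2)[of x "lattice_floor \<epsilon> x"] that cl
        by (auto simp: lattice_floor_def[symmetric] \<epsilon>0_def dist_norm)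
      then show ?thesis by linarith
    qed
    ultimately show ?thesis by blast
  qed
  \<comment> \<open>\<open>near\<close> is applied on the ball through \<open>x\<close> itself, and
    a point of \<open>\<Omega>\<close> is needed to speak of \<open>V\<close> at all. The bound is
    \<open>\<eta> / 2 + \<eta> / 4\<close>.\<close>
  have u_far: "\<bar>u x\<bar> \<le> 3 * \<eta> / 4" if x: "r \<le> norm x" for x
  proof -
    obtain \<epsilon>0 where e0: "0 < \<epsilon>0" "\<And>\<epsilon> \<omega> y. 0 < \<epsilon> \<Longrightarrow> \<epsilon> < \<epsilon>0 \<Longrightarrow> \<omega> \<in> \<Omega> \<Longrightarrow> norm y \<le> norm x \<Longrightarrow> \<bar>V \<epsilon> \<omega> (\<chi> i. \<lfloor>y $ i / \<epsilon>\<rfloor>) - u y\<bar> \<le> \<eta> / 2"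
      using near[of "norm x"] by auto
    define \<epsilon> where "\<epsilon> = min (\<epsilon>0 / 2) (1 / ?n)"
    have \<epsilon>: "0 < \<epsilon>" "\<epsilon> < \<epsilon>0" "?n * \<epsilon> \<le> 1"
    proof -
      show "0 < \<epsilon>" "\<epsilon> < \<epsilon>0" using e0 n1 by (auto simp: \<epsilon>_def min_less_iff_disj)
      have "\<epsilon> \<le> 1 / ?n" by (simp add: \<epsilon>_def)
      then show "?n * \<epsilon> \<le> 1" using n1 by (simp add: field_simps)
    qed
    obtain \<omega> where \<omega>: "\<omega> \<in> \<Omega>" using False by blast
    show ?thesis using far[OF \<epsilon>(1,3) \<omega> x] e0(2)[OF \<epsilon>(1,2) \<omega> order_refl] by linarith
  qed
  obtain \<epsilon>0 where e0: "0 < \<epsilon>0" "\<And>\<epsilon> \<omega> x. 0 < \<epsilon> \<Longrightarrow> \<epsilon> < \<epsilon>0 \<Longrightarrow> \<omega> \<in> \<Omega> \<Longrightarrow> norm x \<le> r \<Longrightarrow> \<bar>V \<epsilon> \<omega> (\<chi> i. \<lfloor>x $ i / \<epsilon>\<rfloor>) - u x\<bar> \<le> \<eta> / 2"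
    using near[OF r0] by auto
  show ?thesis
  proof (rule that[of "min \<epsilon>0 (1 / ?n)"])
    show "0 < min \<epsilon>0 (1 / ?n)" using e0 n1 by simp
    fix \<epsilon> \<omega> x assume \<epsilon>: "0 < \<epsilon>" "\<epsilon> < min \<epsilon>0 (1 / ?n)" and \<omega>: "\<omega> \<in> \<Omega>"
    then have "?n * \<epsilon> \<le> 1" using n1 by (simp add: field_simps)
    show "\<bar>V \<epsilon> \<omega> (\<chi> i. \<lfloor>x $ i / \<epsilon>\<rfloor>) - u x\<bar> \<le> \<eta>"
    proof (cases "norm x \<le> r")
      case True
      then show ?thesis using e0(2)[OF \<epsilon>(1) _ \<omega>, of x] \<epsilon> assms by simp
    next
      case False
      then have "r \<le> norm x" by simp
      then show ?thesis using far[OF \<epsilon>(1) \<open>?n * \<epsilon> \<le> 1\<close> \<omega>, of x] u_far[of x] by linarith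
    qed
  qed
qed

end

subsection \<open>Uniqueness of the effective diffusion constant\<close>

lemma partial_deriv_add:
  assumes "f differentiable (at x)" "g differentiable (at x)"
  shows "partial_deriv i (\<lambda>x. f x + g x) x = partial_deriv i f x + partial_deriv i g x"
proof -
  have "((\<lambda>x. f x + g x) has_derivative (\<lambda>h. frechet_derivative f (at x) h + frechet_derivative g (at x) h)) (at x)"
    using assms frechet_derivative_works by (blast intro: has_derivative_add)
  from frechet_derivative_at[OF this] show ?thesis by (simp add: partial_deriv_def flip: fun_eq_iff) (metis)
qed

lemma partial_deriv_cmult:
  fixes c :: real
  assumes "f differentiable (at x)"
  shows "partial_deriv i (\<lambda>x. c * f x) x = c * partial_deriv i f x"
proof -
  have "((\<lambda>x. c * f x) has_derivative (\<lambda>h. c * frechet_derivative f (at x) h)) (at x)"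
    using assms frechet_derivative_works by (blast intro: has_derivative_mult_right)
  from frechet_derivative_at[OF this] show ?thesis by (simp add: partial_deriv_def flip: fun_eq_iff) (metis)
qed

lemma C_class_add: "C_class m f \<Longrightarrow> C_class m g \<Longrightarrow> C_class m (\<lambda>x. f x + g x)"
proof (induction m arbitrary: f g)
  case 0
  then show ?case by (simp add: continuous_on_add)
next
  case (Suc m)
  then have "partial_deriv i (\<lambda>x. f x + g x) = (\<lambda>x. partial_deriv i f x + partial_deriv i g x)" for i
    by (auto simp: partial_deriv_add)
  then show ?case using Suc by (auto intro: differentiable_add)
qed

lemma C_class_cmult: "C_class m f \<Longrightarrow> C_class m (\<lambda>x. c * f x)"
proof (induction m arbitrary: f)
  case 0
  then show ?case by (simp add: continuous_on_mult_left)
next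
  case (Suc m)
  then have "partial_deriv i (\<lambda>x. c * f x) = (\<lambda>x. c * partial_deriv i f x)" for i
    by (auto simp: partial_deriv_cmult)
  then show ?case using Suc by (auto intro: differentiable_mult)
qed

lemma smooth_differentiable: "smooth f \<Longrightarrow> f differentiable (at x)"
  unfolding smooth_def by (metis C_class.simps(2))

lemma smooth_partial_deriv: "smooth f \<Longrightarrow> smooth (partial_deriv i f)"
  unfolding smooth_def by (metis C_class.simps(2))

lemma smooth_continuous: "smooth f \<Longrightarrow> continuous_on UNIV f"
  unfolding smooth_def by (metis C_class.simps(1))

lemma smooth_add: "smooth f \<Longrightarrow> smooth g \<Longrightarrow> smooth (\<lambda>x. f x + g x)"
  by (simp add: smooth_def C_class_add)

lemma smooth_cmult: "smooth f \<Longrightarrow> smooth (\<lambda>x. c * f x)"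
  by (simp add: smooth_def C_class_cmult)

lemma smooth_diff: "smooth f \<Longrightarrow> smooth g \<Longrightarrow> smooth (\<lambda>x. f x - g x)"
  using smooth_add[OF _ smooth_cmult[of g "-1"], of f] by simp

lemma smooth_zero: "smooth (\<lambda>_. 0)"
proof -
  have "C_class m (\<lambda>_ :: real ^ 'a. 0)" for m
  proof (induction m)
    case (Suc m)
    moreover have "partial_deriv i (\<lambda>_ :: real ^ 'a. 0) = (\<lambda>_. 0)" for i
      by (simp add: partial_deriv_def fun_eq_iff)
    ultimately show ?case by simp
  qed simp
  then show ?thesis by (simp add: smooth_def)
qed

lemma smooth_sum: "(\<And>i. i \<in> S \<Longrightarrow> smooth (f i)) \<Longrightarrow> smooth (\<lambda>x. \<Sum>i\<in>S. f i x)"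
  by (induction S rule: infinite_finite_induct) (auto intro: smooth_add simp: smooth_zero)

lemma second_partial_add:
  assumes "smooth f" "smooth g"
  shows "partial_deriv j (partial_deriv i (\<lambda>x. f x + g x)) x = partial_deriv j (partial_deriv i f) x + partial_deriv j (partial_deriv i g) x"
proof -
  have "partial_deriv i (\<lambda>x. f x + g x) = (\<lambda>x. partial_deriv i f x + partial_deriv i g x)"
    using assms by (simp add: fun_eq_iff partial_deriv_add smooth_differentiable)
  then show ?thesis using assms by (simp add: partial_deriv_add smooth_differentiable smooth_partial_deriv)
qed

lemma second_partial_cmult:
  assumes "smooth f"
  shows "partial_deriv j (partial_deriv i (\<lambda>x. c * f x)) x = c * partial_deriv j (partial_deriv i f) x"
proof -
  have "partial_deriv i (\<lambda>x. c * f x) = (\<lambda>x. c * partial_deriv i f x)"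
    using assms by (simp add: fun_eq_iff partial_deriv_cmult smooth_differentiable)
  then show ?thesis using assms by (simp add: partial_deriv_cmult smooth_differentiable smooth_partial_deriv)
qed

definition diffusion :: "'n::finite \<Rightarrow> real \<Rightarrow> (real ^ 'n \<Rightarrow> real) \<Rightarrow> real ^ 'n \<Rightarrow> real" where
  "diffusion k q u x = q * partial_deriv k (partial_deriv k u) x
     + (\<Sum>j\<in>UNIV - {k}. 1 / (2 * real CARD('n)) * partial_deriv j (partial_deriv j u) x)"

lemma diffusion_add: "smooth f \<Longrightarrow> smooth g \<Longrightarrow> diffusion k q (\<lambda>x. f x + g x) x = diffusion k q f x + diffusion k q g x"
  by (simp add: diffusion_def second_partial_add distrib_left sum.distrib del: mult_1 times_divide_eq_left)

lemma diffusion_cmult: "smooth f \<Longrightarrow> diffusion k q (\<lambda>x. c * f x) x = c * diffusion k q f x"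
  by (simp add: diffusion_def second_partial_cmult distrib_left sum_distrib_left mult.left_commute)

lemma diffusion_zero: "diffusion k q (\<lambda>_. 0) x = 0"
  using diffusion_cmult[OF smooth_zero, of k q 0 x] by simp

lemma diffusion_sum: "(\<And>i. i \<in> S \<Longrightarrow> smooth (f i)) \<Longrightarrow> diffusion k q (\<lambda>x. \<Sum>i\<in>S. f i x) x = (\<Sum>i\<in>S. diffusion k q (f i) x)"
  by (induction S rule: infinite_finite_induct) (auto simp: diffusion_zero diffusion_add smooth_sum)

lemma smooth_diffusion: "smooth u \<Longrightarrow> smooth (diffusion k q u)"
  unfolding diffusion_def by (intro smooth_add smooth_cmult smooth_sum smooth_partial_deriv)

section \<open>Compactly supported smooth test functions\<close>

definition flat :: "nat \<Rightarrow> real \<Rightarrow> real" where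
  "flat n t = (if t \<le> 0 then 0 else inverse t ^ n * exp (- inverse t))"

text \<open>The powers of the reciprocal make the family closed under differentiation up to linear
  combination. At 0 the right difference quotient is the next member of the family, a power of the
  reciprocal divided by its exponential, and tends to 0.\<close>

lemma flat_has_derivative:
  "(flat n has_real_derivative flat (n + 2) t - real n * flat (Suc n) t) (at t)"
proof -
  consider "t < 0" | "t > 0" | "t = 0" by linarith
  then show ?thesis
  proof cases
    case 1
    have "((\<lambda>_. 0) has_real_derivative 0) (at t)" by simp
    then have "(flat n has_real_derivative 0) (at t)"
      by (rule has_field_derivative_transform_within_open[of _ _ _ "{..<0}"]) (use 1 in \<open>auto simp: flat_def\<close>)
    then show ?thesis using 1 by (simp add: flat_def)
  next
    case 2
    have "((\<lambda>t. inverse t ^ n * exp (- inverse t)) has_real_derivative flat (n + 2) t - real n * flat (Suc n) t) (at t)"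
      using 2 by (auto intro!: derivative_eq_intros simp: flat_def power2_eq_square field_simps)
        (cases n; simp add: field_simps)
    then show ?thesis
      by (rule has_field_derivative_transform_within_open[of _ _ _ "{0<..}"]) (use 2 in \<open>auto simp: flat_def\<close>)
  next
    case 3
    have "((\<lambda>h. flat n h / h) \<longlongrightarrow> 0) (at_right 0)"
    proof -
      have "((\<lambda>h::real. inverse h ^ Suc n / exp (inverse h)) \<longlongrightarrow> 0) (at_right 0)"
        by (rule filterlim_compose[OF tendsto_power_div_exp_0 filterlim_inverse_at_top_right])
      moreover have "\<forall>\<^sub>F h in at_right 0. inverse h ^ Suc n / exp (inverse h) = flat n h / h"
        by (rule eventually_at_right_less[THEN eventually_mono]) (simp add: flat_def exp_minus field_simps)
      ultimately show ?thesis by (rule Lim_transform_eventually)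
    qed
    moreover have "((\<lambda>h. flat n h / h) \<longlongrightarrow> 0) (at_left 0)"
    proof (rule Lim_transform_eventually[OF tendsto_const])
      show "\<forall>\<^sub>F h in at_left 0. 0 = flat n h / h"
        by (auto simp: flat_def eventually_at_filter)
    qed
    ultimately have "((\<lambda>h. flat n h / h) \<longlongrightarrow> 0) (at 0)" using filterlim_split_at by blast
    then have "(flat n has_real_derivative 0) (at 0)"
      by (simp add: DERIV_def flat_def)
    then show ?thesis using 3 by (simp add: flat_def)
  qed
qed

text \<open>This span is closed under differentiation and all its members vanish outside the unit
  interval, so derivatives of every order are available without closed formulas.\<close>

inductive bump_span :: "(real \<Rightarrow> real) \<Rightarrow> bool" where
  base: "bump_span (\<lambda>t. flat m t * flat n (1 - t))"
| add: "bump_span f \<Longrightarrow> bump_span g \<Longrightarrow> bump_span (\<lambda>t. f t + g t)"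
| scale: "bump_span f \<Longrightarrow> bump_span (\<lambda>t. c * f t)"

lemma bump_span_derivative:
  "bump_span f \<Longrightarrow> \<exists>f'. bump_span f' \<and> (\<forall>t. (f has_real_derivative f' t) (at t))"
proof (induction rule: bump_span.induct)
  case (base m n)
  let ?b = "\<lambda>m n t. flat m t * flat n (1 - t)"
  let ?f' = "\<lambda>t. (?b (m + 2) n t + (- real m) * ?b (Suc m) n t) + ((-1) * ?b m (n + 2) t + real n * ?b m (Suc n) t)"
  have "(?b m n has_real_derivative ?f' t) (at t)" for t
    by (auto intro!: derivative_eq_intros flat_has_derivative DERIV_chain2[OF flat_has_derivative, of _ _ t] simp: algebra_simps)
  moreover have "bump_span ?f'" by (intro bump_span.intros)
  ultimately show ?case by blast
next
  case (add f g)
  then obtain f' g' where "bump_span f'" "bump_span g'" "\<forall>t. (f has_real_derivative f' t) (at t)" "\<forall>t. (g has_real_derivative g' t) (at t)" by blast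
  then show ?case by (intro exI[of _ "\<lambda>t. f' t + g' t"]) (auto intro: bump_span.intros derivative_intros)
next
  case (scale f c)
  then obtain f' where "bump_span f'" "\<forall>t. (f has_real_derivative f' t) (at t)" by blast
  then show ?case by (intro exI[of _ "\<lambda>t. c * f' t"]) (auto intro: bump_span.intros DERIV_cmult)
qed

lemma bump_span_support: "bump_span f \<Longrightarrow> t \<le> 0 \<or> 1 \<le> t \<Longrightarrow> f t = 0"
  by (induction rule: bump_span.induct) (auto simp: flat_def)

text \<open>Fixing the whole chain of derivatives at once turns differentiation of products of these
  functions into raising an index.\<close>

lemma bump_derivatives:
  obtains G :: "nat \<Rightarrow> real \<Rightarrow> real" where
    "G 0 (1 / 2) \<noteq> 0" "\<And>m t. (G m has_real_derivative G (Suc m) t) (at t)"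
    "\<And>m t. t \<le> 0 \<or> 1 \<le> t \<Longrightarrow> G m t = 0"
proof -
  let ?P = "\<lambda>(m::nat) g. bump_span g \<and> (m = 0 \<longrightarrow> g (1 / 2) \<noteq> 0)"
  have "\<exists>G. \<forall>m. ?P m (G m) \<and> (\<forall>t. (G m has_real_derivative G (Suc m) t) (at t))"
  proof (rule dependent_nat_choice)
    show "\<exists>g. ?P 0 g"
      by (rule exI[of _ "\<lambda>t. flat 0 t * flat 0 (1 - t)"]) (intro conjI impI bump_span.base, simp add: flat_def)
    show "\<exists>g'. ?P (Suc m) g' \<and> (\<forall>t. (g has_real_derivative g' t) (at t))" if "?P m g" for g m
      using bump_span_derivative[of g] that by auto
  qed
  then obtain G where "\<forall>m. ?P m (G m) \<and> (\<forall>t. (G m has_real_derivative G (Suc m) t) (at t))" by blast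
  then show ?thesis using that[of G] bump_span_support by blast
qed

locale test_functions =
  fixes G :: "nat \<Rightarrow> real \<Rightarrow> real"
  assumes G0: "G 0 (1 / 2) \<noteq> 0"
    and G_deriv: "\<And>m t. (G m has_real_derivative G (Suc m) t) (at t)"
    and G_support: "\<And>m t. t \<le> 0 \<or> 1 \<le> t \<Longrightarrow> G m t = 0"
begin

definition W :: "('n::finite \<Rightarrow> nat) \<Rightarrow> real ^ 'n \<Rightarrow> real" where
  "W n x = (\<Prod>i\<in>UNIV. G (n i) (x $ i))"

lemma W_differentiable: "W n differentiable (at x)"
proof -
  have "((\<lambda>x. x $ i) has_derivative (\<lambda>h. h $ i)) (at x)" for i
    by (rule bounded_linear_imp_has_derivative[OF bounded_linear_vec_nth])
  moreover have "(G (n i) has_derivative (\<lambda>h. G (Suc (n i)) (x $ i) * h)) (at (x $ i))" for i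
    using G_deriv[of "n i" "x $ i"] by (simp add: has_field_derivative_def)
  ultimately have "((\<lambda>x. G (n i) (x $ i)) has_derivative (\<lambda>h. G (Suc (n i)) (x $ i) * h $ i)) (at x)" for i
    by (rule has_derivative_compose)
  from has_derivative_prod[of UNIV "\<lambda>i x. G (n i) (x $ i)", OF this] show ?thesis unfolding W_def differentiable_def by blast
qed

lemma partial_deriv_W: "partial_deriv j (W n) = W (n(j := Suc (n j)))"
proof
  fix x
  define P where "P = (\<Prod>i\<in>UNIV - {j}. G (n i) (x $ i))"
  have line: "W n (x + t *\<^sub>R axis j 1) = G (n j) (x $ j + t) * P" for t
  proof -
    have "W n (x + t *\<^sub>R axis j 1) = G (n j) (x $ j + t) * (\<Prod>i\<in>UNIV - {j}. G (n i) ((x + t *\<^sub>R axis j 1) $ i))"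
      unfolding W_def by (subst prod.remove[of _ j]) auto
    also have "(\<Prod>i\<in>UNIV - {j}. G (n i) ((x + t *\<^sub>R axis j 1) $ i)) = P"
      unfolding P_def by (rule prod.cong) (auto simp: axis_def)
    finally show ?thesis .
  qed
  have "((\<lambda>t. W n (x + t *\<^sub>R axis j 1)) has_real_derivative G (Suc (n j)) (x $ j) * P) (at 0)"
    unfolding line using DERIV_shift[of "G (n j)" "G (Suc (n j)) (x $ j)" 0 "x $ j"] G_deriv[of "n j" "x $ j"]
    by (auto intro!: DERIV_cmult_right simp: add.commute)
  moreover have "((\<lambda>t. W n (x + t *\<^sub>R axis j 1)) has_real_derivative partial_deriv j (W n) (x + 0 *\<^sub>R axis j 1)) (at 0)"
    by (rule has_real_derivative_line[OF W_differentiable])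
  ultimately have "partial_deriv j (W n) x = G (Suc (n j)) (x $ j) * P"
    using DERIV_unique by fastforce
  also have "\<dots> = W (n(j := Suc (n j))) x"
    unfolding W_def P_def by (subst (2) prod.remove[of _ j]) auto
  finally show "partial_deriv j (W n) x = W (n(j := Suc (n j))) x" .
qed

lemma smooth_W:
  fixes n :: "'n::finite \<Rightarrow> nat"
  shows "smooth (W n)"
proof -
  have "C_class m (W n)" for m and n :: "'n \<Rightarrow> nat"
  proof (induction m arbitrary: n)
    case 0
    then show ?case by (auto intro!: continuous_at_imp_continuous_on differentiable_imp_continuous_within W_differentiable)
  next
    case (Suc m)
    then show ?case by (simp add: partial_deriv_W W_differentiable)
  qed
  then show ?thesis by (simp add: smooth_def)
qed

lemma W_support:
  assumes "real CARD('n) < norm x" shows "W n (x :: real ^ 'n::finite) = 0"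
proof -
  have "\<exists>i. 1 \<le> \<bar>x $ i\<bar>"
  proof (rule ccontr)
    assume "\<not> ?thesis"
    then have "(\<Sum>i\<in>UNIV. \<bar>x $ i\<bar>) \<le> (\<Sum>i\<in>(UNIV::'n set). 1)" by (intro sum_mono) (metis linear)
    then show False using norm_le_l1_cart[of x] assms by simp
  qed
  then obtain i where "1 \<le> \<bar>x $ i\<bar>" by blast
  then have "x $ i \<le> 0 \<or> 1 \<le> x $ i" by linarith
  then have "G (n i) (x $ i) = 0" by (rule G_support)
  then show ?thesis unfolding W_def by (metis UNIV_I finite prod_zero_iff)
qed

lemma diffusion_W:
  fixes n :: "'n::finite \<Rightarrow> nat"
  shows "diffusion k q (W n) x = q * W (n(k := n k + 2)) x + (\<Sum>j\<in>UNIV - {k}. 1 / (2 * real CARD('n)) * W (n(j := n j + 2)) x)"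
  by (simp add: diffusion_def partial_deriv_W)

text \<open>Constant-coefficient operators commute, so one right-hand side has explicit compactly supported
  solutions for two different values of the diffusion constant.\<close>

lemma diffusion_commute:
  fixes n :: "'n::finite \<Rightarrow> nat"
  shows "diffusion k q (diffusion k q' (W n)) x = diffusion k q' (diffusion k q (W n)) x"
proof -
  let ?c = "1 / (2 * real CARD('n))"
  \<comment> \<open>The expansion is symmetric in \<open>r\<close> and \<open>s\<close>, because the
    two operators differ only in the coefficient along \<open>k\<close>.\<close>
  have D: "diffusion k r (diffusion k s (W n)) x =
    s * (r * W (n(k := n k + 4)) x) + s * (\<Sum>j\<in>UNIV - {k}. ?c * W (n(k := n k + 2, j := n j + 2)) x)
    + r * (\<Sum>j\<in>UNIV - {k}. ?c * W (n(k := n k + 2, j := n j + 2)) x)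
    + (\<Sum>j\<in>UNIV - {k}. ?c * (\<Sum>i\<in>UNIV - {k}. ?c * W (n(j := n j + 2, i := (n(j := n j + 2)) i + 2)) x))" for r s
  proof -
    have "diffusion k s (W n) = (\<lambda>x. s * W (n(k := n k + 2)) x + (\<Sum>j\<in>UNIV - {k}. ?c * W (n(j := n j + 2)) x))"
      by (rule ext) (rule diffusion_W)
    then have "diffusion k r (diffusion k s (W n)) x = s * diffusion k r (W (n(k := n k + 2))) x
      + (\<Sum>j\<in>UNIV - {k}. ?c * diffusion k r (W (n(j := n j + 2))) x)"
      by (simp only: diffusion_add diffusion_cmult diffusion_sum smooth_W smooth_cmult smooth_sum)
    also have "diffusion k r (W (n(k := n k + 2))) x = r * W (n(k := n k + 4)) x
       + (\<Sum>j\<in>UNIV - {k}. ?c * W (n(k := n k + 2, j := n j + 2)) x)"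
      unfolding diffusion_W by (intro arg_cong2[where f="(+)"] sum.cong) (auto simp: numeral_eq_Suc)
    also have "(\<Sum>j\<in>UNIV - {k}. ?c * diffusion k r (W (n(j := n j + 2))) x)
      = (\<Sum>j\<in>UNIV - {k}. r * (?c * W (n(k := n k + 2, j := n j + 2)) x)
         + ?c * (\<Sum>i\<in>UNIV - {k}. ?c * W (n(j := n j + 2, i := (n(j := n j + 2)) i + 2)) x))"
      unfolding diffusion_W by (rule sum.cong) (auto simp: fun_upd_twist distrib_left)
    also have "\<dots> = r * (\<Sum>j\<in>UNIV - {k}. ?c * W (n(k := n k + 2, j := n j + 2)) x)
      + (\<Sum>j\<in>UNIV - {k}. ?c * (\<Sum>i\<in>UNIV - {k}. ?c * W (n(j := n j + 2, i := (n(j := n j + 2)) i + 2)) x))"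
      by (simp only: sum.distrib sum_distrib_left)
    finally show ?thesis by (simp only: distrib_left add.assoc)
  qed
  show ?thesis unfolding D by (simp only: mult.left_commute add.commute add.left_commute add.assoc)
qed

text \<open>In the uniqueness argument this function multiplies \<open>q' - q\<close>. If the second
  derivative of the bump vanished, the bump would be affine, and its compact support would make it
  zero.\<close>

lemma W_second_nonzero: "\<exists>x. W ((\<lambda>_. 0)(k := 2)) x \<noteq> 0"
proof (rule ccontr)
  assume "\<not> ?thesis"
  then have zero: "W ((\<lambda>_. 0)(k := 2)) x = 0" for x by blast
  have "G 2 t = 0" for t
  proof -
    have "W ((\<lambda>_. 0)(k := 2)) (\<chi> i. if i = k then t else 1 / 2) = G 2 t * (\<Prod>i\<in>UNIV - {k}. G 0 (1 / 2))"
      unfolding W_def by (subst prod.remove[of _ k]) (auto intro!: prod.cong)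
    then show ?thesis using zero G0 by simp
  qed
  then have "(G 1 has_real_derivative 0) (at t)" for t using G_deriv[of 1 t] by (simp add: numeral_2_eq_2)
  then have "G 1 t = G 1 2" for t by (metis DERIV_isconst_all)
  then have "G 1 t = 0" for t using G_support[of 2 1] by simp
  then have "(G 0 has_real_derivative 0) (at t)" for t using G_deriv[of 0 t] by simp
  then have "G 0 t = G 0 2" for t by (metis DERIV_isconst_all)
  then show False using G0 G_support[of 2 0] by simp
qed

end

text \<open>The defining condition speaks about given solutions, so uniqueness requires exhibiting
  one. Averaging does not increase the supremum norm, so the Neumann series with ratio
  \<open>1 / (1 + \<epsilon>\<^sup>2)\<close> converges geometrically.\<close>

lemma discrete_solution_exists:
  fixes \<beta> :: "int ^ 'n::finite \<Rightarrow> real"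
  assumes \<beta>: "\<And>y. \<bar>\<beta> y\<bar> \<le> 1 / (2 * real CARD('n))" and "\<epsilon> \<noteq> 0" and g: "\<And>z. \<bar>g z\<bar> \<le> F"
  shows "\<exists>V. (\<forall>z. \<bar>V z\<bar> \<le> F * (1 + \<epsilon>\<^sup>2)) \<and> (\<forall>z. (1 + \<epsilon>\<^sup>2) * V z - step k \<beta> V z = \<epsilon>\<^sup>2 * g z)"
proof -
  define r where "r = 1 / (1 + \<epsilon>\<^sup>2)"
  have e: "0 < \<epsilon>\<^sup>2" using assms by simp
  define s where "s = \<epsilon>\<^sup>2"
  have s: "0 < s" using e by (simp add: s_def)
  then have r: "0 < r" "r < 1" "r * (1 + \<epsilon>\<^sup>2) = 1" by (simp_all add: r_def flip: s_def)
  define d where "d m = ((\<lambda>h z. r * step k \<beta> h z) ^^ m) (\<lambda>z. r * (\<epsilon>\<^sup>2 * g z))" for m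
  have F: "0 \<le> F" using g[of 0] by linarith
  have dS: "d (Suc m) z = r * step k \<beta> (d m) z" for m z by (simp add: d_def)
  have db: "\<bar>d m z\<bar> \<le> r ^ m * (\<epsilon>\<^sup>2 * F)" for m z
  proof (induction m arbitrary: z)
    case 0
    have "r * (\<epsilon>\<^sup>2 * \<bar>g z\<bar>) \<le> 1 * (\<epsilon>\<^sup>2 * F)" using r g F by (intro mult_mono) auto
    then show ?case using r by (simp add: d_def abs_mult)
  next
    case (Suc m)
    have "step k \<beta> (d m) z \<le> r ^ m * (\<epsilon>\<^sup>2 * F)" using Suc by (intro step_le_of_bounded \<beta>) (auto simp: abs_le_iff)
    moreover have "step k \<beta> (\<lambda>z. - d m z) z \<le> r ^ m * (\<epsilon>\<^sup>2 * F)" using Suc by (intro step_le_of_bounded \<beta>) (auto simp: abs_le_iff)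
    ultimately have "\<bar>step k \<beta> (d m) z\<bar> \<le> r ^ m * (\<epsilon>\<^sup>2 * F)" unfolding step_uminus by linarith
    then have "r * \<bar>step k \<beta> (d m) z\<bar> \<le> r * (r ^ m * (\<epsilon>\<^sup>2 * F))" using r by (intro mult_left_mono) auto
    then show ?case using r by (simp add: dS abs_mult mult.assoc)
  qed
  have geo: "(\<lambda>m. r ^ m * (\<epsilon>\<^sup>2 * F)) sums (1 / (1 - r) * (\<epsilon>\<^sup>2 * F))"
    using r by (intro sums_mult2 geometric_sums) auto
  have sm: "summable (\<lambda>m. d m z)" for z
    by (rule summable_comparison_test'[OF sums_summable[OF geo], of 0]) (simp add: db)
  define V where "V z = (\<Sum>m. d m z)" for z
  have Vs: "(\<lambda>m. d m z) sums V z" for z unfolding V_def using sm by (rule summable_sums)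
  have "(\<lambda>m. step k \<beta> (d m) z) sums step k \<beta> V z" for z
    unfolding step_def by (intro sums_sum sums_add sums_mult Vs)
  then have "(\<lambda>m. d (Suc m) z) sums (r * step k \<beta> V z)" for z unfolding dS by (rule sums_mult)
  then have "(\<lambda>m. d m z) sums (r * step k \<beta> V z + d 0 z)" for z by (subst (asm) sums_Suc_iff) auto
  then have "V z = r * step k \<beta> V z + r * (\<epsilon>\<^sup>2 * g z)" for z using Vs sums_unique2 by (fastforce simp: d_def)
  then have "(1 + \<epsilon>\<^sup>2) * V z = (r * (1 + \<epsilon>\<^sup>2)) * (step k \<beta> V z + \<epsilon>\<^sup>2 * g z)" for z
    by (metis distrib_left mult.assoc mult.commute)
  then have "(1 + \<epsilon>\<^sup>2) * V z - step k \<beta> V z = \<epsilon>\<^sup>2 * g z" for z unfolding r(3) by simp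
  moreover have "\<bar>V z\<bar> \<le> F * (1 + \<epsilon>\<^sup>2)" for z
  proof -
    have "\<bar>V z\<bar> \<le> 1 / (1 - r) * (\<epsilon>\<^sup>2 * F)"
      using summable_rabs_comparison_test norm_sums_le[OF Vs geo, of z] db by auto
    also have "1 / (1 - r) * (\<epsilon>\<^sup>2 * F) = F * (1 + \<epsilon>\<^sup>2)" using s by (simp add: r_def field_simps flip: s_def)
    finally show ?thesis .
  qed
  ultimately show ?thesis by blast
qed

lemma compactly_supported_bounds:
  fixes f :: "real ^ 'n::finite \<Rightarrow> real"
  assumes "continuous_on UNIV f" "compactly_supported f"
  obtains F \<rho> where "0 \<le> \<rho>" "\<And>x. \<bar>f x\<bar> \<le> F" "\<And>x. \<rho> < norm x \<Longrightarrow> f x = 0"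
proof -
  have "bounded {x. f x \<noteq> 0}" using assms(2) by (simp add: compactly_supported_def)
  then obtain \<rho> where \<rho>: "\<And>x. f x \<noteq> 0 \<Longrightarrow> norm x \<le> \<rho>" by (auto simp: bounded_iff)
  have "bounded (f ` cball 0 \<rho>)"
    by (intro compact_imp_bounded compact_continuous_image continuous_on_subset[OF assms(1)]) auto
  then obtain F where "\<forall>x\<in>cball 0 \<rho>. \<bar>f x\<bar> \<le> F" by (auto simp: bounded_iff)
  then have F: "\<And>x. norm x \<le> \<rho> \<Longrightarrow> \<bar>f x\<bar> \<le> F" by simp
  show ?thesis
  proof (rule that[of "max 0 \<rho>" "max 0 F"])
    show "\<bar>f x\<bar> \<le> max 0 F" for x using \<rho>[of x] F[of x] by (cases "f x = 0") auto
    show "f x = 0" if "max 0 \<rho> < norm x" for x using \<rho>[of x] that by force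
  qed simp
qed

section \<open>Translation of the definitions into equations of the walk\<close>

lemma step_alt:
  fixes \<beta> :: "int ^ 'n::finite \<Rightarrow> real"
  shows "step k \<beta> g y = (\<Sum>i\<in>UNIV. 1 / (2 * real CARD('n)) * (g (y + axis i 1) + g (y - axis i 1)))
     + \<beta> y * (g (y + axis k 1) - g (y - axis k 1))"
proof -
  have "step k \<beta> g y = (\<Sum>i\<in>UNIV. 1 / (2 * real CARD('n)) * (g (y + axis i 1) + g (y - axis i 1))
     + (if i = k then \<beta> y * (g (y + axis k 1) - g (y - axis k 1)) else 0))"
    unfolding step_def rate_def by (rule sum.cong) (auto simp: algebra_simps)
  then show ?thesis by (simp add: sum.distrib)
qed

lemma translate_eq_wrap: "translate L z \<omega> = wrap L (z + \<omega>)"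
  by (simp add: translate_def wrap_def add.commute)

text \<open>In the difference equation \<open>\<omega>\<close> is a mere parameter: for each
  \<open>\<omega>\<close> it is the equation of the walk in the environment translated by
  \<open>\<omega>\<close>.\<close>

lemma discrete_solution_iff:
  fixes L :: "'n::finite \<Rightarrow> nat" and v :: "real ^ 'n \<Rightarrow> int ^ 'n \<Rightarrow> real"
  shows "discrete_solution k L b f \<epsilon> v \<longleftrightarrow>
    bounded {v (lattice_point \<epsilon> z) \<omega> | z \<omega>. \<omega> \<in> torus L} \<and>
    (\<forall>z. \<forall>\<omega>\<in>torus L. (1 + \<epsilon>\<^sup>2) * v (lattice_point \<epsilon> z) \<omega>
      - step k (\<lambda>z. b (wrap L (z + \<omega>))) (\<lambda>z. v (lattice_point \<epsilon> z) \<omega>) z = \<epsilon>\<^sup>2 * f (lattice_point \<epsilon> z))"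
  unfolding discrete_solution_def Let_def step_alt lattice_point_plus_axis translate_eq_wrap
  by (simp add: algebra_simps)

lemma is_effective_diffusion_cell:
  fixes k :: "'n::finite" and L :: "'n \<Rightarrow> nat" and b :: "int ^ 'n \<Rightarrow> real"
  defines "\<beta> \<equiv> \<lambda>y. b (wrap L y)"
  assumes "walk L \<beta>" and cell: "cell k \<beta> \<phi> \<psi> q"
    and pr: "periodic L \<phi>" "\<And>i. periodic L (\<psi> i)"
  shows "is_effective_diffusion k L b q"
  unfolding is_effective_diffusion_def
proof (intro conjI allI impI)
  interpret walk k L \<beta> by fact
  show q: "0 < q" using cell_positive[OF cell pr(1) pr(2)] .
  fix f u :: "real ^ 'n \<Rightarrow> real" and v
  assume f: "smooth f" "compactly_supported f" and v: "\<forall>\<epsilon>>0. discrete_solution k L b f \<epsilon> (v \<epsilon>)"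
    and u: "homogenized_solution k q f u"
  obtain F \<rho> where F: "0 \<le> \<rho>" "\<And>x. \<bar>f x\<bar> \<le> F" "\<And>x. \<rho> < norm x \<Longrightarrow> f x = 0"
    by (rule compactly_supported_bounds[OF smooth_continuous[OF f(1)] f(2)]) (rule that)
  obtain K1 where K1: "\<And>y. \<bar>\<phi> y\<bar> \<le> K1" using periodic_bounded[OF L pr(1)] by blast
  have "\<forall>i. \<exists>K. \<forall>y. \<bar>\<psi> i y\<bar> \<le> K" using periodic_bounded[OF L pr(2)] by metis
  then have "\<exists>K2. \<forall>i y. \<bar>\<psi> i y\<bar> \<le> K2 i" by (rule choice)
  then obtain K2 where K2: "\<And>i y. \<bar>\<psi> i y\<bar> \<le> K2 i" by blast
  define K where "K = max K1 (Max (range K2))"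
  have K: "\<bar>\<phi> y\<bar> \<le> K" "\<bar>\<psi> i y\<bar> \<le> K" for i y
  proof -
    show "\<bar>\<phi> y\<bar> \<le> K" using K1[of y] by (simp add: K_def)
    have "\<bar>\<psi> i y\<bar> \<le> Max (range K2)" using K2[of i y] by (rule order.trans) simp
    then show "\<bar>\<psi> i y\<bar> \<le> K" by (simp add: K_def)
  qed
  obtain Bu where Bu: "\<And>x. \<bar>u x\<bar> \<le> Bu"
    using u by (auto simp: homogenized_solution_def bounded_iff)
  interpret homogenization k L \<beta> \<phi> \<psi> q K F \<rho> Bu f u "\<lambda>\<epsilon> \<omega> z. v \<epsilon> (lattice_point \<epsilon> z) \<omega>" "torus L"
  proof
    show "cell k \<beta> \<phi> \<psi> q" "0 < q" "0 \<le> \<rho>" by fact+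
    show "C_class 2 u" using u by (simp add: homogenized_solution_def)
    show "q * partial_deriv k (partial_deriv k u) x
          + 1 / (2 * real CARD('n)) * (\<Sum>j\<in>UNIV - {k}. partial_deriv j (partial_deriv j u) x) = u x - f x" for x
    proof -
      have "- q * partial_deriv k (partial_deriv k u) x
          - (\<Sum>j\<in>UNIV - {k}. 1 / (2 * real CARD('n)) * partial_deriv j (partial_deriv j u) x) + u x = f x"
        using u by (simp add: homogenized_solution_def)
      then show ?thesis unfolding sum_distrib_left[symmetric] by simp
    qed
    fix \<epsilon> :: real and \<omega> z assume e: "0 < \<epsilon>" and w: "\<omega> \<in> torus L"
    then have ds: "discrete_solution k L b f \<epsilon> (v \<epsilon>)" using v by blast
    show "(1 + \<epsilon>\<^sup>2) * v \<epsilon> (lattice_point \<epsilon> z) \<omega> - step k (\<lambda>z. \<beta> (z + \<omega>)) (\<lambda>z. v \<epsilon> (lattice_point \<epsilon> z) \<omega>) z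
      = \<epsilon>\<^sup>2 * f (lattice_point \<epsilon> z)"
      using ds w unfolding discrete_solution_iff \<beta>_def by blast
    have "bounded {v \<epsilon> (lattice_point \<epsilon> z) \<omega> | z \<omega>. \<omega> \<in> torus L}" using ds unfolding discrete_solution_iff by blast
    then obtain M where "\<forall>x\<in>{v \<epsilon> (lattice_point \<epsilon> z) \<omega> | z \<omega>. \<omega> \<in> torus L}. norm x \<le> M" unfolding bounded_iff by blast
    then show "\<exists>M. \<forall>z. \<bar>v \<epsilon> (lattice_point \<epsilon> z) \<omega>\<bar> \<le> M" using w by auto
  qed (use F K Bu in auto)
  show "((\<lambda>\<epsilon>. SUP (x, \<omega>)\<in>UNIV \<times> torus L. \<bar>v \<epsilon> (lattice_floor \<epsilon> x) \<omega> - u x\<bar>) \<longlongrightarrow> 0) (at_right 0)"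
  proof (rule tendstoI)
    fix e :: real assume e: "0 < e"
    obtain \<epsilon>0 where e0: "0 < \<epsilon>0" "\<And>\<epsilon> \<omega> x. 0 < \<epsilon> \<Longrightarrow> \<epsilon> < \<epsilon>0 \<Longrightarrow> \<omega> \<in> torus L \<Longrightarrow>
        \<bar>v \<epsilon> (lattice_point \<epsilon> (\<chi> i. \<lfloor>x $ i / \<epsilon>\<rfloor>)) \<omega> - u x\<bar> \<le> e / 2"
      using uniform_convergence[of "e / 2"] e by (metis half_gt_zero)
    have "dist (SUP (x, \<omega>)\<in>UNIV \<times> torus L. \<bar>v \<epsilon> (lattice_floor \<epsilon> x) \<omega> - u x\<bar>) 0 < e"
      if \<epsilon>: "0 < \<epsilon>" "\<epsilon> < \<epsilon>0" for \<epsilon>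
    proof -
      let ?S = "SUP (x, \<omega>)\<in>UNIV \<times> torus L. \<bar>v \<epsilon> (lattice_floor \<epsilon> x) \<omega> - u x\<bar>"
      have le: "(case p of (x, \<omega>) \<Rightarrow> \<bar>v \<epsilon> (lattice_floor \<epsilon> x) \<omega> - u x\<bar>) \<le> e / 2" if "p \<in> UNIV \<times> torus L" for p
        using e0(2)[OF \<epsilon>] that by (auto simp: lattice_floor_def)
      \<comment> \<open>A real supremum carries information only over a nonempty set that is bounded
        above, hence the explicit point. The bound \<open>e / 2\<close> leaves room for the strict
        inequality.\<close>
      obtain \<omega> where \<omega>: "\<omega> \<in> torus L" using torus_wrap[OF L] by blast
      have "?S \<le> e / 2" by (rule cSUP_least) (use \<omega> le in auto)
      moreover have "(case (0, \<omega>) of (x, \<omega>) \<Rightarrow> \<bar>v \<epsilon> (lattice_floor \<epsilon> x) \<omega> - u x\<bar>) \<le> ?S"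
        by (rule cSUP_upper) (use \<omega> le in \<open>auto intro!: bdd_aboveI2[where M="e / 2"]\<close>)
      ultimately show ?thesis using e by (simp add: dist_real_def)
    qed
    then show "\<forall>\<^sub>F \<epsilon> in at_right 0. dist (SUP (x, \<omega>)\<in>UNIV \<times> torus L. \<bar>v \<epsilon> (lattice_floor \<epsilon> x) \<omega> - u x\<bar>) 0 < e"
      using e0(1) by (auto simp: eventually_at_right[of 0 1] intro!: exI[of _ \<epsilon>0])
  qed
qed

text \<open>Two candidate constants are tested on one source for which both homogenized equations
  have explicit solutions. The same discrete solutions converge to each of them, so they coincide,
  and their difference is \<open>q' - q\<close> times a second derivative of the test
  function.\<close>

lemma is_effective_diffusion_unique:
  fixes k :: "'n::finite" and L :: "'n \<Rightarrow> nat" and b :: "int ^ 'n \<Rightarrow> real"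
  assumes "walk L (\<lambda>y. b (wrap L y))"
    and "is_effective_diffusion k L b q" "is_effective_diffusion k L b q'"
  shows "q = q'"
proof (rule ccontr)
  assume neq: "q \<noteq> q'"
  interpret walk k L "\<lambda>y. b (wrap L y)" by fact
  obtain G :: "nat \<Rightarrow> real \<Rightarrow> real" where "test_functions G"
    using bump_derivatives by (metis test_functions.intro)
  then interpret test_functions G .
  let ?n = "\<lambda>_ :: 'n. 0 :: nat"
  let ?w = "W ?n"
  define D where "D r x = ?w x - diffusion k r ?w x" for r x
  \<comment> \<open>Peeling the outer factor off this product of two operators leaves
    \<open>D q'\<close> as a solution for the constant \<open>q\<close>; after commuting the
    factors, \<open>D q\<close> is a solution for \<open>q'\<close>.\<close>
  define f where "f x = D q' x - diffusion k q (D q') x" for x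
  have smD: "smooth (D r)" for r unfolding D_def by (intro smooth_diff smooth_W smooth_diffusion)
  have smf: "smooth f" unfolding f_def by (intro smooth_diff smD smooth_diffusion)
  have DD: "diffusion k r (D s) x = diffusion k r ?w x - diffusion k r (diffusion k s ?w) x" for r s x
  proof -
    have "D s = (\<lambda>x. ?w x + (-1) * diffusion k s ?w x)" by (simp add: D_def fun_eq_iff)
    then show ?thesis
      by (simp only: diffusion_add diffusion_cmult smooth_W smooth_diffusion smooth_cmult)
  qed
  have f': "f x = D q x - diffusion k q' (D q) x" for x
    unfolding f_def DD by (simp add: D_def diffusion_commute[of k q q'])
  have sup: "D r x = 0" "diffusion k r (D s) x = 0" if "real CARD('n) < norm x" for x r s
  proof -
    have a: "W n x = 0" for n using that by (rule W_support)
    then show "D r x = 0" by (simp add: D_def diffusion_W)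
    have "diffusion k s ?w = (\<lambda>x. s * W (?n(k := ?n k + 2)) x + (\<Sum>j\<in>UNIV - {k}. 1 / (2 * real CARD('n)) * W (?n(j := ?n j + 2)) x))"
      by (rule ext) (rule diffusion_W)
    then have "diffusion k r (diffusion k s ?w) x = s * diffusion k r (W (?n(k := ?n k + 2))) x
      + (\<Sum>j\<in>UNIV - {k}. 1 / (2 * real CARD('n)) * diffusion k r (W (?n(j := ?n j + 2))) x)"
      by (simp only: diffusion_add diffusion_cmult diffusion_sum smooth_W smooth_cmult smooth_sum)
    then show "diffusion k r (D s) x = 0" unfolding DD by (simp add: diffusion_W a)
  qed
  have cs: "compactly_supported g" if "\<And>x. real CARD('n) < norm x \<Longrightarrow> g x = 0" for g :: "real ^ 'n \<Rightarrow> real"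
  proof -
    have "bounded {x. g x \<noteq> 0}" unfolding bounded_iff using that by (metis mem_Collect_eq not_le)
    then show ?thesis by (simp add: compactly_supported_def)
  qed
  have csf: "compactly_supported f" by (rule cs) (simp add: f_def sup)
  have csD: "compactly_supported (D r)" for r by (rule cs) (simp add: sup)
  obtain F where F: "\<And>x. \<bar>f x\<bar> \<le> F"
    using compactly_supported_bounds[OF smooth_continuous[OF smf] csf] by metis
  have hom: "homogenized_solution k s f (D r)" if "\<And>x. f x = D r x - diffusion k s (D r) x" for r s
    unfolding homogenized_solution_def
  proof (intro conjI allI)
    show "C_class 2 (D r)" using smD by (simp add: smooth_def)
    obtain B where "\<And>x. \<bar>D r x\<bar> \<le> B"
      using compactly_supported_bounds[OF smooth_continuous[OF smD] csD] by metis
    then show "bounded (range (D r))" by (auto simp: bounded_iff)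
    fix x
    show "- s * partial_deriv k (partial_deriv k (D r)) x
          - (\<Sum>j\<in>UNIV - {k}. 1 / (2 * real CARD('n)) * partial_deriv j (partial_deriv j (D r)) x) + D r x = f x"
      unfolding that by (simp add: diffusion_def)
  qed
  have "\<exists>V. (\<forall>z. \<bar>V z\<bar> \<le> F * (1 + \<epsilon>\<^sup>2)) \<and> (\<forall>z. (1 + \<epsilon>\<^sup>2) * V z - step k (\<lambda>z. b (wrap L (z + \<omega>))) V z = \<epsilon>\<^sup>2 * f (lattice_point \<epsilon> z))"
    if "0 < \<epsilon>" for \<epsilon> \<omega>
    using bound that F less_imp_le by (intro discrete_solution_exists) (auto intro: less_imp_le)
  then obtain V where V: "\<And>\<epsilon> \<omega> z. 0 < \<epsilon> \<Longrightarrow> \<bar>V \<epsilon> \<omega> z\<bar> \<le> F * (1 + \<epsilon>\<^sup>2)"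
    "\<And>\<epsilon> \<omega> z. 0 < \<epsilon> \<Longrightarrow> (1 + \<epsilon>\<^sup>2) * V \<epsilon> \<omega> z - step k (\<lambda>z. b (wrap L (z + \<omega>))) (V \<epsilon> \<omega>) z = \<epsilon>\<^sup>2 * f (lattice_point \<epsilon> z)"
    by metis
  \<comment> \<open>Reading \<open>V\<close> at the floor extends it to all real points and is exact
    on the lattice.\<close>
  define v where "v \<epsilon> x \<omega> = V \<epsilon> \<omega> (\<chi> i. \<lfloor>x $ i / \<epsilon>\<rfloor>)" for \<epsilon> and x :: "real ^ 'n" and \<omega>
  have vl: "v \<epsilon> (lattice_point \<epsilon> z) \<omega> = V \<epsilon> \<omega> z" if "0 < \<epsilon>" for \<epsilon> z \<omega>
    using that by (simp add: v_def lattice_point_def)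
  have ds: "\<forall>\<epsilon>>0. discrete_solution k L b f \<epsilon> (v \<epsilon>)"
  proof (intro allI impI)
    fix \<epsilon> :: real assume e: "0 < \<epsilon>"
    show "discrete_solution k L b f \<epsilon> (v \<epsilon>)"
      unfolding discrete_solution_iff vl[OF e] using V[OF e] by (auto simp: bounded_iff)
  qed
  let ?S = "\<lambda>u \<epsilon>. SUP (x, \<omega>)\<in>UNIV \<times> torus L. \<bar>v \<epsilon> (lattice_floor \<epsilon> x) \<omega> - u x\<bar>"
  have l1: "(?S (D q') \<longlongrightarrow> 0) (at_right 0)"
    using assms(2) smf csf ds hom[of q' q] f_def unfolding is_effective_diffusion_def by blast
  have l2: "(?S (D q) \<longlongrightarrow> 0) (at_right 0)"
    using assms(3) smf csf ds hom[of q q'] f' unfolding is_effective_diffusion_def by blast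
  obtain \<omega> where \<omega>: "\<omega> \<in> torus L" using torus_wrap[OF L] by blast
  have "D q x = D q' x" for x
  proof -
    \<comment> \<open>Passing from the supremum to a single point requires a set bounded above,
      hence the global bounds on \<open>V\<close> and \<open>D r\<close>.\<close>
    have up: "\<bar>v \<epsilon> (lattice_floor \<epsilon> x) \<omega> - D r x\<bar> \<le> ?S (D r) \<epsilon>" if "0 < \<epsilon>" for \<epsilon> r
    proof -
      obtain B where B: "\<And>x. \<bar>D r x\<bar> \<le> B"
        using compactly_supported_bounds[OF smooth_continuous[OF smD] csD] by metis
      have "(case (x, \<omega>) of (x, \<omega>) \<Rightarrow> \<bar>v \<epsilon> (lattice_floor \<epsilon> x) \<omega> - D r x\<bar>) \<le> ?S (D r) \<epsilon>"
      proof (rule cSUP_upper)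
        show "bdd_above ((\<lambda>(x, \<omega>). \<bar>v \<epsilon> (lattice_floor \<epsilon> x) \<omega> - D r x\<bar>) ` (UNIV \<times> torus L))"
        proof (rule bdd_aboveI2[where M="F * (1 + \<epsilon>\<^sup>2) + B"])
          fix p :: "(real ^ 'n) \<times> (int ^ 'n)"
          show "(case p of (x, \<omega>) \<Rightarrow> \<bar>v \<epsilon> (lattice_floor \<epsilon> x) \<omega> - D r x\<bar>) \<le> F * (1 + \<epsilon>\<^sup>2) + B"
          proof (cases p)
            case (Pair y w)
            have "\<bar>v \<epsilon> (lattice_floor \<epsilon> y) w\<bar> \<le> F * (1 + \<epsilon>\<^sup>2)" unfolding v_def by (rule V(1)[OF that])
            then show ?thesis using B[of y] Pair by simp
          qed
        qed
      qed (use \<omega> in auto)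
      then show ?thesis by simp
    qed
    have lim: "((\<lambda>\<epsilon>. ?S (D q') \<epsilon> + ?S (D q) \<epsilon>) \<longlongrightarrow> 0 + 0) (at_right 0)" by (rule tendsto_add[OF l1 l2])
    have "\<forall>\<^sub>F \<epsilon> in at_right 0. \<bar>D q x - D q' x\<bar> \<le> ?S (D q') \<epsilon> + ?S (D q) \<epsilon>"
    proof (rule eventually_at_right_less[THEN eventually_mono])
      fix \<epsilon> :: real assume "0 < \<epsilon>"
      from up[OF this, of q] up[OF this, of q'] show "\<bar>D q x - D q' x\<bar> \<le> ?S (D q') \<epsilon> + ?S (D q) \<epsilon>" by linarith
    qed
    then have "\<bar>D q x - D q' x\<bar> \<le> 0 + 0"
      by (rule tendsto_lowerbound[OF lim]) simp
    then show ?thesis by simp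
  qed
  then have "(q' - q) * W (?n(k := 2)) x = 0" for x
    by (simp add: D_def diffusion_W algebra_simps numeral_2_eq_2)
  then show False using neq W_second_nonzero[of k] by (metis mult_eq_0_iff right_minus_eq)
qed

lemma effective_diffusion_cell:
  fixes k :: "'n::finite" and L :: "'n \<Rightarrow> nat" and b :: "int ^ 'n \<Rightarrow> real"
  defines "\<beta> \<equiv> \<lambda>y. b (wrap L y)"
  assumes "walk L \<beta>" "cell k \<beta> \<phi> \<psi> q" "periodic L \<phi>" "\<And>i. periodic L (\<psi> i)"
  shows "effective_diffusion k L b = q"
  unfolding effective_diffusion_def
proof (rule the_equality)
  show *: "is_effective_diffusion k L b q"
    using is_effective_diffusion_cell[OF assms(2-5)[unfolded \<beta>_def]] .
  show "q' = q" if "is_effective_diffusion k L b q'" for q'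
    using is_effective_diffusion_unique[OF _ that *] assms(2) unfolding \<beta>_def by blast
qed

lemma admissible_odd_walk:
  fixes k :: "'n::finite" and L :: "'n \<Rightarrow> nat"
  assumes L: "\<forall>i. L i > 0" and "admissible k L b"
  shows "odd_walk k L (\<lambda>y. b (wrap L y))"
proof
  have fin: "finite (torus L)" by (rule finite_torus)
  show "\<forall>i. L i > 0" by fact
  show "periodic L (\<lambda>y. b (wrap L y))" by (simp add: periodic_def wrap_def)
  show "\<bar>b (wrap L y)\<bar> < 1 / (2 * real CARD('n))" for y
  proof -
    have "\<bar>b (wrap L y)\<bar> \<le> (SUP \<omega>\<in>torus L. \<bar>b \<omega>\<bar>)"
      by (rule cSUP_upper[OF torus_wrap[OF L]]) (simp add: fin)
    moreover have "(SUP \<omega>\<in>torus L. \<bar>b \<omega>\<bar>) < 1 / (2 * real CARD('n))" using assms(2) unfolding admissible_def by blast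
    ultimately show ?thesis by linarith
  qed
  show "b (wrap L (reflect k L y)) = - b (wrap L y)" for y
  proof -
    \<comment> \<open>Sending \<open>c\<close> to \<open>L k - 1 - c\<close> permutes the residues
      from 0 to \<open>L k - 1\<close>, so reflection commutes with reduction to the period.\<close>
    have "wrap L (reflect k L y) = reflect k L (wrap L y)"
    proof (rule vec_eq_iff[THEN iffD2], rule allI)
      fix i
      have "(int (L k) - 1 - y $ k) mod int (L k) = int (L k) - 1 - y $ k mod int (L k)"
      proof -
        have "(int (L k) - 1 - y $ k) mod int (L k) = (int (L k) - 1 - y $ k mod int (L k)) mod int (L k)"
          by (metis mod_diff_right_eq)
        also have "\<dots> = int (L k) - 1 - y $ k mod int (L k)"
        proof (rule mod_pos_pos_trivial)
          have "y $ k mod int (L k) < int (L k)" "0 \<le> y $ k mod int (L k)" using L by auto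
          then show "0 \<le> int (L k) - 1 - y $ k mod int (L k)" "int (L k) - 1 - y $ k mod int (L k) < int (L k)" by auto
        qed
        finally show ?thesis .
      qed
      then show "wrap L (reflect k L y) $ i = reflect k L (wrap L y) $ i"
        by (simp add: wrap_def reflect_def)
    qed
    then show ?thesis using assms(2) torus_wrap[OF L, of y] by (simp add: admissible_def)
  qed
qed

subsection \<open>Dimension one and period two\<close>

lemma sum_cyclic_shift:
  fixes F :: "int \<Rightarrow> real"
  assumes "F (int N) = F 0"
  shows "(\<Sum>t<N. F (int t + 1)) = (\<Sum>t<N. F (int t))"
  using sum_lessThan_telescope[of "\<lambda>t. F (int t)" N] assms
  by (simp add: sum_subtractf algebra_simps)

lemma plus_axis_axis: "axis k t + axis k 1 = axis k (t + 1)" "axis k t - axis k 1 = axis k (t - 1)" for t :: int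
  by (auto simp: axis_def vec_eq_iff)

text \<open>\<open>d\<close> is the increment of the harmonic function obtained by adding
  \<open>\<phi>\<close> to the coordinate, and \<open>harm\<close> yields detailed balance for edge
  conductances \<open>1 / d\<close>. Summing the energy identity against the resulting reversible
  measure expresses \<open>q\<close> through the sum of \<open>1 / d\<close>, while the increments
  themselves add up to \<open>N\<close>.\<close>

lemma (in walk) effective_le_dimension_one:
  assumes "CARD('n) = 1" and cell: "cell k \<beta> \<phi> \<psi> q" and pr: "periodic L \<phi>" "periodic L (\<psi> k)"
  shows "q \<le> 1 / 2"
proof -
  have U: "(UNIV :: 'n set) = {k}" using assms(1) by (metis UNIV_I card_1_singletonE singletonD)
  define N where "N = L k"
  have N: "0 < N" using L by (simp add: N_def)
  define p where "p t = 1 / 2 + \<beta> (axis k t)" for t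
  define m where "m t = 1 / 2 - \<beta> (axis k t)" for t
  have pm: "0 < p t" "0 < m t" "p t + m t = 1" for t
    using bound[of "axis k t"] assms(1) by (auto simp: p_def m_def abs_less_iff)
  define d where "d t = 1 + \<phi> (axis k (t + 1)) - \<phi> (axis k t)" for t
  define \<zeta> where "\<zeta> t = \<psi> k (axis k t) - \<phi> (axis k t) * \<phi> (axis k t) / 2" for t
  have wrapN: "g (axis k (t + int N)) = g (axis k t)" if "periodic L g" for g t
    by (rule periodic_cong[OF that]) (simp add: axis_def N_def)
  have dN: "d (t + int N) = d t" for t
    using wrapN[OF pr(1), of t] wrapN[OF pr(1), of "t + 1"] by (simp add: d_def algebra_simps)
  have \<zeta>N: "\<zeta> (t + int N) = \<zeta> t" for t
    unfolding \<zeta>_def wrapN[OF pr(1)] wrapN[OF pr(2)] ..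
  have st: "step k \<beta> g (axis k t) = p t * g (axis k (t + 1)) + m t * g (axis k (t - 1))" for g t
    by (simp add: step_def U rate_def p_def m_def plus_axis_axis)
  have harm: "p t * d t = m t * d (t - 1)" for t
  proof -
    have "\<phi> (axis k t) - step k \<beta> \<phi> (axis k t) = 2 * \<beta> (axis k t)" using cell by (simp add: cell_def)
    then show ?thesis unfolding st d_def p_def m_def by (simp add: algebra_simps)
  qed
  have en: "\<zeta> t - (p t * \<zeta> (t + 1) + m t * \<zeta> (t - 1)) = (p t * (d t)\<^sup>2 + m t * (d (t - 1))\<^sup>2) / 2 - q" for t
  proof -
    have "(- 1 + \<phi> (axis k (t - 1)) - \<phi> (axis k t))\<^sup>2 = (d (t - 1))\<^sup>2"
      by (simp add: d_def power2_eq_square algebra_simps)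
    then show ?thesis
      using cell_energy[OF cell, of "axis k t"] unfolding st
      by (simp add: U rate_def plus_axis_axis d_def \<zeta>_def p_def m_def)
  qed
  \<comment> \<open>Both rates are positive, so all increments have one sign, and it is positive
    because their sum over a period is \<open>N\<close>.\<close>
  have sgn: "0 < d t \<longleftrightarrow> 0 < d (t - 1)" for t
  proof -
    have "0 < p t * d t \<longleftrightarrow> 0 < m t * d (t - 1)" unfolding harm ..
    then show ?thesis using pm[of t] by (simp add: zero_less_mult_iff)
  qed
  have sumd: "(\<Sum>t<N. d (int t)) = real N"
    using sum_cyclic_shift[of "\<lambda>t. \<phi> (axis k t)" N] wrapN[OF pr(1), of 0]
    by (simp add: d_def sum_subtractf sum.distrib)
  have "\<exists>t<N. 0 < d (int t)"
  proof (rule ccontr)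
    assume "\<not> ?thesis"
    then have "(\<Sum>t<N. d (int t)) \<le> 0" by (intro sum_nonpos) (metis lessThan_iff not_less)
    then show False using sumd N by simp
  qed
  then obtain t0 where t0: "0 < d t0" by blast
  have dpos: "0 < d t" for t
  proof -
    have "0 < d t \<longleftrightarrow> 0 < d t0"
    proof (induction t rule: int_induct[of _ t0])
      case (step1 i) then show ?case using sgn[of "i + 1"] by simp
    next
      case (step2 i) then show ?case using sgn[of i] by simp
    qed simp
    then show ?thesis using t0 by simp
  qed
  \<comment> \<open>\<open>w t\<close> is the conductance of the edge from \<open>t - 1\<close> to
    \<open>t\<close>; the reversible measure at \<open>t\<close> is
    \<open>w (t + 1) + w t\<close>.\<close>
  define w where "w t = 1 / d (t - 1)" for t
  have wp: "(w (t + 1) + w t) * p t = w (t + 1)" and wm: "(w (t + 1) + w t) * m t = w t" for t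
  proof -
    have "w (t + 1) * m t = w t * p t" using harm[of t] dpos[of t] dpos[of "t - 1"] by (simp add: w_def field_simps)
    moreover have "m t = 1 - p t" using pm(3)[of t] by simp
    ultimately show "(w (t + 1) + w t) * p t = w (t + 1)" "(w (t + 1) + w t) * m t = w t" by algebra+
  qed
  have eq: "(\<zeta> t - \<zeta> (t + 1)) * w (t + 1) - (\<zeta> (t - 1) - \<zeta> t) * w t
     = (d t + d (t - 1)) / 2 - q * (w (t + 1) + w t)" for t
  proof -
    have "(w (t + 1) + w t) * (\<zeta> t - (p t * \<zeta> (t + 1) + m t * \<zeta> (t - 1)))
      = (w (t + 1) + w t) * ((p t * (d t)\<^sup>2 + m t * (d (t - 1))\<^sup>2) / 2 - q)"
      by (simp only: en)
    moreover have "(w (t + 1) + w t) * (\<zeta> t - (p t * \<zeta> (t + 1) + m t * \<zeta> (t - 1)))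
      = (w (t + 1) + w t) * \<zeta> t - ((w (t + 1) + w t) * p t) * \<zeta> (t + 1) - ((w (t + 1) + w t) * m t) * \<zeta> (t - 1)"
      by (simp add: algebra_simps)
    moreover have "(w (t + 1) + w t) * ((p t * (d t)\<^sup>2 + m t * (d (t - 1))\<^sup>2) / 2 - q)
      = (((w (t + 1) + w t) * p t) * (d t)\<^sup>2 + ((w (t + 1) + w t) * m t) * (d (t - 1))\<^sup>2) / 2 - q * (w (t + 1) + w t)"
      by (simp add: algebra_simps)
    moreover have "w (t + 1) * (d t)\<^sup>2 = d t" "w t * (d (t - 1))\<^sup>2 = d (t - 1)"
      using dpos[of t] dpos[of "t - 1"] by (simp_all add: w_def power2_eq_square)
    ultimately show ?thesis unfolding wp wm by (simp add: algebra_simps)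
  qed
  have wN: "w (int N) = w 0" using dN[of "-1"] by (simp add: w_def)
  have wN1: "w (int N + 1) = w 1" using dN[of 0] by (simp add: w_def)
  have s1: "(\<Sum>t<N. w (int t + 1)) = (\<Sum>t<N. w (int t))" by (rule sum_cyclic_shift[OF wN])
  have s2: "(\<Sum>t<N. d (int t)) = (\<Sum>t<N. d (int t - 1))"
    using sum_cyclic_shift[of "\<lambda>t. d (t - 1)" N] dN[of "-1"] by simp
  have s3: "(\<Sum>t<N. (\<zeta> (int t) - \<zeta> (int t + 1)) * w (int t + 1)) = (\<Sum>t<N. (\<zeta> (int t - 1) - \<zeta> (int t)) * w (int t))"
    using sum_cyclic_shift[of "\<lambda>t. (\<zeta> (t - 1) - \<zeta> t) * w t" N] \<zeta>N[of "-1"] \<zeta>N[of 0] wN by simp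
  have "0 = (\<Sum>t<N. (\<zeta> (int t) - \<zeta> (int t + 1)) * w (int t + 1) - (\<zeta> (int t - 1) - \<zeta> (int t)) * w (int t))"
    using s3 by (simp add: sum_subtractf)
  also have "\<dots> = (\<Sum>t<N. (d (int t) + d (int t - 1)) / 2 - q * (w (int t + 1) + w (int t)))"
    unfolding eq ..
  also have "\<dots> = ((\<Sum>t<N. d (int t)) + (\<Sum>t<N. d (int t - 1))) / 2 - q * ((\<Sum>t<N. w (int t + 1)) + (\<Sum>t<N. w (int t)))"
    by (simp only: sum_subtractf sum.distrib sum_divide_distrib[symmetric] sum_distrib_left[symmetric])
  also have "\<dots> = real N - 2 * q * (\<Sum>t<N. w (int t))" unfolding s1 s2[symmetric] sumd by simp
  finally have main: "2 * q * (\<Sum>t<N. w (int t)) = real N" by simp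
  \<comment> \<open>The arithmetic-harmonic mean inequality in tangent form: \<open>1 / x\<close> is
    at least \<open>2 - x\<close> for positive \<open>x\<close>.\<close>
  have "2 - d (t - 1) \<le> w t" for t
  proof -
    have "0 \<le> (d (t - 1) - 1)\<^sup>2 / d (t - 1)" using dpos[of "t - 1"] by simp
    also have "\<dots> = d (t - 1) - 2 + w t" using dpos[of "t - 1"] by (simp add: w_def power2_eq_square field_simps)
    finally show ?thesis by simp
  qed
  then have "(\<Sum>t<N. 2 - d (int t - 1)) \<le> (\<Sum>t<N. w (int t))" by (intro sum_mono)
  then have "real N \<le> (\<Sum>t<N. w (int t))" using s2 sumd by (simp add: sum_subtractf)
  moreover have "0 < q" by (rule cell_positive[OF cell pr])
  ultimately have "2 * q * real N \<le> 2 * q * (\<Sum>t<N. w (int t))" by (intro mult_left_mono) auto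
  then show ?thesis using main N by simp
qed

section \<open>Sums over the torus\<close>

lemma sum_torus_shift:
  assumes L: "\<forall>i. L i > 0" and g: "periodic L g"
  shows "(\<Sum>y\<in>torus L. g (y + a)) = (\<Sum>y\<in>torus L. g y)"
proof -
  have inv: "wrap L (wrap L (y + a) - a) = y" "wrap L (wrap L (y - a) + a) = y" if "y \<in> torus L" for y a
    using wrap_torus[OF that] by (auto simp: vec_eq_iff wrap_def mod_simps)
  have "bij_betw (\<lambda>y. wrap L (y + a)) (torus L) (torus L)"
    by (rule bij_betw_byWitness[where f'="\<lambda>y. wrap L (y - a)"]) (auto simp: inv torus_wrap[OF L])
  from sum.reindex_bij_betw[OF this, of g] show ?thesis using g by (simp add: periodic_def)
qed

lemma sum_torus_shift_minus:
  assumes "\<forall>i. L i > 0" "periodic L g"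
  shows "(\<Sum>y\<in>torus L. g (y - a)) = (\<Sum>y\<in>torus L. g y)"
  using sum_torus_shift[OF assms, of "- a"] by simp

lemma card_torus_pos: "\<forall>i. L i > 0 \<Longrightarrow> 0 < card (torus L)"
  using torus_wrap[of L 0] by (auto simp: card_gt_0_iff finite_torus)

lemma sum_torus_symmetric_step:
  fixes L :: "'n::finite \<Rightarrow> nat"
  assumes L: "\<forall>i. L i > 0" and g: "periodic L g"
  shows "(\<Sum>y\<in>torus L. step k (\<lambda>_. 0) g y) = (\<Sum>y\<in>torus L. g y)"
proof -
  have "(\<Sum>y\<in>torus L. step k (\<lambda>_. 0) g y)
    = (\<Sum>i\<in>UNIV. 1 / (2 * real CARD('n)) * ((\<Sum>y\<in>torus L. g (y + axis i 1)) + (\<Sum>y\<in>torus L. g (y - axis i 1))))"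
    unfolding step_alt by (simp only: mult_zero_left add_0_right sum.swap[of _ UNIV] sum_distrib_left[symmetric] sum.distrib)
  also have "\<dots> = (\<Sum>y\<in>torus L. g y)"
    unfolding sum_torus_shift[OF L g] sum_torus_shift_minus[OF L g] by simp
  finally show ?thesis .
qed

text \<open>Nonnegativity of the Dirichlet form: expand the mean of
  \<open>(g x - g y)\<^sup>2\<close> over the neighbours \<open>x\<close> of \<open>y\<close>. After
  summation both squares have the same sum, because counting measure is invariant.\<close>

lemma sum_torus_symmetric_energy:
  fixes L :: "'n::finite \<Rightarrow> nat"
  assumes L: "\<forall>i. L i > 0" and g: "periodic L g"
  shows "0 \<le> (\<Sum>y\<in>torus L. g y * (g y - step k (\<lambda>_. 0) g y))"
proof -
  have "g y * step k (\<lambda>_. 0) g y \<le> ((g y)\<^sup>2 + step k (\<lambda>_. 0) (\<lambda>y. (g y)\<^sup>2) y) / 2" for y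
  proof -
    have "0 \<le> step k (\<lambda>_. 0) (\<lambda>x. (g x - g y)\<^sup>2) y"
      using step_mono[of "\<lambda>_. 0" y "\<lambda>_. 0" "\<lambda>x. (g x - g y)\<^sup>2" k] by (simp add: step_const)
    also have "(\<lambda>x. (g x - g y)\<^sup>2) = (\<lambda>x. ((g x)\<^sup>2 - 2 * g y * g x) + (g y)\<^sup>2)"
      by (simp add: fun_eq_iff power2_diff algebra_simps)
    finally show ?thesis unfolding step_add step_diff step_cmult step_const by (simp add: power2_eq_square)
  qed
  then have "(\<Sum>y\<in>torus L. g y * step k (\<lambda>_. 0) g y) \<le> (\<Sum>y\<in>torus L. ((g y)\<^sup>2 + step k (\<lambda>_. 0) (\<lambda>y. (g y)\<^sup>2) y) / 2)"
    by (intro sum_mono)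
  also have "\<dots> = ((\<Sum>y\<in>torus L. (g y)\<^sup>2) + (\<Sum>y\<in>torus L. step k (\<lambda>_. 0) (\<lambda>y. (g y)\<^sup>2) y)) / 2"
    by (simp add: sum_divide_distrib[symmetric] sum.distrib)
  also have "(\<Sum>y\<in>torus L. step k (\<lambda>_. 0) (\<lambda>y. (g y)\<^sup>2) y) = (\<Sum>y\<in>torus L. (g y)\<^sup>2)"
    unfolding power2_eq_square by (intro sum_torus_symmetric_step L periodic_mult g)
  finally show ?thesis by (simp add: right_diff_distrib sum_subtractf power2_eq_square)
qed

text \<open>When the period in the drift direction is 2, both neighbours in that direction coincide on the torus,
  so the drift cancels and the walk on the torus is symmetric.\<close>

lemma (in walk) effective_le_period_two:
  assumes "L k = 2" and cell: "cell k \<beta> \<phi> \<psi> q" and pr: "periodic L \<phi>" "periodic L (\<psi> k)"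
    and odd: "\<And>y. \<phi> (reflect k L y) = - \<phi> y"
  shows "q \<le> 1 / (2 * real CARD('n))"
proof -
  let ?c = "1 / (2 * real CARD('n))"
  \<comment> \<open>Modulo 2 both shifts along \<open>k\<close> agree with the reflection, which
    sends the coordinate \<open>c\<close> to \<open>1 - c\<close>.\<close>
  have eqv: "g (y + axis k 1) = g (reflect k L y)" "g (y - axis k 1) = g (reflect k L y)" if "periodic L g" for g y
  proof -
    have m: "(y $ k + 1) mod 2 = (1 - y $ k) mod 2" "(y $ k - 1) mod 2 = (1 - y $ k) mod 2" by presburger+
    show "g (y + axis k 1) = g (reflect k L y)" "g (y - axis k 1) = g (reflect k L y)"
      using m by (auto intro!: periodic_cong[OF that] simp: reflect_def axis_def assms(1))
  qed
  have sym: "step k \<beta> g y = step k (\<lambda>_. 0) g y" if "periodic L g" for g y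
    unfolding step_alt[of k \<beta>] step_alt[of k "\<lambda>_. 0"] eqv[OF that] by simp
  \<comment> \<open>The neighbouring values of the odd \<open>\<phi>\<close> along \<open>k\<close>
    are \<open>- \<phi> y\<close>, so the flux is minus the integrand of the Dirichlet form.\<close>
  have eq: "q - ?c = - (\<phi> y * (\<phi> y - step k (\<lambda>_. 0) \<phi> y)) - (\<psi> k y - step k (\<lambda>_. 0) (\<psi> k) y)" for y
  proof -
    have "flux k \<beta> k \<phi> y = - (2 * \<beta> y) * \<phi> y"
      unfolding flux_def eqv[OF pr(1)] odd by (simp add: rate_def algebra_simps)
    also have "2 * \<beta> y = \<phi> y - step k \<beta> \<phi> y" using cell by (simp add: cell_def)
    finally have "flux k \<beta> k \<phi> y = - (\<phi> y * (\<phi> y - step k (\<lambda>_. 0) \<phi> y))"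
      unfolding sym[OF pr(1)] by (simp add: algebra_simps)
    moreover have "\<psi> k y - step k \<beta> (\<psi> k) y = flux k \<beta> k \<phi> y - (q - ?c)"
      using cell by (auto simp: cell_def)
    ultimately show ?thesis unfolding sym[OF pr(2)] by linarith
  qed
  have "(\<Sum>y\<in>torus L. q - ?c) = (\<Sum>y\<in>torus L. - (\<phi> y * (\<phi> y - step k (\<lambda>_. 0) \<phi> y)) - (\<psi> k y - step k (\<lambda>_. 0) (\<psi> k) y))"
    by (intro sum.cong refl eq)
  also have "\<dots> = - (\<Sum>y\<in>torus L. \<phi> y * (\<phi> y - step k (\<lambda>_. 0) \<phi> y))
    - ((\<Sum>y\<in>torus L. \<psi> k y) - (\<Sum>y\<in>torus L. step k (\<lambda>_. 0) (\<psi> k) y))"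
    by (simp only: sum_subtractf sum_negf)
  also have "\<dots> \<le> 0"
    unfolding sum_torus_symmetric_step[OF L pr(2)] using sum_torus_symmetric_energy[OF L pr(1), of k] by simp
  finally have "real (card (torus L)) * (q - ?c) \<le> 0" by simp
  then show ?thesis using card_torus_pos[OF L] by (simp add: mult_le_0_iff)
qed

subsection \<open>Period four in dimension two\<close>

text \<open>The factor 1/4 is the jump probability 1/(2d) for d = 2: this is the transverse part of
  the generator.\<close>

definition lap :: "(int \<Rightarrow> real) \<Rightarrow> int \<Rightarrow> real" where
  "lap f t = (f (t + 1) + f (t - 1) - 2 * f t) / 4"

lemma lap_linear:
  "lap (\<lambda>t. f t + g t) t = lap f t + lap g t" "lap (\<lambda>t. f t - g t) t = lap f t - lap g t"
  "lap (\<lambda>t. c * f t) t = c * lap f t"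
  by (simp_all add: lap_def algebra_simps add_divide_distrib diff_divide_distrib)

definition cyclic :: "nat \<Rightarrow> (int \<Rightarrow> real) \<Rightarrow> bool" where
  "cyclic N f \<longleftrightarrow> (\<forall>t. f (t + int N) = f t)"

lemma cyclic_add: "cyclic N f \<Longrightarrow> cyclic N g \<Longrightarrow> cyclic N (\<lambda>t. f t + g t)"
  by (simp add: cyclic_def)

lemma cyclic_diff: "cyclic N f \<Longrightarrow> cyclic N g \<Longrightarrow> cyclic N (\<lambda>t. f t - g t)"
  by (simp add: cyclic_def)

lemma cyclic_cmult: "cyclic N f \<Longrightarrow> cyclic N (\<lambda>t. c * f t)"
  by (simp add: cyclic_def)

lemma sum_cyclic:
  assumes "cyclic N F"
  shows "(\<Sum>t<N. F (int t + 1)) = (\<Sum>t<N. F (int t))"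
  using assms spec[of "\<lambda>t. F (t + int N) = F t" 0] by (intro sum_cyclic_shift) (simp add: cyclic_def)

text \<open>Summation by parts; the boundary terms cancel by periodicity.\<close>

lemma sum_mult_lap:
  assumes f: "cyclic N f" and g: "cyclic N g"
  shows "(\<Sum>t<N. f (int t) * lap g (int t)) = - (\<Sum>t<N. (f (int t + 1) - f (int t)) * (g (int t + 1) - g (int t))) / 4"
proof -
  have c: "cyclic N (\<lambda>t. f t * (g t - g (t - 1)))"
    unfolding cyclic_def
  proof
    fix t
    have "t + int N - 1 = (t - 1) + int N" by simp
    then show "f (t + int N) * (g (t + int N) - g (t + int N - 1)) = f t * (g t - g (t - 1))"
      using f g unfolding cyclic_def by metis
  qed
  have "(\<Sum>t<N. f (int t) * lap g (int t)) = (\<Sum>t<N. f (int t) * (g (int t + 1) - g (int t)) / 4 - f (int t) * (g (int t) - g (int t - 1)) / 4)"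
    by (rule sum.cong) (auto simp: lap_def field_simps)
  also have "\<dots> = (\<Sum>t<N. f (int t) * (g (int t + 1) - g (int t))) / 4 - (\<Sum>t<N. f (int t) * (g (int t) - g (int t - 1))) / 4"
    by (simp only: sum_subtractf sum_divide_distrib)
  also have "(\<Sum>t<N. f (int t) * (g (int t) - g (int t - 1))) = (\<Sum>t<N. f (int t + 1) * (g (int t + 1) - g (int t)))"
    using sum_cyclic[OF c] by simp
  also have "(\<Sum>t<N. f (int t) * (g (int t + 1) - g (int t))) / 4 - (\<Sum>t<N. f (int t + 1) * (g (int t + 1) - g (int t))) / 4
    = - (\<Sum>t<N. (f (int t + 1) - f (int t)) * (g (int t + 1) - g (int t))) / 4"
    unfolding left_diff_distrib sum_subtractf[of "\<lambda>t. f (int t + 1) * _ t"] by (simp add: sum_subtractf diff_divide_distrib[symmetric])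
  finally show ?thesis .
qed

lemma sum_mult_lap_commute:
  assumes "cyclic N f" "cyclic N g"
  shows "(\<Sum>t<N. f (int t) * lap g (int t)) = (\<Sum>t<N. g (int t) * lap f (int t))"
  unfolding sum_mult_lap[OF assms] sum_mult_lap[OF assms(2,1)] by (simp add: mult.commute)

lemma sum_mult_lap_nonpos:
  assumes "cyclic N f"
  shows "(\<Sum>t<N. f (int t) * lap f (int t)) \<le> 0"
  unfolding sum_mult_lap[OF assms assms] by (auto intro!: sum_nonneg)

lemma sum_lap:
  assumes "cyclic N f" shows "(\<Sum>t<N. lap f (int t)) = 0"
  using sum_mult_lap[of N "\<lambda>_. 1" f] assms by (simp add: cyclic_def)

text \<open>The positive screening term \<open>m\<close> makes the quadratic form definite, so the
  homogeneous system has only the zero solution. The lemma supplies the function \<open>h\<close> of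
  the invariant density.\<close>

lemma screened_poisson_solvable:
  assumes N: "0 < N" and m: "cyclic N m" "\<And>t. 0 < m t" and g: "cyclic N g"
  shows "\<exists>h. cyclic N h \<and> (\<forall>t. m t * h t - lap h t = g t)"
proof -
  define A where "A s t = (m s + 1 / 2) * of_bool (s = t) - (of_bool ((s + 1) mod int N = t) + of_bool ((s - 1) mod int N = t)) / 4" for s t
  define S where "S = {0..<int N}"
  define ext where "ext x t = x (t mod int N)" for x :: "int \<Rightarrow> real" and t
  have cyc: "cyclic N (ext x)" for x by (simp add: cyclic_def ext_def)
  have modc: "f (t mod int N) = f t" if "cyclic N f" for f t
  proof -
    have "f (t + int n * int N) = f t" for n t
      by (induction n arbitrary: t) (use that in \<open>simp_all add: cyclic_def algebra_simps\<close>, metis add.assoc)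
    note up = this
    have "f (t mod int N) = f (t mod int N + (t div int N) * int N)"
    proof (cases "0 \<le> t div int N")
      case True
      then show ?thesis using up[of "t mod int N" "nat (t div int N)"] by simp
    next
      case False
      then show ?thesis using up[of "t mod int N + (t div int N) * int N" "nat (- (t div int N))"] by (simp add: minus_div_mult_eq_mod)
    qed
    then show ?thesis by simp
  qed
  have delta: "(\<Sum>t\<in>S. of_bool (s = t) * x t) = x s" if "s \<in> S" for s and x :: "int \<Rightarrow> real"
    using that by (simp add: of_bool_def if_distrib[of "\<lambda>c. c * _"] S_def cong: if_cong)
  have modS: "t mod int N \<in> S" for t using N by (simp add: S_def)
  have A: "(\<Sum>t\<in>S. A s t * x t) = m s * ext x s - lap (ext x) s" if s: "s \<in> S" for s x
  proof -
    have "(\<Sum>t\<in>S. A s t * x t) = (m s + 1 / 2) * (\<Sum>t\<in>S. of_bool (s = t) * x t)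
      - ((\<Sum>t\<in>S. of_bool ((s + 1) mod int N = t) * x t) + (\<Sum>t\<in>S. of_bool ((s - 1) mod int N = t) * x t)) / 4"
      unfolding A_def
      by (simp only: left_diff_distrib distrib_right sum_subtractf sum.distrib sum_distrib_left sum_divide_distrib mult.assoc times_divide_eq_left add_divide_distrib)
    also have "\<dots> = (m s + 1 / 2) * x s - (x ((s + 1) mod int N) + x ((s - 1) mod int N)) / 4"
      by (simp only: delta[OF s] delta[OF modS])
    also have "x s = ext x s" using s by (simp add: ext_def S_def)
    finally show ?thesis by (simp add: ext_def lap_def field_simps)
  qed
  \<comment> \<open>A periodic predicate that holds on one period holds everywhere; written as a 0-1
    function it is covered by \<open>modc\<close>.\<close>
  have all: "P t" if "cyclic N (\<lambda>t. of_bool (P t))" "\<And>s. s \<in> S \<Longrightarrow> P s" for P t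
    using modc[OF that(1), of t] that(2)[OF modS[of t]] by simp
  have cyc_eq: "cyclic N (\<lambda>t. of_bool (m t * ext x t - lap (ext x) t = y t))" if "cyclic N y" for x y
  proof -
    have "ext x (t + int N + 1) = ext x (t + 1)" "ext x (t + int N - 1) = ext x (t - 1)" "ext x (t + int N) = ext x t" for t
      using cyc[of x, unfolded cyclic_def, rule_format, of "t + 1"] cyc[of x, unfolded cyclic_def, rule_format, of "t - 1"]
        cyc[of x, unfolded cyclic_def, rule_format, of t] by (simp_all add: algebra_simps)
    then have "lap (ext x) (t + int N) = lap (ext x) t" for t by (simp add: lap_def)
    then show ?thesis using m(1) that cyc[of x] by (simp add: cyclic_def)
  qed
  have inj: "\<forall>t\<in>S. x t = 0" if ker: "\<And>s. s \<in> S \<Longrightarrow> (\<Sum>t\<in>S. A s t * x t) = 0" for x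
  proof -
    have eq: "m t * ext x t - lap (ext x) t = 0" if "t \<in> S" for t using A[OF that, of x] ker[OF that] by simp
    have "(\<Sum>t<N. m (int t) * (ext x (int t))\<^sup>2) = (\<Sum>t<N. ext x (int t) * lap (ext x) (int t))"
    proof (rule sum.cong[OF refl])
      fix t assume "t \<in> {..<N}"
      then have "lap (ext x) (int t) = m (int t) * ext x (int t)" using eq[of "int t"] by (simp add: S_def)
      then show "m (int t) * (ext x (int t))\<^sup>2 = ext x (int t) * lap (ext x) (int t)" by (simp add: power2_eq_square)
    qed
    also have "\<dots> \<le> 0" by (rule sum_mult_lap_nonpos[OF cyc])
    finally have le: "(\<Sum>t<N. m (int t) * (ext x (int t))\<^sup>2) \<le> 0" .
    have nn: "0 \<le> m (int t) * (ext x (int t))\<^sup>2" for t using m(2)[of "int t"] by simp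
    have "(\<Sum>t<N. m (int t) * (ext x (int t))\<^sup>2) = 0" using le nn by (intro antisym sum_nonneg) auto
    then have "\<forall>t\<in>{..<N}. m (int t) * (ext x (int t))\<^sup>2 = 0" using nn by (subst (asm) sum_nonneg_eq_0_iff) auto
    then have z: "ext x (int t) = 0" if "t < N" for t
      using that m(2)[of "int t"] by (metis lessThan_iff less_irrefl mult_eq_0_iff power_zero_numeral zero_eq_power2)
    show ?thesis
    proof
      fix t assume "t \<in> S"
      then show "x t = 0" using z[of "nat t"] by (auto simp: S_def ext_def)
    qed
  qed
  have "finite S" by (simp add: S_def)
  then obtain x where x: "\<forall>s\<in>S. (\<Sum>t\<in>S. A s t * x t) = g s"
    using finite_system_solvable[of S A g] inj by blast
  have "m t * ext x t - lap (ext x) t = g t" for t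
    by (rule all[OF cyc_eq[OF g]]) (use A x in auto)
  then show ?thesis using cyc by blast
qed

text \<open>Substituting \<open>f = e + 2 h\<close> and \<open>g = e - 2 h\<close> turns the quantity to be bounded into
  a sum of squares, using only that \<open>-lap\<close> is a nonnegative form.\<close>

lemma period_four_sum_nonpos:
  assumes cyc: "cyclic N h" "cyclic N z" "cyclic N y"
    and p: "\<And>t. 0 < p t" "\<And>t. p t < 1 / 2" and r: "\<And>t. 0 < r t" "\<And>t. r t < 1 / 2"
    and z: "\<And>t. z t - lap z t = p t * (2 + z t - y t) - 1 / 2"
    and y: "\<And>t. y t - lap y t = r t * (2 - z t + y t) - 1 / 2"
    and h: "\<And>t. lap h t = (p t - r t) + (p t + r t) * h t"
  shows "(\<Sum>t<N. - (z (int t) + y (int t)) * (p (int t) * (1 + h (int t)) + r (int t) * (1 - h (int t)) - 1 / 2)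
    + h (int t) * (z (int t) - y (int t)) / 2) \<le> 0"
proof -
  define f where "f t = (z t - y t) + 2 * h t" for t
  define g where "g t = (z t - y t) - 2 * h t" for t
  define s where "s t = z t + y t" for t
  define \<mu> where "\<mu> t = p t + r t - 1 / 2" for t
  define \<kappa> where "\<kappa> t = r t - p t" for t
  define \<delta> where "\<delta> t = g t * \<kappa> t / 4" for t
  have cf: "cyclic N f" unfolding f_def by (intro cyclic_add cyclic_diff cyclic_cmult cyc)
  have cs: "cyclic N s" unfolding s_def by (intro cyclic_add cyc)
  have f: "f t / 2 - lap f t = \<mu> t * g t" for t
    using z[of t] y[of t] h[of t] unfolding f_def lap_linear by (simp add: g_def \<mu>_def algebra_simps add_divide_distrib diff_divide_distrib)
  have s: "s t - lap s t = 2 * \<mu> t - \<kappa> t * (z t - y t)" for t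
    using z[of t] y[of t] unfolding s_def lap_linear by (simp add: \<mu>_def \<kappa>_def algebra_simps)
  \<comment> \<open>The equation for \<open>f\<close> is tested with \<open>f\<close> itself and the
    nonpositive form is dropped. Splitting the product by
    \<open>x * y \<le> x\<^sup>2 / 4 + y\<^sup>2\<close> then controls \<open>f\<close> by
    \<open>\<mu> * g\<close>.\<close>
  have "(\<Sum>t<N. (f (int t))\<^sup>2 / 2) = (\<Sum>t<N. f (int t) * (\<mu> (int t) * g (int t))) + (\<Sum>t<N. f (int t) * lap f (int t))"
    unfolding f[symmetric] sum.distrib[symmetric] by (simp add: power2_eq_square algebra_simps)
  also have "\<dots> \<le> (\<Sum>t<N. f (int t) * (\<mu> (int t) * g (int t)))"
    using sum_mult_lap_nonpos[OF cf] by simp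
  also have "\<dots> \<le> (\<Sum>t<N. (f (int t))\<^sup>2 / 4 + (\<mu> (int t) * g (int t))\<^sup>2)"
  proof (rule sum_mono)
    fix t
    have "0 \<le> (f (int t) / 2 - \<mu> (int t) * g (int t))\<^sup>2" by simp
    then show "f (int t) * (\<mu> (int t) * g (int t)) \<le> (f (int t))\<^sup>2 / 4 + (\<mu> (int t) * g (int t))\<^sup>2"
      by (simp add: power2_eq_square algebra_simps)
  qed
  finally have F: "(\<Sum>t<N. (f (int t))\<^sup>2 / 4) \<le> (\<Sum>t<N. (\<mu> (int t) * g (int t))\<^sup>2)"
    unfolding sum.distrib sum_divide_distrib[symmetric] by simp
  have pt: "s t * (\<mu> t - h t * \<kappa> t) - h t * (z t - y t) / 2 \<ge>
    (\<mu> t * g t)\<^sup>2 / 4 - (f t)\<^sup>2 / 16 - s t * lap s t / 2" for t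
  proof -
    have "\<mu> t - h t * \<kappa> t = (s t - lap s t) / 2 + 2 * \<delta> t"
      unfolding s by (simp add: \<delta>_def g_def algebra_simps add_divide_distrib diff_divide_distrib)
    then have "s t * (\<mu> t - h t * \<kappa> t) = s t * ((s t - lap s t) / 2 + 2 * \<delta> t)" by simp
    then have "s t * (\<mu> t - h t * \<kappa> t) = (s t)\<^sup>2 / 2 - s t * lap s t / 2 + 2 * s t * \<delta> t"
      by (simp add: power2_eq_square algebra_simps diff_divide_distrib)
    \<comment> \<open>Completing the square in \<open>s\<close> costs
      \<open>2 * (\<delta> t)\<^sup>2\<close>, a multiple of
      \<open>(\<kappa> t)\<^sup>2 * (g t)\<^sup>2\<close>.\<close>
    moreover have "0 \<le> (s t + 2 * \<delta> t)\<^sup>2 / 2" by simp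
    then have "- 2 * (\<delta> t)\<^sup>2 \<le> (s t)\<^sup>2 / 2 + 2 * s t * \<delta> t" by (simp add: power2_eq_square algebra_simps)
    moreover have "2 * (\<delta> t)\<^sup>2 = (\<kappa> t)\<^sup>2 * (g t)\<^sup>2 / 8" by (simp add: \<delta>_def power2_eq_square)
    moreover have "h t * (z t - y t) / 2 = (f t)\<^sup>2 / 16 - (g t)\<^sup>2 / 16"
      by (simp add: f_def g_def power2_eq_square field_simps)
    \<comment> \<open>The bounds on \<open>p\<close> and \<open>r\<close> say that the absolute
      values of \<open>\<mu>\<close> and \<open>\<kappa>\<close> add up to at most 1/2; with
      \<open>a\<close> the latter, the factor is at most
      \<open>1 - 4 * a + 6 * a\<^sup>2 \<le> 1 - a\<close>. So the available
      \<open>(g t)\<^sup>2 / 16\<close> covers both the cost of the completed square and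
      \<open>(\<mu> t * g t)\<^sup>2 / 4\<close>.\<close>
    moreover have "(4 * (\<mu> t)\<^sup>2 + 2 * (\<kappa> t)\<^sup>2) * (g t)\<^sup>2 \<le> 1 * (g t)\<^sup>2"
    proof (rule mult_right_mono)
      define a where "a = \<bar>\<kappa> t\<bar>"
      have a: "0 \<le> a" "a \<le> 1 / 2" "\<bar>\<mu> t\<bar> \<le> 1 / 2 - a"
        using p[of t] r[of t] unfolding a_def \<mu>_def \<kappa>_def by (simp, linarith+)
      have "(\<mu> t)\<^sup>2 \<le> (1 / 2 - a)\<^sup>2" using a(3) by (metis abs_ge_zero power2_abs power_mono)
      moreover have "a\<^sup>2 \<le> a / 2" using a mult_left_mono[OF a(2,1)] by (simp add: power2_eq_square)
      moreover have "(\<kappa> t)\<^sup>2 = a\<^sup>2" by (simp add: a_def)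
      ultimately show "4 * (\<mu> t)\<^sup>2 + 2 * (\<kappa> t)\<^sup>2 \<le> 1" using a by (simp add: power2_diff power2_eq_square algebra_simps)
    qed simp
    then have "4 * (\<mu> t * g t)\<^sup>2 + 2 * ((\<kappa> t)\<^sup>2 * (g t)\<^sup>2) \<le> (g t)\<^sup>2"
      by (simp add: power_mult_distrib distrib_right mult.assoc)
    ultimately show ?thesis by linarith
  qed
  have "0 \<le> (\<Sum>t<N. (\<mu> (int t) * g (int t))\<^sup>2) / 4 - (\<Sum>t<N. (f (int t))\<^sup>2 / 4) / 4 - (\<Sum>t<N. s (int t) * lap s (int t)) / 2"
    using F sum_mult_lap_nonpos[OF cs] by simp
  also have "\<dots> = (\<Sum>t<N. (\<mu> (int t) * g (int t))\<^sup>2 / 4 - (f (int t))\<^sup>2 / 16 - s (int t) * lap s (int t) / 2)"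
    by (simp add: sum_subtractf sum_divide_distrib)
  also have "\<dots> \<le> (\<Sum>t<N. s (int t) * (\<mu> (int t) - h (int t) * \<kappa> (int t)) - h (int t) * (z (int t) - y (int t)) / 2)"
    by (intro sum_mono pt)
  also have "\<dots> = - (\<Sum>t<N. - (z (int t) + y (int t)) * (p (int t) * (1 + h (int t)) + r (int t) * (1 - h (int t)) - 1 / 2)
    + h (int t) * (z (int t) - y (int t)) / 2)"
    unfolding sum_negf[symmetric] by (rule sum.cong) (auto simp: s_def \<mu>_def \<kappa>_def algebra_simps)
  finally show ?thesis by simp
qed

text \<open>Oddness under the reflection of row \<open>c\<close> to row \<open>3 - c\<close> leaves
  two rows of unknowns, \<open>z\<close> and \<open>y\<close>, and two rates, \<open>p\<close> and
  \<open>r\<close>. The invariant density is \<open>1 + h\<close> on rows 0 and 3 and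
  \<open>1 - h\<close> on rows 1 and 2; pairing it with the second cell problem eliminates
  \<open>\<psi>\<close>.\<close>

lemma (in odd_walk) effective_le_period_four:
  assumes "CARD('n) = 2" "L k = 4" and cell: "cell k \<beta> \<phi> \<psi> q" and pr: "periodic L \<phi>" "periodic L (\<psi> k)"
    and odd\<phi>: "\<And>y. \<phi> (reflect k L y) = - \<phi> y"
  shows "q \<le> 1 / 4"
proof -
  have "card (UNIV - {k}) = 1" using assms(1) by simp
  then obtain j where "UNIV - {k} = {j}" using card_1_singletonE by blast
  then have U: "(UNIV :: 'n set) = {k, j}" and jk: "j \<noteq> k" by auto
  define N where "N = L j"
  have N: "0 < N" using L by (simp add: N_def)
  define pt :: "int \<Rightarrow> int \<Rightarrow> int ^ 'n" where "pt c t = (\<chi> i. if i = k then c else t)" for c t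
  have move: "pt c t + axis k 1 = pt (c + 1) t" "pt c t - axis k 1 = pt (c - 1) t"
    "pt c t + axis j 1 = pt c (t + 1)" "pt c t - axis j 1 = pt c (t - 1)" for c t
    using jk U by (auto simp: pt_def vec_eq_iff axis_def)
  have nth: "i = k \<or> i = j" for i using U by blast
  have cyc: "g (pt c (t + int N)) = g (pt c t)" if "periodic L g" for g c t
    by (rule periodic_cong[OF that]) (use nth in \<open>auto simp: pt_def N_def, metis mod_add_self2\<close>)
  have row: "g (pt (c + 4) t) = g (pt c t)" if "periodic L g" for g c t
    by (rule periodic_cong[OF that]) (simp add: pt_def assms(2))
  have refl: "reflect k L (pt c t) = pt (3 - c) t" for c t
    by (auto simp: reflect_def pt_def vec_eq_iff assms(2))
  define p where "p t = 1 / 4 + \<beta> (pt 0 t)" for t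
  define r where "r t = 1 / 4 - \<beta> (pt 1 t)" for t
  define z where "z t = \<phi> (pt 0 t)" for t
  define y where "y t = - \<phi> (pt 1 t)" for t
  have \<beta>s: "\<beta> (pt 0 t) = p t - 1 / 4" "\<beta> (pt 1 t) = 1 / 4 - r t" "\<beta> (pt 2 t) = r t - 1 / 4" "\<beta> (pt 3 t) = 1 / 4 - p t" for t
    using odd[of "pt 1 t"] odd[of "pt 0 t"] by (simp_all add: p_def r_def refl)
  have \<phi>s: "\<phi> (pt 0 t) = z t" "\<phi> (pt 1 t) = - y t" "\<phi> (pt 2 t) = y t" "\<phi> (pt 3 t) = - z t"
    "\<phi> (pt (-1) t) = - z t" "\<phi> (pt 4 t) = z t" for t
    using odd\<phi>[of "pt 1 t"] odd\<phi>[of "pt 0 t"] row[OF pr(1), of "-1" t] row[OF pr(1), of 0 t]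
    by (simp_all add: z_def y_def refl)
  have pb: "0 < p t" "p t < 1 / 2" and rb: "0 < r t" "r t < 1 / 2" for t
    using bound[of "pt 0 t"] bound[of "pt 1 t"] assms(1) by (auto simp: p_def r_def abs_less_iff)
  have st: "step k \<beta> g (pt c t) = (1 / 4 + \<beta> (pt c t)) * g (pt (c + 1) t) + (1 / 4 - \<beta> (pt c t)) * g (pt (c - 1) t)
     + (g (pt c (t + 1)) + g (pt c (t - 1))) / 4" for g c t
    using jk unfolding step_def U by (simp add: rate_def move assms(1) add_divide_distrib)
  have fl: "flux k \<beta> k \<phi> (pt c t) = (1 / 4 + \<beta> (pt c t)) * \<phi> (pt (c + 1) t) - (1 / 4 - \<beta> (pt c t)) * \<phi> (pt (c - 1) t)" for c t
    by (simp add: flux_def rate_def move assms(1))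
  have c1: "\<phi> (pt c t) - step k \<beta> \<phi> (pt c t) = 2 * \<beta> (pt c t)" for c t using cell by (simp add: cell_def)
  have zeq: "z t - lap z t = p t * (2 + z t - y t) - 1 / 2" for t
    using c1[of 0 t] unfolding st by (simp add: \<phi>s \<beta>s lap_def algebra_simps add_divide_distrib diff_divide_distrib)
  have yeq: "y t - lap y t = r t * (2 - z t + y t) - 1 / 2" for t
    using c1[of 1 t] unfolding st by (simp add: \<phi>s \<beta>s lap_def algebra_simps add_divide_distrib diff_divide_distrib)
  have cz: "cyclic N z" "cyclic N y" "cyclic N p" "cyclic N r"
    unfolding cyclic_def z_def y_def p_def r_def by (simp_all add: cyc[OF pr(1)] cyc[OF per])
  \<comment> \<open>The equation is invariance of the density: along \<open>k\<close>, row 0 is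
    entered from row 3 with probability \<open>1 / 2 - p t\<close> and from row 1 with probability
    \<open>r t\<close>.\<close>
  have "\<exists>h. cyclic N h \<and> (\<forall>t. (p t + r t) * h t - lap h t = r t - p t)"
    using pb rb by (intro screened_poisson_solvable[OF N] cyclic_add cyclic_diff cz add_pos_pos) auto
  then obtain h where ch: "cyclic N h" and h: "\<And>t. (p t + r t) * h t - lap h t = r t - p t" by blast
  have heq: "lap h t = (p t - r t) + (p t + r t) * h t" for t using h[of t] by simp
  define S where "S c t = \<psi> k (pt c t)" for c t
  define s0 where "s0 t = S 0 t + S 3 t" for t
  define s1 where "s1 t = S 1 t + S 2 t" for t
  have Srow: "S 4 t = S 0 t" "S (-1) t = S 3 t" for t
    using row[OF pr(2), of 0 t] row[OF pr(2), of "-1" t] by (simp_all add: S_def)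
  have c2: "S c t - ((1 / 4 + \<beta> (pt c t)) * S (c + 1) t + (1 / 4 - \<beta> (pt c t)) * S (c - 1) t + (S c (t + 1) + S c (t - 1)) / 4)
    = (1 / 4 + \<beta> (pt c t)) * \<phi> (pt (c + 1) t) - (1 / 4 - \<beta> (pt c t)) * \<phi> (pt (c - 1) t) - (q - 1 / 4)" for c t
  proof -
    have "\<psi> k (pt c t) - step k \<beta> (\<psi> k) (pt c t) = flux k \<beta> k \<phi> (pt c t) - (q - 1 / 4)"
      using cell assms(1) by (simp add: cell_def)
    then show ?thesis unfolding st fl S_def .
  qed
  have e0: "p t * (s0 t - s1 t) - lap s0 t = 2 * ((1 / 2 - p t) * z t - p t * y t) - 2 * (q - 1 / 4)" for t
    using c2[of 0 t] c2[of 3 t] by (simp add: \<phi>s \<beta>s Srow s0_def s1_def lap_def algebra_simps add_divide_distrib diff_divide_distrib)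
  have e1: "r t * (s1 t - s0 t) - lap s1 t = 2 * ((1 / 2 - r t) * y t - r t * z t) - 2 * (q - 1 / 4)" for t
    using c2[of 1 t] c2[of 2 t] by (simp add: \<phi>s \<beta>s s0_def s1_def lap_def algebra_simps add_divide_distrib diff_divide_distrib)
  have cS: "cyclic N s0" "cyclic N s1"
    unfolding cyclic_def s0_def s1_def S_def by (simp_all add: cyc[OF pr(2)])
  let ?Q = "\<lambda>t. - (z t + y t) * (p t * (1 + h t) + r t * (1 - h t) - 1 / 2) + h t * (z t - y t) / 2"
  \<comment> \<open>Weighting the equations of the two row pairs with \<open>1 + h\<close> and
    \<open>1 - h\<close> leaves only terms in \<open>s0\<close> and \<open>s1\<close> that sum to
    zero over a period, by the symmetry of \<open>lap\<close>.\<close>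
  have key: "(s0 t - s1 t) * lap h t - lap (\<lambda>t. s0 t + s1 t) t - h t * lap (\<lambda>t. s0 t - s1 t) t = 2 * ?Q t - 4 * (q - 1 / 4)" for t
  proof -
    have "(1 + h t) * (p t * (s0 t - s1 t) - lap s0 t) + (1 - h t) * (r t * (s1 t - s0 t) - lap s1 t)
       = 2 * ?Q t - 4 * (q - 1 / 4)"
      unfolding e0 e1 by (simp add: field_simps)
    moreover have "(1 + h t) * (p t * (s0 t - s1 t) - lap s0 t) + (1 - h t) * (r t * (s1 t - s0 t) - lap s1 t)
      = (s0 t - s1 t) * lap h t - lap (\<lambda>t. s0 t + s1 t) t - h t * lap (\<lambda>t. s0 t - s1 t) t"
      unfolding heq lap_linear by (simp add: algebra_simps)
    ultimately show ?thesis by simp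
  qed
  have "(\<Sum>t<N. 2 * ?Q (int t) - 4 * (q - 1 / 4)) = 0"
  proof -
    have "(\<Sum>t<N. 2 * ?Q (int t) - 4 * (q - 1 / 4)) = (\<Sum>t<N. (s0 (int t) - s1 (int t)) * lap h (int t))
      - (\<Sum>t<N. lap (\<lambda>t. s0 t + s1 t) (int t)) - (\<Sum>t<N. h (int t) * lap (\<lambda>t. s0 t - s1 t) (int t))"
      unfolding key[symmetric] sum_subtractf ..
    also have "\<dots> = 0"
      unfolding sum_lap[OF cyclic_add[OF cS]] sum_mult_lap_commute[OF ch cyclic_diff[OF cS]] by simp
    finally show ?thesis .
  qed
  then have "real N * (4 * (q - 1 / 4)) = 2 * (\<Sum>t<N. ?Q (int t))"
    unfolding sum_subtractf sum_distrib_left[symmetric] by (simp add: right_diff_distrib)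
  also have "\<dots> \<le> 0"
    using period_four_sum_nonpos[OF ch cz(1,2) pb rb zeq yeq heq] by simp
  finally show ?thesis using N by (simp add: mult_le_0_iff)
qed

subsection \<open>Perturbation of the symmetric walk\<close>

text \<open>Second-order perturbation theory around the symmetric walk. The approximate second corrector
  \<open>t * \<psi>1 + t\<^sup>2 * \<psi>2\<close> has residual \<open>t\<^sup>2 * c2 + O(t\<^sup>3)\<close>, which bounds \<open>q\<close> from below by the maximum principle.\<close>

lemma perturbation_lower_bound:
  fixes k :: "'n::finite" and L :: "'n \<Rightarrow> nat" and \<beta>1 :: "int ^ 'n \<Rightarrow> real"
  defines "c \<equiv> 1 / (2 * real CARD('n))"
  defines "up g y \<equiv> g (y + axis k 1)" and "dn g y \<equiv> g (y - axis k 1)"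
  assumes L: "\<forall>i. L i > 0" and per: "periodic L \<beta>1" and bd: "\<And>y. \<bar>\<beta>1 y\<bar> \<le> 1"
    and odd: "\<And>y. \<beta>1 (reflect k L y) = - \<beta>1 y"
    and p: "periodic L \<phi>1" "periodic L \<phi>2" "periodic L \<psi>1" "periodic L \<psi>2"
    and \<phi>1: "\<And>y. \<phi>1 y - step k (\<lambda>_. 0) \<phi>1 y = 2 * \<beta>1 y"
    and \<phi>2: "\<And>y. \<phi>2 y - step k (\<lambda>_. 0) \<phi>2 y = \<beta>1 y * (up \<phi>1 y - dn \<phi>1 y)"
    and \<psi>1: "\<And>y. \<psi>1 y - step k (\<lambda>_. 0) \<psi>1 y = c * (up \<phi>1 y - dn \<phi>1 y)"
    and \<psi>2: "\<And>y. \<psi>2 y - step k (\<lambda>_. 0) \<psi>2 y = \<beta>1 y * (up \<psi>1 y - dn \<psi>1 y)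
        + c * (up \<phi>2 y - dn \<phi>2 y) + \<beta>1 y * (up \<phi>1 y + dn \<phi>1 y) - c2"
    and "0 < c2"
  shows "\<exists>t. 0 < t \<and> t < c \<and> (\<forall>\<phi> \<psi> q. cell k (\<lambda>y. t * \<beta>1 y) \<phi> \<psi> q \<longrightarrow> periodic L \<phi> \<longrightarrow> periodic L (\<psi> k) \<longrightarrow> c < q)"
proof -
  have c: "0 < c" "c \<le> 1 / 2" unfolding c_def using Suc_leI[OF zero_less_card_finite[where 'a='n]] by (auto simp: field_simps)
  obtain K2 where K2: "0 \<le> K2" "\<And>y. \<bar>\<phi>2 y\<bar> \<le> K2" using periodic_bounded[OF L p(2)] by blast
  obtain K4 where K4: "0 \<le> K4" "\<And>y. \<bar>\<psi>2 y\<bar> \<le> K4" using periodic_bounded[OF L p(4)] by blast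
  \<comment> \<open>For \<open>t \<le> c / 2\<close> all rates are at least \<open>c / 2\<close>, so
    the oscillation of the remainder \<open>\<rho>\<close> has a bound independent of
    \<open>t\<close>; \<open>2 * K2\<close> bounds its residual.\<close>
  define K3 where "K3 = (2 / (c / 2)) ^ (\<Sum>i\<in>UNIV. L i) * (2 * K2)"
  have K3: "0 \<le> K3" using c K2 by (simp add: K3_def)
  define K5 where "K5 = 2 * K2 + 4 * K3 + 2 * K4 + 1"
  have K5: "0 < K5" using K2 K3 K4 by (simp add: K5_def)
  \<comment> \<open>Small enough for the error \<open>t ^ 3 * K5\<close> to stay below the gain
    \<open>t\<^sup>2 * c2\<close>.\<close>
  define t where "t = min (c / 2) (c2 / (2 * K5))"
  have t: "0 < t" "t \<le> c / 2" "t * K5 < c2"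
  proof -
    show "0 < t" "t \<le> c / 2" using c K5 \<open>0 < c2\<close> by (auto simp: t_def)
    have "t \<le> c2 / (2 * K5)" by (simp add: t_def)
    then have "t * (2 * K5) \<le> c2" using K5 by (subst (asm) pos_le_divide_eq) auto
    then show "t * K5 < c2" using \<open>0 < c2\<close> by linarith
  qed
  define \<beta> where "\<beta> = (\<lambda>y. t * \<beta>1 y)"
  have tb: "\<bar>t * \<beta>1 y\<bar> \<le> c / 2" for y
  proof -
    have "t * \<bar>\<beta>1 y\<bar> \<le> c / 2 * 1" using t bd[of y] by (intro mult_mono) auto
    then show ?thesis using t by (simp add: abs_mult)
  qed
  interpret walk k L \<beta>
  proof
    show "\<forall>i. L i > 0" by fact
    show "periodic L \<beta>" unfolding \<beta>_def by (intro periodic_intros per)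
    show "\<bar>\<beta> y\<bar> < 1 / (2 * real CARD('n))" for y
      using tb[of y] c unfolding c_def[symmetric] \<beta>_def by linarith
  qed
  have st: "step k \<beta> g y = step k (\<lambda>_. 0) g y + t * \<beta>1 y * (up g y - dn g y)" for g y
    unfolding step_alt[of k \<beta>] step_alt[of k "\<lambda>_. 0"] by (simp add: \<beta>_def up_def dn_def)
  have "c < q" if cell: "cell k \<beta> \<phi> \<psi> q" and pr: "periodic L \<phi>" "periodic L (\<psi> k)" for \<phi> \<psi> q
  proof -
    define \<rho> where "\<rho> y = (\<phi> y - t * \<phi>1 y - t\<^sup>2 * \<phi>2 y) / t ^ 3" for y
    have \<phi>: "\<phi> y = t * \<phi>1 y + t\<^sup>2 * \<phi>2 y + t ^ 3 * \<rho> y" for y using t by (simp add: \<rho>_def)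
    have p\<rho>: "periodic L \<rho>" unfolding \<rho>_def by (intro periodic_intros p pr)
    have cell\<phi>: "\<phi> y - step k \<beta> \<phi> y = 2 * (t * \<beta>1 y)" for y using cell by (simp add: cell_def \<beta>_def)
    have st\<phi>: "step k \<beta> \<phi> y = t * step k \<beta> \<phi>1 y + t\<^sup>2 * step k \<beta> \<phi>2 y + t ^ 3 * step k \<beta> \<rho> y" for y
    proof -
      have "\<phi> = (\<lambda>y. t * \<phi>1 y + t\<^sup>2 * \<phi>2 y + t ^ 3 * \<rho> y)" using \<phi> by blast
      then show ?thesis by (simp only: step_add step_cmult)
    qed
    have \<rho>eq: "\<rho> y - step k \<beta> \<rho> y = \<beta>1 y * (up \<phi>2 y - dn \<phi>2 y)" for y
    proof -
      have "t ^ 3 * (\<rho> y - step k \<beta> \<rho> y) = (\<phi> y - step k \<beta> \<phi> y)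
          - t * (\<phi>1 y - step k \<beta> \<phi>1 y) - t\<^sup>2 * (\<phi>2 y - step k \<beta> \<phi>2 y)"
        unfolding st\<phi> \<phi>[of y] by (simp add: algebra_simps)
      also have "\<dots> = 2 * (t * \<beta>1 y) - t * (2 * \<beta>1 y - t * \<beta>1 y * (up \<phi>1 y - dn \<phi>1 y))
          - t\<^sup>2 * (\<beta>1 y * (up \<phi>1 y - dn \<phi>1 y) - t * \<beta>1 y * (up \<phi>2 y - dn \<phi>2 y))"
        unfolding cell\<phi> unfolding st \<phi>1[symmetric] \<phi>2[symmetric] by (simp add: algebra_simps)
      also have "\<dots> = t ^ 3 * (\<beta>1 y * (up \<phi>2 y - dn \<phi>2 y))"
        by (simp add: algebra_simps power2_eq_square power3_eq_cube)
      finally show ?thesis using t by simp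
    qed
    have bu: "\<bar>\<beta>1 y * v\<bar> \<le> M" if "\<bar>v\<bar> \<le> M" for y v M
      using mult_mono[OF bd[of y] that] by (simp add: abs_mult)
    have "\<rho> x - \<rho> y \<le> K3" for x y
      unfolding K3_def
    proof (rule oscillation_bound[OF L p\<rho>])
      show "0 < c / 2" "c / 2 \<le> 1" "0 \<le> 2 * K2" using c K2 by auto
      show "c / 2 \<le> rate k \<beta> s i y" if "s \<in> {1, -1}" for y i s
        using tb[of y] that c unfolding rate_def c_def[symmetric] \<beta>_def by auto
      show "\<rho> y - step k \<beta> \<rho> y \<le> 2 * K2" for y
      proof -
        have "\<bar>up \<phi>2 y - dn \<phi>2 y\<bar> \<le> 2 * K2"
          using K2(2)[of "y + axis k 1"] K2(2)[of "y - axis k 1"] unfolding up_def dn_def by linarith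
        from bu[OF this, of y] show ?thesis unfolding \<rho>eq by linarith
      qed
    qed
    then have osc: "\<bar>\<rho> y - \<rho> 0\<bar> \<le> K3" for y by (metis abs_le_iff minus_diff_eq)
    \<comment> \<open>Only the oscillation of \<open>\<rho>\<close> is bounded, so its value at 0 is
      split off. In the flux this constant contributes \<open>t ^ 3 * \<rho> 0\<close> times
      \<open>2 * (t * \<beta>1 y)\<close>, which is the same multiple of the residual of
      \<open>\<phi>\<close>; hence the term with \<open>\<phi>\<close> in
      \<open>\<zeta>\<close>.\<close>
    define \<sigma> where "\<sigma> y = \<rho> y - \<rho> 0" for y
    define \<zeta> where "\<zeta> y = \<psi> k y - t ^ 3 * \<rho> 0 * \<phi> y - (t * \<psi>1 y + t\<^sup>2 * \<psi>2 y)" for y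
    define R where "R y = c * (up \<sigma> y - dn \<sigma> y) + \<beta>1 y * (up \<phi>2 y + dn \<phi>2 y)
      + t * (\<beta>1 y * (up \<sigma> y + dn \<sigma> y)) + \<beta>1 y * (up \<psi>2 y - dn \<psi>2 y)" for y
    have res: "\<zeta> y - step k \<beta> \<zeta> y = t\<^sup>2 * c2 - (q - c) + t ^ 3 * R y" for y
    proof -
      have ud: "up \<phi> y = t * up \<phi>1 y + t\<^sup>2 * up \<phi>2 y + t ^ 3 * (up \<sigma> y + \<rho> 0)"
        "dn \<phi> y = t * dn \<phi>1 y + t\<^sup>2 * dn \<phi>2 y + t ^ 3 * (dn \<sigma> y + \<rho> 0)"
        by (simp_all add: up_def dn_def \<phi> \<sigma>_def)
      have "flux k \<beta> k \<phi> y = c * (up \<phi> y - dn \<phi> y) + t * (\<beta>1 y * (up \<phi> y + dn \<phi> y))"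
      proof -
        have "rate k \<beta> s k y = c + s * (t * \<beta>1 y)" for s by (simp add: rate_def c_def \<beta>_def)
        then show ?thesis by (simp add: flux_def up_def dn_def algebra_simps)
      qed
      moreover have "\<psi> k y - step k \<beta> (\<psi> k) y = flux k \<beta> k \<phi> y - (q - c)"
        using cell by (simp add: cell_def c_def)
      ultimately have \<psi>: "\<psi> k y - step k \<beta> (\<psi> k) y
        = c * (up \<phi> y - dn \<phi> y) + t * (\<beta>1 y * (up \<phi> y + dn \<phi> y)) - (q - c)" by simp
      have "step k \<beta> \<zeta> y = step k \<beta> (\<psi> k) y - t ^ 3 * \<rho> 0 * step k \<beta> \<phi> y - (t * step k \<beta> \<psi>1 y + t\<^sup>2 * step k \<beta> \<psi>2 y)"
        unfolding \<zeta>_def step_diff step_add step_cmult ..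
      then have "\<zeta> y - step k \<beta> \<zeta> y = (\<psi> k y - step k \<beta> (\<psi> k) y) - t ^ 3 * \<rho> 0 * (\<phi> y - step k \<beta> \<phi> y)
        - t * (\<psi>1 y - step k \<beta> \<psi>1 y) - t\<^sup>2 * (\<psi>2 y - step k \<beta> \<psi>2 y)"
        unfolding \<zeta>_def by (simp add: algebra_simps)
      also have "\<dots> = (c * (up \<phi> y - dn \<phi> y) + t * (\<beta>1 y * (up \<phi> y + dn \<phi> y)) - (q - c)) - t ^ 3 * \<rho> 0 * (2 * (t * \<beta>1 y))
        - t * (c * (up \<phi>1 y - dn \<phi>1 y) - t * \<beta>1 y * (up \<psi>1 y - dn \<psi>1 y))
        - t\<^sup>2 * ((\<beta>1 y * (up \<psi>1 y - dn \<psi>1 y) + c * (up \<phi>2 y - dn \<phi>2 y) + \<beta>1 y * (up \<phi>1 y + dn \<phi>1 y) - c2)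
           - t * \<beta>1 y * (up \<psi>2 y - dn \<psi>2 y))"
        unfolding \<psi> cell\<phi> unfolding st \<psi>1[symmetric] \<psi>2[symmetric] by (simp only: diff_diff_eq)
      also have "\<dots> = t\<^sup>2 * c2 - (q - c) + t ^ 3 * R y"
        unfolding ud R_def by (simp add: algebra_simps power2_eq_square power3_eq_cube)
      finally show ?thesis .
    qed
    have R: "- K5 \<le> R y" for y
    proof -
      have \<sigma>: "\<bar>up \<sigma> y\<bar> \<le> K3" "\<bar>dn \<sigma> y\<bar> \<le> K3" using osc by (auto simp: up_def dn_def \<sigma>_def)
      have "\<bar>c * (up \<sigma> y - dn \<sigma> y)\<bar> \<le> 1 * (2 * K3)"
        unfolding abs_mult using c \<sigma> by (intro mult_mono) auto
      moreover have "\<bar>\<beta>1 y * (up \<phi>2 y + dn \<phi>2 y)\<bar> \<le> 2 * K2"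
        by (rule bu) (use K2(2)[of "y + axis k 1"] K2(2)[of "y - axis k 1"] in \<open>unfold up_def dn_def, linarith\<close>)
      moreover have "\<bar>\<beta>1 y * (up \<psi>2 y - dn \<psi>2 y)\<bar> \<le> 2 * K4"
        by (rule bu) (use K4(2)[of "y + axis k 1"] K4(2)[of "y - axis k 1"] in \<open>unfold up_def dn_def, linarith\<close>)
      moreover have "\<bar>t * (\<beta>1 y * (up \<sigma> y + dn \<sigma> y))\<bar> \<le> 1 * (2 * K3)"
        unfolding abs_mult[of t] using t c \<sigma> by (intro mult_mono bu) auto
      ultimately show ?thesis unfolding R_def K5_def by linarith
    qed
    have p\<zeta>: "periodic L \<zeta>" unfolding \<zeta>_def by (intro periodic_intros p pr)
    have "t\<^sup>2 * c2 - (q - c) - t ^ 3 * K5 \<le> 0"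
    proof (rule residual_lower[OF p\<zeta>])
      fix y
      have "t ^ 3 * (- K5) \<le> t ^ 3 * R y" using t R[of y] by (intro mult_left_mono) auto
      then show "t\<^sup>2 * c2 - (q - c) - t ^ 3 * K5 \<le> \<zeta> y - step k \<beta> \<zeta> y" unfolding res by simp
    qed
    moreover have "0 < t\<^sup>2 * (c2 - t * K5)" using t by (intro mult_pos_pos) auto
    then have "t ^ 3 * K5 < t\<^sup>2 * c2" by (simp add: right_diff_distrib power2_eq_square power3_eq_cube mult.assoc)
    ultimately show "c < q" by linarith
  qed
  then show ?thesis using t c unfolding \<beta>_def by (intro exI[of _ t]) auto
qed

lemma reflect_nth: "reflect k L y $ i = (if i = k then int (L k) - 1 - y $ k else y $ i)"
  by (simp add: reflect_def)

lemma sin_cos_period_mod: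
  fixes a :: int
  assumes "0 < N" "\<theta> = 2 * pi * real m / real N"
  shows "sin (\<theta> * (real_of_int (a mod int N) + s)) = sin (\<theta> * (real_of_int a + s))"
    "cos (\<theta> * (real_of_int (a mod int N) + s)) = cos (\<theta> * (real_of_int a + s))"
proof -
  have "real_of_int a = real_of_int (a mod int N) + real_of_int (a div int N) * real N"
    by (metis mod_mult_div_eq mult.commute of_int_add of_int_mult of_int_of_nat_eq)
  moreover have "\<theta> * real N = 2 * pi * real m" using assms by simp
  ultimately have "\<theta> * (real_of_int a + s) = \<theta> * (real_of_int (a mod int N) + s) + (2 * pi) * of_int (a div int N * int m)"
    by (simp add: algebra_simps)
  then show "sin (\<theta> * (real_of_int (a mod int N) + s)) = sin (\<theta> * (real_of_int a + s))"
    "cos (\<theta> * (real_of_int (a mod int N) + s)) = cos (\<theta> * (real_of_int a + s))"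
    by (simp_all add: sin_add cos_add del: of_int_mult)
qed

text \<open>Products of single Fourier modes make \<open>\<beta>1\<close> and its partner
  \<open>\<gamma>\<close> eigenfunctions of the symmetric walk for the same eigenvalue, so the
  first-order correctors are explicit. The shift by 1/2 puts a zero of the sine at the centre of the
  reflection, which makes the drift odd.\<close>

lemma ex_effective_greater:
  fixes k :: "'n::finite" and L :: "'n \<Rightarrow> nat"
  defines "c \<equiv> 1 / (2 * real CARD('n))"
  assumes L: "\<forall>i. L i > 0" and Lk: "6 \<le> L k" and jk: "j \<noteq> k" and Lj: "2 \<le> L j"
  shows "\<exists>b. admissible k L b \<and> c < effective_diffusion k L b"
proof -
  have c: "0 < c" by (simp add: c_def)
  define \<theta> where "\<theta> = 2 * pi * real 1 / real (L k)"
  \<comment> \<open>The largest multiple of the base frequency not exceeding pi. It lies beyond pi/2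
    as soon as \<open>L j \<ge> 2\<close>, so its cosine is negative.\<close>
  define \<eta> where "\<eta> = 2 * pi * real (L j div 2) / real (L j)"
  define a where "a = cos \<theta>"
  define b where "b = cos \<eta>"
  have \<theta>: "0 < \<theta>" "\<theta> \<le> pi / 3"
    using Lk by (auto simp: \<theta>_def field_simps)
  have a: "1 / 2 \<le> a" unfolding a_def using cos_monotone_0_pi_le[of \<theta> "pi / 3"] \<theta> cos_60 by simp
  have b: "b < 0"
  proof -
    have "L j < 4 * (L j div 2)" "2 * (L j div 2) \<le> L j" using Lj by presburger+
    then have "real (L j) < 4 * real (L j div 2)" "2 * real (L j div 2) \<le> real (L j)" by linarith+
    then have "pi / 2 < \<eta>" "\<eta> \<le> pi" using Lj by (auto simp: \<eta>_def field_simps)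
    moreover have "cos (pi - \<eta>) > 0" using calculation by (intro cos_gt_zero_pi) auto
    ultimately show ?thesis by (simp add: b_def)
  qed
  have ab: "a \<le> 1" "-1 \<le> b" by (simp_all add: a_def b_def)
  define \<beta>1 where "\<beta>1 y = sin (\<theta> * (real_of_int (y $ k) + 1 / 2)) * cos (\<eta> * (real_of_int (y $ j) + 0))" for y :: "int ^ 'n"
  define \<gamma> where "\<gamma> y = cos (\<theta> * (real_of_int (y $ k) + 1 / 2)) * cos (\<eta> * (real_of_int (y $ j) + 0))" for y :: "int ^ 'n"
  have per: "periodic L \<beta>1" "periodic L \<gamma>"
    unfolding periodic_def \<beta>1_def \<gamma>_def wrap_nth
    using L by (simp_all only: sin_cos_period_mod[OF _ \<theta>_def] sin_cos_period_mod[OF _ \<eta>_def] simp_thms)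
  have bd: "\<bar>\<beta>1 y\<bar> \<le> 1" for y unfolding \<beta>1_def abs_mult by (intro mult_le_one) auto
  have two: "\<theta> * (real_of_int (int (L k) - 1 - m) + 1 / 2) = 2 * pi - \<theta> * (real_of_int m + 1 / 2)" for m
    using Lk by (simp add: \<theta>_def field_simps)
  have odd: "\<beta>1 (reflect k L y) = - \<beta>1 y" and even: "\<gamma> (reflect k L y) = \<gamma> y" for y
    unfolding \<beta>1_def \<gamma>_def reflect_nth using jk by (simp_all only: if_True if_False two refl sin_2pi_minus cos_2pi_minus)
  have kk: "sin (\<theta> * (real_of_int (m + 1) + 1 / 2)) = sin (\<theta> * (real_of_int m + 1 / 2)) * a + cos (\<theta> * (real_of_int m + 1 / 2)) * sin \<theta>"
    "sin (\<theta> * (real_of_int (m - 1) + 1 / 2)) = sin (\<theta> * (real_of_int m + 1 / 2)) * a - cos (\<theta> * (real_of_int m + 1 / 2)) * sin \<theta>"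
    "cos (\<theta> * (real_of_int (m + 1) + 1 / 2)) = cos (\<theta> * (real_of_int m + 1 / 2)) * a - sin (\<theta> * (real_of_int m + 1 / 2)) * sin \<theta>"
    "cos (\<theta> * (real_of_int (m - 1) + 1 / 2)) = cos (\<theta> * (real_of_int m + 1 / 2)) * a + sin (\<theta> * (real_of_int m + 1 / 2)) * sin \<theta>" for m
  proof -
    have "\<theta> * (real_of_int (m + 1) + 1 / 2) = \<theta> * (real_of_int m + 1 / 2) + \<theta>" "\<theta> * (real_of_int (m - 1) + 1 / 2) = \<theta> * (real_of_int m + 1 / 2) - \<theta>"
      by (simp_all add: algebra_simps)
    then show "sin (\<theta> * (real_of_int (m + 1) + 1 / 2)) = sin (\<theta> * (real_of_int m + 1 / 2)) * a + cos (\<theta> * (real_of_int m + 1 / 2)) * sin \<theta>"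
    "sin (\<theta> * (real_of_int (m - 1) + 1 / 2)) = sin (\<theta> * (real_of_int m + 1 / 2)) * a - cos (\<theta> * (real_of_int m + 1 / 2)) * sin \<theta>"
    "cos (\<theta> * (real_of_int (m + 1) + 1 / 2)) = cos (\<theta> * (real_of_int m + 1 / 2)) * a - sin (\<theta> * (real_of_int m + 1 / 2)) * sin \<theta>"
    "cos (\<theta> * (real_of_int (m - 1) + 1 / 2)) = cos (\<theta> * (real_of_int m + 1 / 2)) * a + sin (\<theta> * (real_of_int m + 1 / 2)) * sin \<theta>"
      by (simp_all only: sin_add cos_add sin_diff cos_diff a_def)
  qed
  have jj: "cos (\<eta> * (real_of_int (m + 1) + 0)) + cos (\<eta> * (real_of_int (m - 1) + 0)) = 2 * b * cos (\<eta> * (real_of_int m + 0))" for m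
  proof -
    have "\<eta> * (real_of_int (m + 1) + 0) = \<eta> * (real_of_int m + 0) + \<eta>" "\<eta> * (real_of_int (m - 1) + 0) = \<eta> * (real_of_int m + 0) - \<eta>"
      by (simp_all add: algebra_simps)
    then show ?thesis by (simp only: cos_add cos_diff b_def) simp
  qed
  have ax: "(y + axis i 1) $ l = (if l = i then y $ l + 1 else y $ l)" "(y - axis i 1) $ l = (if l = i then y $ l - 1 else y $ l)" for y :: "int ^ 'n" and i l
    by (auto simp: axis_def)
  have upk: "\<beta>1 (y + axis k 1) = a * \<beta>1 y + sin \<theta> * \<gamma> y" "\<beta>1 (y - axis k 1) = a * \<beta>1 y - sin \<theta> * \<gamma> y"
    "\<gamma> (y + axis k 1) = a * \<gamma> y - sin \<theta> * \<beta>1 y" "\<gamma> (y - axis k 1) = a * \<gamma> y + sin \<theta> * \<beta>1 y" for y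
    unfolding \<beta>1_def \<gamma>_def ax using jk by (simp_all only: if_True if_False kk refl) (simp_all add: algebra_simps)
  have upj: "\<beta>1 (y + axis j 1) + \<beta>1 (y - axis j 1) = 2 * b * \<beta>1 y" "\<gamma> (y + axis j 1) + \<gamma> (y - axis j 1) = 2 * b * \<gamma> y" for y
    unfolding \<beta>1_def \<gamma>_def ax using jk[symmetric] by (simp_all only: if_True if_False refl distrib_left[symmetric] jj) simp_all
  have upi: "\<beta>1 (y + axis i 1) = \<beta>1 y" "\<beta>1 (y - axis i 1) = \<beta>1 y" "\<gamma> (y + axis i 1) = \<gamma> y" "\<gamma> (y - axis i 1) = \<gamma> y"
    if "i \<noteq> k" "i \<noteq> j" for y i
    unfolding \<beta>1_def \<gamma>_def ax using that by simp_all
  define \<nu> where "\<nu> = 2 * c * (2 - a - b)"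
  have \<nu>: "0 < \<nu>" using c ab b by (simp add: \<nu>_def)
  have eig: "g y - step k (\<lambda>_. 0) g y = \<nu> * g y"
    if k: "g (y + axis k 1) + g (y - axis k 1) = 2 * a * g y" and j: "g (y + axis j 1) + g (y - axis j 1) = 2 * b * g y"
      and i: "\<And>i. i \<noteq> k \<Longrightarrow> i \<noteq> j \<Longrightarrow> g (y + axis i 1) = g y" "\<And>i. i \<noteq> k \<Longrightarrow> i \<noteq> j \<Longrightarrow> g (y - axis i 1) = g y"
    for g y
  proof -
    have "step k (\<lambda>_. 0) g y = (\<Sum>i\<in>UNIV. c * (g (y + axis i 1) + g (y - axis i 1)))"
      by (simp add: step_alt c_def)
    also have "\<dots> = (\<Sum>i\<in>UNIV. c * (2 * g y) + (if i = k then c * (2 * a * g y - 2 * g y) else 0) + (if i = j then c * (2 * b * g y - 2 * g y) else 0))"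
    proof (intro sum.cong refl)
      fix i
      have "g (y + axis i 1) + g (y - axis i 1)
        = 2 * g y + (if i = k then 2 * a * g y - 2 * g y else 0) + (if i = j then 2 * b * g y - 2 * g y else 0)"
        using jk k j i by (cases "i = k"; cases "i = j") simp_all
      then show "c * (g (y + axis i 1) + g (y - axis i 1))
        = c * (2 * g y) + (if i = k then c * (2 * a * g y - 2 * g y) else 0) + (if i = j then c * (2 * b * g y - 2 * g y) else 0)"
        by (simp add: distrib_left)
    qed
    also have "\<dots> = real CARD('n) * (c * (2 * g y)) + c * (2 * a * g y - 2 * g y) + c * (2 * b * g y - 2 * g y)"
      by (simp add: sum.distrib)
    also have "real CARD('n) * (c * (2 * g y)) = g y" by (simp add: c_def)
    finally show ?thesis by (simp add: \<nu>_def algebra_simps)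
  qed
  have eig\<beta>: "\<beta>1 y - step k (\<lambda>_. 0) \<beta>1 y = \<nu> * \<beta>1 y" and eig\<gamma>: "\<gamma> y - step k (\<lambda>_. 0) \<gamma> y = \<nu> * \<gamma> y" for y
    by (rule eig; simp add: upk upj upi)+
  interpret sym: odd_walk k L "\<lambda>_. 0"
    by unfold_locales (use L in auto)
  define \<phi>1 where "\<phi>1 y = 2 / \<nu> * \<beta>1 y" for y
  define \<psi>1 where "\<psi>1 y = 4 * c * sin \<theta> / \<nu>\<^sup>2 * \<gamma> y" for y
  have p1: "periodic L \<phi>1" "periodic L \<psi>1" unfolding \<phi>1_def \<psi>1_def by (intro periodic_intros per)+
  have d\<phi>1: "\<phi>1 (y + axis k 1) - \<phi>1 (y - axis k 1) = 4 * sin \<theta> / \<nu> * \<gamma> y"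
    "\<phi>1 (y + axis k 1) + \<phi>1 (y - axis k 1) = 4 * a / \<nu> * \<beta>1 y" for y
    by (simp_all add: \<phi>1_def upk algebra_simps add_divide_distrib diff_divide_distrib)
  have d\<psi>1: "\<psi>1 (y + axis k 1) - \<psi>1 (y - axis k 1) = - (8 * c * (sin \<theta>)\<^sup>2 / \<nu>\<^sup>2) * \<beta>1 y" for y
    by (simp add: \<psi>1_def upk algebra_simps power2_eq_square[of "sin \<theta>"] add_divide_distrib diff_divide_distrib)
  have e\<phi>1: "\<phi>1 y - step k (\<lambda>_. 0) \<phi>1 y = 2 * \<beta>1 y" for y
  proof -
    have "\<phi>1 y - step k (\<lambda>_. 0) \<phi>1 y = 2 / \<nu> * (\<beta>1 y - step k (\<lambda>_. 0) \<beta>1 y)"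
      unfolding \<phi>1_def step_cmult by (simp only: right_diff_distrib)
    then show ?thesis unfolding eig\<beta> using \<nu> by simp
  qed
  have e\<psi>1: "\<psi>1 y - step k (\<lambda>_. 0) \<psi>1 y = c * (\<phi>1 (y + axis k 1) - \<phi>1 (y - axis k 1))" for y
  proof -
    have "\<psi>1 y - step k (\<lambda>_. 0) \<psi>1 y = 4 * c * sin \<theta> / \<nu>\<^sup>2 * (\<gamma> y - step k (\<lambda>_. 0) \<gamma> y)"
      unfolding \<psi>1_def step_cmult by (simp only: right_diff_distrib)
    then show ?thesis unfolding eig\<gamma> d\<phi>1 using \<nu> by (simp add: power2_eq_square)
  qed
  \<comment> \<open>The existence of \<open>\<phi>2\<close> suffices: it enters \<open>g\<close>
    through a difference of shifts, whose sum over the torus is zero.\<close>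
  have "\<exists>\<phi>2. periodic L \<phi>2 \<and> (\<forall>y. \<phi>2 (reflect k L y) = - \<phi>2 y) \<and>
      (\<forall>y. \<phi>2 y - step k (\<lambda>_. 0) \<phi>2 y = \<beta>1 y * (\<phi>1 (y + axis k 1) - \<phi>1 (y - axis k 1)))"
    unfolding d\<phi>1 by (rule sym.odd_poisson_solvable) (intro periodic_intros per, simp add: odd even)
  then obtain \<phi>2 where p2: "periodic L \<phi>2" and e\<phi>2: "\<And>y. \<phi>2 y - step k (\<lambda>_. 0) \<phi>2 y = \<beta>1 y * (\<phi>1 (y + axis k 1) - \<phi>1 (y - axis k 1))"
    by blast
  define g where "g y = \<beta>1 y * (\<psi>1 (y + axis k 1) - \<psi>1 (y - axis k 1)) + c * (\<phi>2 (y + axis k 1) - \<phi>2 (y - axis k 1))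
    + \<beta>1 y * (\<phi>1 (y + axis k 1) + \<phi>1 (y - axis k 1))" for y
  have pg: "periodic L g" unfolding g_def by (intro periodic_intros per p1 p2)
  obtain \<psi>2 c2 where p3: "periodic L \<psi>2" and e\<psi>2: "\<And>y. \<psi>2 y - step k (\<lambda>_. 0) \<psi>2 y = g y - c2"
    using sym.poisson_solvable[OF pg] by blast
  \<comment> \<open>\<open>A\<close> is the coefficient of the square of \<open>\<beta>1\<close> in
    \<open>g\<close>, so \<open>c2\<close> is \<open>A\<close> times the mean of that square. Its
    sign is that of \<open>(2 * a - 1) + a * (- b)\<close>.\<close>
  define A where "A = 4 * a / \<nu> - 8 * c * (sin \<theta>)\<^sup>2 / \<nu>\<^sup>2"
  have A: "0 < A"
  proof -
    have "A = 4 / \<nu>\<^sup>2 * (a * \<nu> - 2 * c * (sin \<theta>)\<^sup>2)"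
      using \<nu> by (simp add: A_def field_simps power2_eq_square)
    also have "(sin \<theta>)\<^sup>2 = 1 - a\<^sup>2" by (simp add: a_def sin_squared_eq)
    also have "a * \<nu> - 2 * c * (1 - a\<^sup>2) = 2 * c * ((2 * a - 1) + a * (- b))"
      by (simp add: \<nu>_def algebra_simps power2_eq_square)
    also have "4 / \<nu>\<^sup>2 * (2 * c * ((2 * a - 1) + a * (- b))) > 0"
      using \<nu> c a b by (intro mult_pos_pos add_nonneg_pos) auto
    finally show ?thesis .
  qed
  have "real (card (torus L)) * c2 = (\<Sum>y\<in>torus L. g y)"
  proof -
    have "(\<Sum>y\<in>torus L. g y - c2) = 0"
      unfolding e\<psi>2[symmetric] sum_subtractf sum_torus_symmetric_step[OF L p3] by simp
    then show ?thesis by (simp add: sum_subtractf)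
  qed
  also have "(\<Sum>y\<in>torus L. g y) = (\<Sum>y\<in>torus L. A * (\<beta>1 y)\<^sup>2 + c * (\<phi>2 (y + axis k 1) - \<phi>2 (y - axis k 1)))"
    unfolding g_def d\<psi>1 d\<phi>1 A_def by (intro sum.cong refl) (simp add: algebra_simps power2_eq_square[of "\<beta>1 _"])
  also have "\<dots> = A * (\<Sum>y\<in>torus L. (\<beta>1 y)\<^sup>2)"
    by (simp add: sum.distrib sum_distrib_left[symmetric] sum_subtractf sum_torus_shift[OF L p2] sum_torus_shift_minus[OF L p2])
  finally have c2: "real (card (torus L)) * c2 = A * (\<Sum>y\<in>torus L. (\<beta>1 y)\<^sup>2)" .
  have "0 < (\<Sum>y\<in>torus L. (\<beta>1 y)\<^sup>2)"
  proof (rule sum_pos2[of _ 0])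
    show "finite (torus L)" by (rule finite_torus)
    show "(0 :: int ^ 'n) \<in> torus L" using L by (auto simp: torus_def Suc_le_eq)
    have "0 < sin (\<theta> / 2)" using \<theta> pi_gt_zero by (intro sin_gt_zero) linarith+
    then show "0 < (\<beta>1 0)\<^sup>2" by (simp add: \<beta>1_def)
  qed simp
  then have "0 < real (card (torus L)) * c2" unfolding c2 using A by simp
  then have c2pos: "0 < c2" by (simp add: zero_less_mult_iff)
  have "\<exists>t. 0 < t \<and> t < c \<and> (\<forall>\<phi> \<psi> q. cell k (\<lambda>y. t * \<beta>1 y) \<phi> \<psi> q \<longrightarrow> periodic L \<phi> \<longrightarrow> periodic L (\<psi> k) \<longrightarrow> c < q)"
    unfolding c_def
    by (rule perturbation_lower_bound[OF L per(1) bd odd p1(1) p2 p1(2) p3 e\<phi>1 e\<phi>2 e\<psi>1[unfolded c_def] e\<psi>2[unfolded g_def c_def] c2pos])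
  then obtain t where t: "0 < t" "t < c" and big: "\<And>\<phi> \<psi> q. cell k (\<lambda>y. t * \<beta>1 y) \<phi> \<psi> q \<Longrightarrow> periodic L \<phi> \<Longrightarrow> periodic L (\<psi> k) \<Longrightarrow> c < q"
    by blast
  have adm: "admissible k L (\<lambda>y. t * \<beta>1 y)"
    unfolding admissible_def
  proof (intro conjI ballI)
    have "(SUP \<omega>\<in>torus L. \<bar>t * \<beta>1 \<omega>\<bar>) \<le> t"
    proof (rule cSUP_least)
      show "torus L \<noteq> {}" using torus_wrap[OF L] by blast
      show "\<bar>t * \<beta>1 \<omega>\<bar> \<le> t" for \<omega> using t mult_left_mono[OF bd[of \<omega>], of t] by (simp add: abs_mult)
    qed
    then show "(SUP \<omega>\<in>torus L. \<bar>t * \<beta>1 \<omega>\<bar>) < 1 / (2 * real CARD('n))" using t by (simp add: c_def)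
    show "t * \<beta>1 x = - (t * \<beta>1 (reflect k L x))" for x by (simp add: odd)
  qed
  have eq: "(\<lambda>y. t * \<beta>1 (wrap L y)) = (\<lambda>y. t * \<beta>1 y)" using per(1) by (simp add: periodic_def)
  interpret odd_walk k L "\<lambda>y. t * \<beta>1 y" using admissible_odd_walk[OF L adm] unfolding eq .
  obtain \<phi> \<psi> q where sol: "periodic L \<phi>" "\<And>i. periodic L (\<psi> i)" "cell k (\<lambda>y. t * \<beta>1 y) \<phi> \<psi> q"
    using cell_exists by blast
  have "effective_diffusion k L (\<lambda>y. t * \<beta>1 y) = q"
    by (rule effective_diffusion_cell[of L "\<lambda>y. t * \<beta>1 y", where \<phi>=\<phi> and \<psi>=\<psi>, unfolded eq]) (use sol walk_axioms in auto)
  then show ?thesis using big[OF sol(3,1,2)] adm by blast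
qed

section \<open>Assembling the four statements\<close>

lemma effective_diffusion_cellE:
  fixes k :: "'n::finite" and L :: "'n \<Rightarrow> nat"
  assumes "\<forall>i. L i > 0" "admissible k L b"
  obtains \<phi> \<psi> where "odd_walk k L (\<lambda>y. b (wrap L y))" "periodic L \<phi>" "\<And>i. periodic L (\<psi> i)"
    "\<And>y. \<phi> (reflect k L y) = - \<phi> y" "cell k (\<lambda>y. b (wrap L y)) \<phi> \<psi> (effective_diffusion k L b)"
proof -
  interpret odd_walk k L "\<lambda>y. b (wrap L y)" using admissible_odd_walk[OF assms] .
  obtain \<phi> \<psi> q where sol: "periodic L \<phi>" "\<And>y. \<phi> (reflect k L y) = - \<phi> y" "\<And>i. periodic L (\<psi> i)"
    "cell k (\<lambda>y. b (wrap L y)) \<phi> \<psi> q"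
    using cell_exists by blast
  have "effective_diffusion k L b = q"
    by (rule effective_diffusion_cell[where \<phi>=\<phi> and \<psi>=\<psi>]) (use sol walk_axioms in auto)
  then show ?thesis using that[OF odd_walk_axioms] sol by blast
qed

theorem theorem1p2:
  fixes k :: "'n::finite" and L :: "'n \<Rightarrow> nat"
  assumes "\<forall>i. L i > 0"
  shows
    "(CARD('n) = 1 \<longrightarrow>
        (\<forall>b. admissible k L b \<longrightarrow> effective_diffusion k L b \<le> 1 / 2)) \<and>
     (CARD('n) \<ge> 1 \<and> L k = 2 \<longrightarrow>
        (\<forall>b. admissible k L b \<longrightarrow> effective_diffusion k L b \<le> 1 / (2 * real CARD('n)))) \<and>
     (CARD('n) = 2 \<and> L k = 4 \<longrightarrow>
        (\<forall>b. admissible k L b \<longrightarrow> effective_diffusion k L b \<le> 1 / 4)) \<and>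
     (CARD('n) \<ge> 2 \<and> L k \<ge> 6 \<and> even (L k) \<and> (\<exists>j. j \<noteq> k \<and> L j \<ge> 2) \<longrightarrow>
        (\<exists>b. admissible k L b \<and> effective_diffusion k L b > 1 / (2 * real CARD('n))))"
proof (intro conjI impI allI)
  fix b assume adm: "admissible k L b"
  obtain \<phi> \<psi> where ow: "odd_walk k L (\<lambda>y. b (wrap L y))"
    and pr: "periodic L \<phi>" "\<And>i. periodic L (\<psi> i)" and od: "\<And>y. \<phi> (reflect k L y) = - \<phi> y"
    and cell: "cell k (\<lambda>y. b (wrap L y)) \<phi> \<psi> (effective_diffusion k L b)"
    by (rule effective_diffusion_cellE[OF assms adm]) (rule that)
  interpret odd_walk k L "\<lambda>y. b (wrap L y)" by (rule ow)
  show "effective_diffusion k L b \<le> 1 / 2" if "CARD('n) = 1"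
    by (rule effective_le_dimension_one[OF that cell pr])
  show "effective_diffusion k L b \<le> 1 / (2 * real CARD('n))" if "CARD('n) \<ge> 1 \<and> L k = 2"
    by (rule effective_le_period_two[OF _ cell pr od]) (use that in simp)
  show "effective_diffusion k L b \<le> 1 / 4" if "CARD('n) = 2 \<and> L k = 4"
    by (rule effective_le_period_four[OF _ _ cell pr od]) (use that in simp_all)
next
  assume "CARD('n) \<ge> 2 \<and> L k \<ge> 6 \<and> even (L k) \<and> (\<exists>j. j \<noteq> k \<and> L j \<ge> 2)"
  then show "\<exists>b. admissible k L b \<and> effective_diffusion k L b > 1 / (2 * real CARD('n))"
    using ex_effective_greater[OF assms] by blast
qed

end
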